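(* Let $f$ be a real-valued continuous function on $(0,\infty)$. (i) If $p\geq \frac12$ and $x\mapsto x^{p}f(x^{p})$ is a non-negative operator monotone function on $(0,\infty)$, then $f$ is a Kwong function on $(0,\infty)$. (ii) If $f$ is a Kwong function on $(0,\infty)$ and $0\leq p\leq\frac12$, then $x\mapsto x^{p}f(x^{p})$ is a non-negative operator monotone function on $(0,\infty)$. (iii) If $f$ is a Kwong function on $(0,\infty)$ and $0\leq p\leq\frac12$, then $x\mapsto \frac{f(x^{p})}{x^{p}}$ is a non-negative operator monotone decreasing function on $(0,\infty)$.
   Context: All functions are assumed continuous. For self-adjoint operators $A,B$ on a complex Hilbert space, $A\leq B$ means $B-A$ is positive, i.e. $\langle (B-A)x,x\rangle\geq0$ for all $x$. A real-valued function $h$ on an interval $J$ is operator monotone if, for all bounded self-adjoint operators $A,B$ on a complex Hilbert space with spectra in $J$, $A\leq B$ implies $h(A)\leq h(B)$ (functional calculus); it is operator monotone decreasing if $A\leq B$ implies $h(B)\leq h(A)$, i.e. if $-h$ is operator monotone. The Hilbert space is arbitrary. A real-valued function $f$ on $(0,\infty)$ is a Kwong (anti-Löwner) function if for every $n$ and all distinct $x_1,\dots,x_n\in(0,\infty)$ the $n\times n$ matrix $K_f=\left[\frac{f(x_i)+f(x_j)}{x_i+x_j}\right]_{i,j=1}^{n}$ is positive (semidefinite). *)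

theory Defs
  imports "HOL-Analysis.Analysis"
begin

section \<open>Complex Hilbert spaces\<close>

text \<open>
  A complex Hilbert space is presented on top of its underlying real Hilbert space
  (\<open>real_inner\<close> and \<open>complete_space\<close>): the real structure is the restriction of the complex
  one, and the real inner product is the real part of the complex one, so that the norm is
  \<open>norm x = sqrt (Re (cinner x x))\<close>.  The inner product is linear in its first argument.
\<close>

class complex_hilbert_space = real_inner + complete_space +
  fixes scaleC :: "complex \<Rightarrow> 'a \<Rightarrow> 'a"  (infixr \<open>*\<^sub>C\<close> 75)
    and cinner :: "'a \<Rightarrow> 'a \<Rightarrow> complex"
  assumes scaleC_add_right: "c *\<^sub>C (x + y) = c *\<^sub>C x + c *\<^sub>C y"
    and scaleC_add_left: "(c + d) *\<^sub>C x = c *\<^sub>C x + d *\<^sub>C x"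
    and scaleC_scaleC: "c *\<^sub>C (d *\<^sub>C x) = (c * d) *\<^sub>C x"
    and scaleR_scaleC: "r *\<^sub>R x = complex_of_real r *\<^sub>C x"
    and cinner_commute: "cinner x y = cnj (cinner y x)"
    and cinner_add_left: "cinner (x + y) z = cinner x z + cinner y z"
    and cinner_scaleC_left: "cinner (c *\<^sub>C x) y = c * cinner x y"
    and inner_eq_Re_cinner: "inner x y = Re (cinner x y)"

definition infinite_dimensional :: "'h::complex_hilbert_space itself \<Rightarrow> bool" where
  "infinite_dimensional _ \<longleftrightarrow>
     \<not> (\<exists>B::'h set. finite B \<and> (\<forall>x. \<exists>c. x = (\<Sum>b\<in>B. c b *\<^sub>C b)))"


section \<open>Bounded self-adjoint operators and continuous functional calculus\<close>

definition bounded_clinear :: "('h::complex_hilbert_space \<Rightarrow> 'h) \<Rightarrow> bool" where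
  "bounded_clinear A \<longleftrightarrow> bounded_linear A \<and> (\<forall>c x. A (c *\<^sub>C x) = c *\<^sub>C A x)"

definition selfadjoint :: "('h::complex_hilbert_space \<Rightarrow> 'h) \<Rightarrow> bool" where
  "selfadjoint A \<longleftrightarrow> bounded_clinear A \<and> (\<forall>x y. cinner (A x) y = cinner x (A y))"

definition positive_op :: "('h::complex_hilbert_space \<Rightarrow> 'h) \<Rightarrow> bool" where
  "positive_op A \<longleftrightarrow> (\<forall>x. cinner (A x) x \<in> \<real>\<^sub>\<ge>\<^sub>0)"

definition op_le :: "('h::complex_hilbert_space \<Rightarrow> 'h) \<Rightarrow> ('h \<Rightarrow> 'h) \<Rightarrow> bool" where
  "op_le A B \<longleftrightarrow> positive_op (\<lambda>x. B x - A x)"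

definition op_spectrum :: "('h::complex_hilbert_space \<Rightarrow> 'h) \<Rightarrow> complex set" where
  "op_spectrum A =
     {z. \<not> (\<exists>R. bounded_clinear R \<and> (\<forall>x. R (A x - z *\<^sub>C x) = x) \<and> (\<forall>x. A (R x) - z *\<^sub>C R x = x))}"

definition poly_op :: "real poly \<Rightarrow> ('h::complex_hilbert_space \<Rightarrow> 'h) \<Rightarrow> 'h \<Rightarrow> 'h" where
  "poly_op q A x = (\<Sum>i\<le>degree q. coeff q i *\<^sub>R (A ^^ i) x)"

text \<open>
  For self-adjoint \<open>A\<close> and \<open>h\<close> continuous on the (real, compact) spectrum of \<open>A\<close>, \<open>h(A)\<close> is
  the limit in operator norm of \<open>q\<^sub>n(A)\<close> for real polynomials \<open>q\<^sub>n\<close> that converge to \<open>h\<close>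
  uniformly on the spectrum.  Such \<open>q\<^sub>n\<close> exist by Weierstrass' theorem, which makes the limit
  unique.  For other \<open>A\<close> or \<open>h\<close> the value is irrelevant.
\<close>

definition fun_calc :: "(real \<Rightarrow> real) \<Rightarrow> ('h::complex_hilbert_space \<Rightarrow> 'h) \<Rightarrow> 'h \<Rightarrow> 'h" where
  "fun_calc h A = (THE T. bounded_clinear T \<and>
     (\<forall>q :: nat \<Rightarrow> real poly.
        uniform_limit {t. complex_of_real t \<in> op_spectrum A} (\<lambda>n. poly (q n)) h sequentially \<longrightarrow>
        (\<lambda>n. onorm (\<lambda>x. poly_op (q n) A x - T x)) \<longlonglongrightarrow> 0))"


section \<open>Operator monotone functions and Kwong functions\<close>

text \<open>
  Operator monotonicity refers to the operators on the Hilbert space \<open>'h\<close>; quantification over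
  all Hilbert spaces is quantification over the type variable \<open>'h\<close>.  Such a quantification is
  not available inside a formula, for a hypothesis.  A function that is operator monotone on all
  Hilbert spaces is so in particular on any given infinite-dimensional \<open>'h\<close>, so a hypothesis of
  operator monotonicity is imposed on one arbitrary infinite-dimensional \<open>'h\<close> only; this is the
  role of \<open>infinite_dimensional\<close> (a single finite-dimensional space would not suffice).  Continuity is part of the
  notion because all functions are assumed continuous.
\<close>

definition operator_monotone_on ::
    "'h::complex_hilbert_space itself \<Rightarrow> real set \<Rightarrow> (real \<Rightarrow> real) \<Rightarrow> bool" where
  "operator_monotone_on _ J h \<longleftrightarrow> continuous_on J h \<and>
     (\<forall>A B :: 'h \<Rightarrow> 'h. selfadjoint A \<longrightarrow> selfadjoint B \<longrightarrow>
        op_spectrum A \<subseteq> complex_of_real ` J \<longrightarrow> op_spectrum B \<subseteq> complex_of_real ` J \<longrightarrow>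
        op_le A B \<longrightarrow> op_le (fun_calc h A) (fun_calc h B))"

definition operator_monotone_decreasing_on ::
    "'h::complex_hilbert_space itself \<Rightarrow> real set \<Rightarrow> (real \<Rightarrow> real) \<Rightarrow> bool" where
  "operator_monotone_decreasing_on _ J h \<longleftrightarrow> continuous_on J h \<and>
     (\<forall>A B :: 'h \<Rightarrow> 'h. selfadjoint A \<longrightarrow> selfadjoint B \<longrightarrow>
        op_spectrum A \<subseteq> complex_of_real ` J \<longrightarrow> op_spectrum B \<subseteq> complex_of_real ` J \<longrightarrow>
        op_le A B \<longrightarrow> op_le (fun_calc h B) (fun_calc h A))"

definition nonneg_on :: "real set \<Rightarrow> (real \<Rightarrow> real) \<Rightarrow> bool" where
  "nonneg_on J h \<longleftrightarrow> (\<forall>x\<in>J. 0 \<le> h x)"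

text \<open>
  Positivity of a real \<open>n \<times> n\<close> matrix, indexed by \<open>{..<n}\<close>, as an operator on
  \<open>n\<close>-dimensional complex space.
\<close>

definition positive_matrix :: "nat \<Rightarrow> (nat \<Rightarrow> nat \<Rightarrow> real) \<Rightarrow> bool" where
  "positive_matrix n K \<longleftrightarrow>
     (\<forall>c :: nat \<Rightarrow> complex.
        (\<Sum>i<n. (\<Sum>j<n. complex_of_real (K i j) * c j) * cnj (c i)) \<in> \<real>\<^sub>\<ge>\<^sub>0)"

definition kwong_function :: "(real \<Rightarrow> real) \<Rightarrow> bool" where
  "kwong_function f \<longleftrightarrow> continuous_on {0<..} f \<and>
     (\<forall>n. \<forall>x :: nat \<Rightarrow> real. (\<forall>i<n. 0 < x i) \<longrightarrow> inj_on x {..<n} \<longrightarrow>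
        positive_matrix n (\<lambda>i j. (f (x i) + f (x j)) / (x i + x j)))"


section \<open>The sequence space as an infinite-dimensional Hilbert space\<close>

text \<open>
  The following instance shows that there are Hilbert space types satisfying
  \<open>infinite_dimensional\<close>, so that statements about all of them are not vacuous.
\<close>

typedef ell2 = "{x :: nat \<Rightarrow> complex. summable (\<lambda>n. (cmod (x n))\<^sup>2)}"
  morphisms ell2_nth Abs_ell2
  by (rule exI[of _ "\<lambda>_. 0"]) simp

lemma summable_ell2: "summable (\<lambda>n. (cmod (ell2_nth x n))\<^sup>2)"
  using ell2_nth[of x] by simp

lemma ell2_nth_Abs: "summable (\<lambda>n. (cmod (x n))\<^sup>2) \<Longrightarrow> ell2_nth (Abs_ell2 x) = x"
  by (simp add: Abs_ell2_inverse)

lemma ell2_eqI: "(\<And>n. ell2_nth x n = ell2_nth y n) \<Longrightarrow> x = y"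
  by (metis ell2_nth_inject ext)

lemma summable_cmod_mult:
  assumes "summable (\<lambda>n. (cmod (x n))\<^sup>2)" "summable (\<lambda>n. (cmod (y n))\<^sup>2)"
  shows "summable (\<lambda>n::nat. cmod (x n) * cmod (y n))"
proof (rule summable_comparison_test')
  show "summable (\<lambda>n. (cmod (x n))\<^sup>2 + (cmod (y n))\<^sup>2)"
    using assms by (rule summable_add)
  show "norm (cmod (x n) * cmod (y n)) \<le> (cmod (x n))\<^sup>2 + (cmod (y n))\<^sup>2" if "n \<ge> 0" for n
    using sum_squares_bound[of "cmod (x n)" "cmod (y n)"]
      mult_nonneg_nonneg[OF norm_ge_zero[of "x n"] norm_ge_zero[of "y n"]]
    by (simp only: real_norm_def abs_of_nonneg mult.assoc)
qed

lemma summable_ell2_mult: "summable (\<lambda>n. ell2_nth x n * cnj (ell2_nth y n))"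
  by (rule summable_norm_cancel)
    (use summable_cmod_mult[OF summable_ell2 summable_ell2] in \<open>simp add: norm_mult\<close>)

lemma summable_cmod_add:
  assumes "summable (\<lambda>n. (cmod (x n))\<^sup>2)" "summable (\<lambda>n. (cmod (y n))\<^sup>2)"
  shows "summable (\<lambda>n::nat. (cmod (x n + y n))\<^sup>2)"
proof (rule summable_comparison_test')
  show "summable (\<lambda>n. (cmod (x n))\<^sup>2 + (cmod (y n))\<^sup>2 + 2 * (cmod (x n) * cmod (y n)))"
    by (intro summable_add summable_mult assms summable_cmod_mult)
  show "norm ((cmod (x n + y n))\<^sup>2)
      \<le> (cmod (x n))\<^sup>2 + (cmod (y n))\<^sup>2 + 2 * (cmod (x n) * cmod (y n))" if "n \<ge> 0" for n
    using power_mono[OF norm_triangle_ineq[of "x n" "y n"], of 2]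
    by (simp add: power2_sum mult.assoc)
qed

lemma summable_cmod_cmult:
  assumes "summable (\<lambda>n. (cmod (x n))\<^sup>2)"
  shows "summable (\<lambda>n::nat. (cmod (c * x n))\<^sup>2)"
  using summable_mult[OF assms, of "(cmod c)\<^sup>2"] by (simp add: norm_mult power_mult_distrib)

instantiation ell2 :: real_inner
begin

definition "0 = Abs_ell2 (\<lambda>_. 0)"
definition "x + y = Abs_ell2 (\<lambda>n. ell2_nth x n + ell2_nth y n)"
definition "- x = Abs_ell2 (\<lambda>n. - ell2_nth x n)" for x :: ell2
definition "x - y = x + - y" for x y :: ell2
definition "r *\<^sub>R x = Abs_ell2 (\<lambda>n. complex_of_real r * ell2_nth x n)"
definition "inner x y = Re (\<Sum>n. ell2_nth x n * cnj (ell2_nth y n))"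
definition "norm x = sqrt (inner x x)" for x :: ell2
definition "sgn x = scaleR (inverse (norm x)) x" for x :: ell2
definition "dist x y = norm (x - y)" for x y :: ell2
definition "uniformity = (INF e\<in>{0 <..}. principal {(x, y). dist (x::ell2) y < e})"
definition "open U \<longleftrightarrow> (\<forall>x\<in>U. eventually (\<lambda>(x', y). x' = x \<longrightarrow> y \<in> U) uniformity)"
  for U :: "ell2 set"

lemma ell2_nth_zero: "ell2_nth 0 n = 0"
  by (simp add: zero_ell2_def ell2_nth_Abs)

lemma ell2_nth_add: "ell2_nth (x + y) n = ell2_nth x n + ell2_nth y n"
  by (simp add: plus_ell2_def ell2_nth_Abs summable_cmod_add summable_ell2)

lemma ell2_nth_uminus: "ell2_nth (- x) n = - ell2_nth x n"
  by (simp add: uminus_ell2_def ell2_nth_Abs summable_ell2)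

lemma ell2_nth_diff: "ell2_nth (x - y) n = ell2_nth x n - ell2_nth y n"
  by (simp add: minus_ell2_def ell2_nth_add ell2_nth_uminus)

lemma ell2_nth_scaleR: "ell2_nth (r *\<^sub>R x) n = complex_of_real r * ell2_nth x n"
  unfolding scaleR_ell2_def
  by (subst ell2_nth_Abs) (rule summable_cmod_cmult summable_ell2 refl)+

lemmas ell2_nth_simps =
  ell2_nth_zero ell2_nth_add ell2_nth_uminus ell2_nth_diff ell2_nth_scaleR

lemma ell2_inner_self: "inner x x = (\<Sum>n. (cmod (ell2_nth x n))\<^sup>2)" for x :: ell2
proof -
  have "(\<Sum>n. ell2_nth x n * cnj (ell2_nth x n)) =
      (\<Sum>n. complex_of_real ((cmod (ell2_nth x n))\<^sup>2))"
    by (simp only: complex_norm_square)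
  also have "\<dots> = complex_of_real (\<Sum>n. (cmod (ell2_nth x n))\<^sup>2)"
    by (rule suminf_of_real[OF summable_ell2, symmetric])
  finally show ?thesis by (simp add: inner_ell2_def)
qed

instance
proof
  fix x y z :: ell2 and a b :: real
  show "x + y + z = x + (y + z)" "x + y = y + x" "0 + x = x" "- x + x = 0" "x - y = x + - y"
    "a *\<^sub>R (x + y) = a *\<^sub>R x + a *\<^sub>R y" "(a + b) *\<^sub>R x = a *\<^sub>R x + b *\<^sub>R x"
    "a *\<^sub>R b *\<^sub>R x = (a * b) *\<^sub>R x" "1 *\<^sub>R x = x"
    by (rule ell2_eqI; simp add: ell2_nth_simps algebra_simps)+
  show "dist x y = norm (x - y)" "sgn x = scaleR (inverse (norm x)) x" "norm x = sqrt (inner x x)"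
    by (fact dist_ell2_def sgn_ell2_def norm_ell2_def)+
  show "uniformity = (INF e\<in>{0 <..}. principal {(x, y). dist (x::ell2) y < e})"
    by (fact uniformity_ell2_def)
  show "open U \<longleftrightarrow> (\<forall>x\<in>U. eventually (\<lambda>(x', y). x' = x \<longrightarrow> y \<in> U) uniformity)" for U :: "ell2 set"
    by (fact open_ell2_def)
  show "inner x y = inner y x"
  proof -
    have "(\<lambda>n. cnj (ell2_nth y n * cnj (ell2_nth x n)))
        sums cnj (\<Sum>n. ell2_nth y n * cnj (ell2_nth x n))"
      unfolding sums_cnj by (rule summable_sums[OF summable_ell2_mult])
    then have "(\<Sum>n. ell2_nth x n * cnj (ell2_nth y n)) =
        cnj (\<Sum>n. ell2_nth y n * cnj (ell2_nth x n))"
      by (simp add: sums_iff mult.commute)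
    then show ?thesis by (simp add: inner_ell2_def)
  qed
  show "inner (x + y) z = inner x z + inner y z"
    using suminf_add[OF summable_ell2_mult[of x z] summable_ell2_mult[of y z], symmetric]
    by (simp add: inner_ell2_def ell2_nth_simps distrib_right)
  show "inner (a *\<^sub>R x) y = a * inner x y"
    using suminf_mult[OF summable_ell2_mult[of x y], of "complex_of_real a"]
    by (simp add: inner_ell2_def ell2_nth_simps mult.assoc)
  show "0 \<le> inner x x"
    by (simp add: ell2_inner_self suminf_nonneg summable_ell2)
  show "(inner x x = 0) = (x = 0)"
    by (auto simp: ell2_inner_self suminf_eq_zero_iff summable_ell2 ell2_nth_zero intro!: ell2_eqI)
qed

end

lemma ell2_norm_square: "(norm x)\<^sup>2 = (\<Sum>n. (cmod (ell2_nth x n))\<^sup>2)" for x :: ell2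
  by (simp only: dot_square_norm[symmetric] ell2_inner_self)

lemma ell2_sum_le_norm: "(\<Sum>n<k. (cmod (ell2_nth x n))\<^sup>2) \<le> (norm x)\<^sup>2"
  unfolding ell2_norm_square by (rule sum_le_suminf) (auto simp: summable_ell2)

lemma ell2_nth_le_norm: "cmod (ell2_nth x n) \<le> norm x"
proof -
  have "(cmod (ell2_nth x n))\<^sup>2 \<le> (\<Sum>m<Suc n. (cmod (ell2_nth x m))\<^sup>2)"
    by (simp add: sum_nonneg)
  also have "\<dots> \<le> (norm x)\<^sup>2" by (rule ell2_sum_le_norm)
  finally show ?thesis by (simp add: power2_le_iff_abs_le)
qed

instance ell2 :: complete_space
proof
  fix X :: "nat \<Rightarrow> ell2"
  assume X: "Cauchy X"
  have "Cauchy (\<lambda>m. ell2_nth (X m) n)" for n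
  proof (rule metric_CauchyI)
    fix e :: real assume "e > 0"
    then obtain M where "\<forall>i\<ge>M. \<forall>j\<ge>M. dist (X i) (X j) < e" using X metric_CauchyD by blast
    moreover have "dist (ell2_nth (X i) n) (ell2_nth (X j) n) \<le> dist (X i) (X j)" for i j
      using ell2_nth_le_norm[of "X i - X j" n] by (simp add: dist_norm ell2_nth_diff)
    ultimately show "\<exists>M. \<forall>i\<ge>M. \<forall>j\<ge>M. dist (ell2_nth (X i) n) (ell2_nth (X j) n) < e"
      by (meson le_less_trans)
  qed
  then have "\<forall>n. \<exists>l. (\<lambda>m. ell2_nth (X m) n) \<longlonglongrightarrow> l"
    using Cauchy_convergent convergent_def by blast
  then obtain L where L: "\<And>n. (\<lambda>m. ell2_nth (X m) n) \<longlonglongrightarrow> L n" by metis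
  have key: "\<exists>M. \<forall>i\<ge>M. \<forall>k. (\<Sum>n<k. (cmod (ell2_nth (X i) n - L n))\<^sup>2) \<le> e\<^sup>2"
    if e: "e > 0" for e :: real
  proof -
    obtain M where M: "\<And>i j. i \<ge> M \<Longrightarrow> j \<ge> M \<Longrightarrow> dist (X i) (X j) < e"
      using X e metric_CauchyD by blast
    have "(\<Sum>n<k. (cmod (ell2_nth (X i) n - L n))\<^sup>2) \<le> e\<^sup>2" if "i \<ge> M" for i k
    proof (rule LIMSEQ_le_const2)
      show "(\<lambda>j. \<Sum>n<k. (cmod (ell2_nth (X i) n - ell2_nth (X j) n))\<^sup>2)
          \<longlonglongrightarrow> (\<Sum>n<k. (cmod (ell2_nth (X i) n - L n))\<^sup>2)"
        by (intro tendsto_intros L)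
      have "(\<Sum>n<k. (cmod (ell2_nth (X i) n - ell2_nth (X j) n))\<^sup>2) \<le> e\<^sup>2" if "j \<ge> M" for j
      proof -
        have "(\<Sum>n<k. (cmod (ell2_nth (X i) n - ell2_nth (X j) n))\<^sup>2) \<le> (norm (X i - X j))\<^sup>2"
          using ell2_sum_le_norm[of "X i - X j" k] by (simp add: ell2_nth_diff)
        also have "\<dots> \<le> e\<^sup>2"
          using M[OF \<open>i \<ge> M\<close> that] by (intro power_mono) (auto simp: dist_norm)
        finally show ?thesis .
      qed
      then show "\<exists>N. \<forall>j\<ge>N. (\<Sum>n<k. (cmod (ell2_nth (X i) n - ell2_nth (X j) n))\<^sup>2) \<le> e\<^sup>2"
        by blast
    qed
    then show ?thesis by blast
  qed
  have summ: "summable (\<lambda>n. (cmod (ell2_nth (X i) n - L n))\<^sup>2)"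
    if "\<forall>k. (\<Sum>n<k. (cmod (ell2_nth (X i) n - L n))\<^sup>2) \<le> c" for i c
    by (rule summableI_nonneg_bounded[where x = c]) (use that in auto)
  obtain M where "\<forall>k. (\<Sum>n<k. (cmod (ell2_nth (X M) n - L n))\<^sup>2) \<le> 1"
    using key[of 1] by auto
  then have "summable (\<lambda>n. (cmod (- 1 * (ell2_nth (X M) n - L n)))\<^sup>2)"
    by (intro summable_cmod_cmult summ)
  from summable_cmod_add[OF this summable_ell2[of "X M"]]
  have "summable (\<lambda>n. (cmod (L n))\<^sup>2)" by simp
  then have nth: "ell2_nth (Abs_ell2 L) = L" by (rule ell2_nth_Abs)
  have "X \<longlonglongrightarrow> Abs_ell2 L"
  proof (rule metric_LIMSEQ_I)
    fix e :: real assume e: "e > 0"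
    obtain N where N: "\<And>i k. i \<ge> N \<Longrightarrow> (\<Sum>n<k. (cmod (ell2_nth (X i) n - L n))\<^sup>2) \<le> (e/2)\<^sup>2"
      using key[of "e/2"] e by auto
    have "dist (X i) (Abs_ell2 L) < e" if "i \<ge> N" for i
    proof -
      have bd: "\<forall>k. (\<Sum>n<k. (cmod (ell2_nth (X i) n - L n))\<^sup>2) \<le> (e/2)\<^sup>2"
        using N[OF that] by (rule allI)
      have "(norm (X i - Abs_ell2 L))\<^sup>2 = (\<Sum>n. (cmod (ell2_nth (X i) n - L n))\<^sup>2)"
        by (simp only: ell2_norm_square ell2_nth_diff nth)
      also have "\<dots> \<le> (e/2)\<^sup>2"
        by (rule suminf_le_const[OF summ[OF bd]]) (rule N[OF that])
      finally have "(norm (X i - Abs_ell2 L))\<^sup>2 \<le> (e/2)\<^sup>2" .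
      then have "norm (X i - Abs_ell2 L) \<le> e/2"
        by (rule power2_le_imp_le) (use e in simp)
      then show ?thesis using e by (simp add: dist_norm)
    qed
    then show "\<exists>N. \<forall>i\<ge>N. dist (X i) (Abs_ell2 L) < e" by blast
  qed
  then show "convergent X" by (rule convergentI)
qed

instantiation ell2 :: complex_hilbert_space
begin

definition "c *\<^sub>C x = Abs_ell2 (\<lambda>n. c * ell2_nth x n)"
definition "cinner x y = (\<Sum>n. ell2_nth x n * cnj (ell2_nth y n))"

lemma ell2_nth_scaleC: "ell2_nth (c *\<^sub>C x) n = c * ell2_nth x n"
  unfolding scaleC_ell2_def
  by (subst ell2_nth_Abs) (rule summable_cmod_cmult summable_ell2 refl)+

instance
proof
  fix x y z :: ell2 and c d :: complex and r :: real
  show "c *\<^sub>C (x + y) = c *\<^sub>C x + c *\<^sub>C y" "(c + d) *\<^sub>C x = c *\<^sub>C x + d *\<^sub>C x"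
    "c *\<^sub>C d *\<^sub>C x = (c * d) *\<^sub>C x" "r *\<^sub>R x = complex_of_real r *\<^sub>C x"
    by (rule ell2_eqI; simp add: ell2_nth_simps ell2_nth_scaleC algebra_simps)+
  have "(\<lambda>n. cnj (ell2_nth y n * cnj (ell2_nth x n))) sums cnj (cinner y x)"
    unfolding cinner_ell2_def sums_cnj by (rule summable_sums[OF summable_ell2_mult])
  then show "cinner x y = cnj (cinner y x)"
    by (simp add: cinner_ell2_def sums_iff mult.commute)
  show "cinner (x + y) z = cinner x z + cinner y z"
    using suminf_add[OF summable_ell2_mult[of x z] summable_ell2_mult[of y z], symmetric]
    by (simp add: cinner_ell2_def ell2_nth_simps distrib_right)
  show "cinner (c *\<^sub>C x) y = c * cinner x y"
    using suminf_mult[OF summable_ell2_mult[of x y], of c]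
    by (simp add: cinner_ell2_def ell2_nth_scaleC mult.assoc)
  show "inner x y = Re (cinner x y)" by (simp add: inner_ell2_def cinner_ell2_def)
qed

end

lemma infinite_dimensional_ell2: "infinite_dimensional TYPE(ell2)"
  unfolding infinite_dimensional_def
proof
  assume "\<exists>B::ell2 set. finite B \<and> (\<forall>x. \<exists>c. x = (\<Sum>b\<in>B. c b *\<^sub>C b))"
  then obtain B :: "ell2 set"
    where B: "finite B" "\<And>x. \<exists>c. x = (\<Sum>b\<in>B. c b *\<^sub>C b)" by blast
  define C where "C = B \<union> (\<lambda>b. \<i> *\<^sub>C b) ` B"
  have C: "finite C" using B(1) by (simp add: C_def)
  have span: "x \<in> span C" for x
  proof -
    obtain c where x: "x = (\<Sum>b\<in>B. c b *\<^sub>C b)" using B(2) by blast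
    have "c b *\<^sub>C b = Re (c b) *\<^sub>R b + Im (c b) *\<^sub>R (\<i> *\<^sub>C b)" for b :: ell2
      by (rule ell2_eqI)
        (simp add: ell2_nth_simps ell2_nth_scaleC complex_eq_iff algebra_simps)
    then have "c b *\<^sub>C b \<in> span C" if "b \<in> B" for b
      using that by (metis C_def UnI1 UnI2 image_eqI span_add span_base span_scale)
    then show ?thesis unfolding x by (rule span_sum)
  qed
  define e where "e n = Abs_ell2 (\<lambda>m. if m = n then 1 else 0)" for n
  have e: "ell2_nth (e n) m = (if m = n then 1 else 0)" for n m
  proof -
    have "summable (\<lambda>m. (cmod (if m = n then 1 else 0))\<^sup>2)"
      by (rule summable_finite[of "{n}"]) auto
    then show ?thesis unfolding e_def by (subst ell2_nth_Abs) auto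
  qed
  have "inj e" by (rule injI) (metis e zero_neq_one)
  have "independent (range e)"
    unfolding dependent_def
  proof
    assume "\<exists>a\<in>range e. a \<in> span (range e - {a})"
    then obtain n where n: "e n \<in> span (range e - {e n})" by blast
    have "span (range e - {e n}) \<subseteq> {x. ell2_nth x n = 0}"
      by (rule span_minimal) (auto simp: e subspace_def ell2_nth_simps)
    with n show False by (auto simp: e)
  qed
  then have "finite (range e)"
    using independent_span_bound[OF C] span by blast
  with \<open>inj e\<close> show False by (simp add: finite_image_iff)
qed

end

theory Submission
  imports Defs "HOL-Computational_Algebra.Fundamental_Theorem_Algebra"
begin

text \<open>
  The case \<open>p = 1/2\<close> is the core: \<open>f\<close> is a Kwong function if and only if \<open>g s = sqrt s * f (sqrt s)\<close>
  is non-negative and operator monotone, and in this case \<open>g s / s\<close> is operator monotone decreasing.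
  Loewner's integral representation would reduce everything to the functions \<open>g s = s / (s + l)\<close>, that is
  \<open>f x = x / (x\<^sup>2 + l)\<close>, for which all claims are easy.  The proof replaces the representation by a
  finite duality.

  As a function of \<open>f\<close>, a Kwong form \<open>\<Sum>x. \<Sum>y. c x * c y * (f x + f y) / (x + y)\<close> is a weighted sum of
  values of \<open>f\<close>.  Conversely, each weighted sum of values of \<open>f\<close> that is non-negative on the functions
  \<open>x / (x\<^sup>2 + l)\<close> with \<open>l \<ge> 0\<close> is such a form (\<open>kwong_duality\<close>).  The reason is that a polynomial which
  is non-negative on the half-line splits as \<open>P (- z\<^sup>2) = Q z * Q (- z)\<close> (\<open>nonneg_poly_splits\<close>).

  From Kwong to operator monotone: for \<open>A \<le> B\<close> and a vector \<open>v\<close>, the functional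
  \<open>h \<mapsto> \<langle>h(B) v, v\<rangle> - \<langle>h(A) v, v\<rangle>\<close> is non-negative on \<open>s / (s + l)\<close>, because inversion is antitone.
  A partition of unity approximates it by weighted sums to which the duality applies
  (\<open>functional_nonneg_of_kwong\<close>).  The quotient \<open>g s / s\<close> is treated in the same way with the test functions
  \<open>1 / (s + l)\<close>.

  From operator monotone to Kwong: an operator monotone \<open>g\<close> satisfies Jensen's operator
  inequality for compressions (\<open>operator_jensen\<close>).  Applied to explicit matrices of Cauchy type with
  interlacing eigenvalues, it determines the sign of the divided differences of \<open>g * q\<^sup>2\<close> at an odd number
  of nodes, for polynomials \<open>q\<close> of small degree (\<open>divided_difference_nonpos\<close>).  Given an even number
  of points, a further node is moved to \<open>0\<close> or to infinity; its term has a definite sign because \<open>g\<close> is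
  non-negative, and it can be dropped.  The two inequalities that result, applied to
  the even and the odd part of \<open>Q\<close>, add up to the positivity of the Kwong form.

  Other exponents are reached by a change of variable: \<open>y \<mapsto> y powr e * f (y powr r)\<close> inherits a positive
  kernel from \<open>f\<close> when \<open>\<bar>e\<bar> + \<bar>r\<bar> \<le> 1\<close> (\<open>kwong_kernel_powr_comp\<close>).  By duality this comes down to the
  kernels of the powers \<open>x powr a\<close> with \<open>\<bar>a\<bar> \<le> 1\<close>, which arise from \<open>x\<close> and \<open>1 / x\<close> by geometric
  means and limits.
\<close>


section \<open>Positive Kwong kernels\<close>

text \<open>
  The matrices of the Kwong condition are real and symmetric, so real weights decide their
  positivity.  Finite sets of points replace enumerated points, and continuity is left out so that
  pointwise limits stay in the class.
\<close>

definition kwong_form :: "(real \<Rightarrow> real) \<Rightarrow> (real \<Rightarrow> real) \<Rightarrow> real set \<Rightarrow> real" where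
  "kwong_form f c X = (\<Sum>x\<in>X. \<Sum>y\<in>X. c x * c y * ((f x + f y) / (x + y)))"

definition kwong_kernel :: "(real \<Rightarrow> real) \<Rightarrow> bool" where
  "kwong_kernel f \<longleftrightarrow> (\<forall>X c. finite X \<longrightarrow> X \<subseteq> {0<..} \<longrightarrow> 0 \<le> kwong_form f c X)"

lemma kwong_kernelD: "kwong_kernel f \<Longrightarrow> finite X \<Longrightarrow> X \<subseteq> {0<..} \<Longrightarrow> 0 \<le> kwong_form f c X"
  unfolding kwong_kernel_def by blast

lemma kwong_form_cong:
  assumes "\<And>x. x \<in> X \<Longrightarrow> f x = g x"
  shows "kwong_form f c X = kwong_form g c X"
  unfolding kwong_form_def by (intro sum.cong refl) (simp add: assms)

lemma kwong_kernel_cong: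
  assumes "kwong_kernel f" "\<And>x. 0 < x \<Longrightarrow> f x = g x"
  shows "kwong_kernel g"
  unfolding kwong_kernel_def
proof (intro allI impI)
  fix X c assume X: "finite X" "X \<subseteq> {0::real<..}"
  have "kwong_form g c X = kwong_form f c X"
    by (rule kwong_form_cong) (use X assms(2) in force)
  then show "0 \<le> kwong_form g c X" using kwong_kernelD[OF assms(1) X] by simp
qed

text \<open>The diagonal of a positive kernel is non-negative.\<close>

lemma kwong_kernel_nonneg:
  assumes "kwong_kernel f" "0 < x"
  shows "0 \<le> f x"
  using kwong_kernelD[OF assms(1), of "{x}" "\<lambda>_. 1"] assms(2)
  by (simp add: kwong_form_def zero_le_divide_iff)

lemma kwong_kernel_add:
  assumes "kwong_kernel f" "kwong_kernel g"
  shows "kwong_kernel (\<lambda>x. f x + g x)"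
proof -
  have "kwong_form (\<lambda>x. f x + g x) c X = kwong_form f c X + kwong_form g c X" for c X
    unfolding kwong_form_def sum.distrib[symmetric]
    by (intro sum.cong refl) (simp add: add_divide_distrib algebra_simps)
  then show ?thesis using assms unfolding kwong_kernel_def by simp
qed

lemma kwong_kernel_scale:
  assumes "kwong_kernel f" "0 \<le> a"
  shows "kwong_kernel (\<lambda>x. a * f x)"
proof -
  have "kwong_form (\<lambda>x. a * f x) c X = a * kwong_form f c X" for c X
    unfolding kwong_form_def sum_distrib_left
    by (intro sum.cong refl) (simp add: algebra_simps add_divide_distrib)
  then show ?thesis using assms unfolding kwong_kernel_def by simp
qed

text \<open>
  The kernels of \<open>f\<close> and \<open>1 / f\<close> are congruent:
  \<open>1 / f x + 1 / f y = (f x + f y) / (f x * f y)\<close>.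
\<close>

lemma kwong_kernel_inverse:
  assumes "kwong_kernel f" "\<And>x. 0 < x \<Longrightarrow> 0 < f x"
  shows "kwong_kernel (\<lambda>x. 1 / f x)"
  unfolding kwong_kernel_def
proof (intro allI impI)
  fix X c assume X: "finite X" "X \<subseteq> {0::real<..}"
  have "kwong_form (\<lambda>x. 1 / f x) c X = kwong_form f (\<lambda>x. c x / f x) X"
    unfolding kwong_form_def
  proof (intro sum.cong refl)
    fix x y assume "x \<in> X" "y \<in> X"
    then have "0 < x" "0 < y" using X by auto
    then have "0 < f x" "0 < f y" "0 < x + y" by (auto intro: assms(2))
    then show "c x * c y * ((1 / f x + 1 / f y) / (x + y)) =
        c x / f x * (c y / f y) * ((f x + f y) / (x + y))"
      by (simp add: field_simps)
  qed
  then show "0 \<le> kwong_form (\<lambda>x. 1 / f x) c X" using kwong_kernelD[OF assms(1) X] by simp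
qed

lemma kwong_kernel_limit:
  assumes "\<And>n::nat. kwong_kernel (F n)" "\<And>x. 0 < x \<Longrightarrow> (\<lambda>n. F n x) \<longlonglongrightarrow> f x"
  shows "kwong_kernel f"
  unfolding kwong_kernel_def
proof (intro allI impI)
  fix X c assume X: "finite X" "X \<subseteq> {0::real<..}"
  have "(\<lambda>n. kwong_form (F n) c X) \<longlonglongrightarrow> kwong_form f c X"
    unfolding kwong_form_def using X
    by (intro tendsto_sum tendsto_mult tendsto_const tendsto_divide tendsto_add assms(2))
      (smt (verit) greaterThan_iff subsetD)+
  then show "0 \<le> kwong_form f c X"
    by (rule LIMSEQ_le_const) (use kwong_kernelD[OF assms(1) X] in blast)
qed

lemma kwong_kernel_id: "kwong_kernel (\<lambda>x. x)"
  unfolding kwong_kernel_def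
proof (intro allI impI)
  fix X c assume X: "finite X" "X \<subseteq> {0::real<..}"
  have "kwong_form (\<lambda>x. x) c X = (\<Sum>x\<in>X. \<Sum>y\<in>X. c x * c y)"
    unfolding kwong_form_def
  proof (intro sum.cong refl)
    fix x y assume "x \<in> X" "y \<in> X"
    then have "x + y > 0" using X by (metis add_pos_pos greaterThan_iff subsetD)
    then show "c x * c y * ((x + y) / (x + y)) = c x * c y" by simp
  qed
  also have "\<dots> = (\<Sum>x\<in>X. c x)\<^sup>2" by (simp add: power2_eq_square sum_product)
  finally show "0 \<le> kwong_form (\<lambda>x. x) c X" by simp
qed

text \<open>
  The geometric mean is reached by Newton's iteration \<open>a \<mapsto> (a + P / a) / 2\<close> for the square
  root of \<open>P = f * g\<close>.  If \<open>a\<close> and \<open>P / a\<close> have positive kernels, then so does their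
  mean \<open>b\<close>, and \<open>P / b\<close> is their harmonic mean, obtained by sums and inversions.
\<close>

lemma kwong_kernel_sqrt_mult:
  assumes f: "kwong_kernel f" "\<And>x. 0 < x \<Longrightarrow> 0 < f x"
    and g: "kwong_kernel g" "\<And>x. 0 < x \<Longrightarrow> 0 < g x"
  shows "kwong_kernel (\<lambda>x. sqrt (f x * g x))"
proof -
  define P where "P x = f x * g x" for x
  have P: "0 < P x" if "0 < x" for x using f(2)[OF that] g(2)[OF that] by (simp add: P_def)
  define a where "a = rec_nat f (\<lambda>_ h x. (h x + P x / h x) / 2)"
  have a0: "a 0 = f" and aS: "a (Suc n) x = (a n x + P x / a n x) / 2" for n x
    by (simp_all add: a_def)
  have pos: "0 < a n x" if "0 < x" for n x
    by (induction n) (use P[OF that] f(2)[OF that] in \<open>auto simp: a0 aS add_pos_pos\<close>)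
  have "kwong_kernel (a n) \<and> kwong_kernel (\<lambda>x. P x / a n x)" for n
  proof (induction n)
    case 0
    have "kwong_kernel (\<lambda>x. P x / a 0 x)"
      by (rule kwong_kernel_cong[OF g(1)]) (use f(2) in \<open>force simp: a0 P_def\<close>)
    then show ?case using f by (simp add: a0)
  next
    case (Suc n)
    have S: "kwong_kernel (a (Suc n))"
      by (rule kwong_kernel_cong[OF kwong_kernel_scale[OF
            kwong_kernel_add[OF conjunct1[OF Suc] conjunct2[OF Suc]], of "1/2"]])
         (auto simp: aS)
    have i1: "kwong_kernel (\<lambda>x. 1 / a n x)"
      using Suc pos by (auto intro: kwong_kernel_inverse)
    have i2: "kwong_kernel (\<lambda>x. 1 / (P x / a n x))"
      using Suc pos P by (intro kwong_kernel_inverse) auto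
    have "kwong_kernel (\<lambda>x. 1 / (1 / 2 * (1 / a n x + 1 / (P x / a n x))))"
      by (intro kwong_kernel_inverse kwong_kernel_scale kwong_kernel_add i1 i2)
        (use pos P in \<open>auto simp: add_pos_pos\<close>)
    then have "kwong_kernel (\<lambda>x. P x / a (Suc n) x)"
    proof (rule kwong_kernel_cong)
      fix x :: real assume "0 < x"
      then have *: "a n x > 0" "P x > 0" using pos P by auto
      then have "a n x * a n x + P x > 0" by (simp add: add_pos_pos)
      with * show "1 / (1 / 2 * (1 / a n x + 1 / (P x / a n x))) = P x / a (Suc n) x"
        unfolding aS by (simp add: divide_simps)
    qed
    with S show ?case by simp
  qed
  then have kw: "kwong_kernel (a n)" for n by blast
  have lim: "(\<lambda>n. a n x) \<longlonglongrightarrow> sqrt (P x)" if x: "0 < x" for x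
  proof -
    define r where "r = sqrt (P x)"
    have r: "r > 0" "P x = r * r" using P[OF x] by (auto simp: r_def)
    have step: "a (Suc n) x - r = (a n x - r)\<^sup>2 / (2 * a n x)" for n
      unfolding aS r(2) using pos[OF x, of n] by (simp add: field_simps power2_eq_square)
    have ge: "0 \<le> a (Suc n) x - r" for n
      unfolding step using pos[OF x, of n] by simp
    have half: "a (Suc (Suc n)) x - r \<le> (a (Suc n) x - r) / 2" for n
    proof -
      let ?b = "a (Suc n) x"
      have "(?b - r)\<^sup>2 \<le> ?b * (?b - r)"
        unfolding power2_eq_square by (intro mult_right_mono ge) (use r in simp)
      then show ?thesis
        unfolding step[of "Suc n"] using pos[OF x, of "Suc n"] by (simp add: field_simps)
    qed
    have bd: "a (Suc n) x - r \<le> (1/2) ^ n * (a (Suc 0) x - r)" for n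
    proof (induction n)
      case (Suc n)
      have "a (Suc (Suc n)) x - r \<le> (a (Suc n) x - r) / 2" by (rule half)
      also have "\<dots> \<le> (1/2) ^ n * (a (Suc 0) x - r) / 2" using Suc by simp
      finally show ?case by simp
    qed simp
    have "(\<lambda>n. a (Suc n) x - r) \<longlonglongrightarrow> 0"
    proof (rule tendsto_sandwich[OF _ _ tendsto_const])
      show "(\<lambda>n. (1/2) ^ n * (a (Suc 0) x - r)) \<longlonglongrightarrow> 0"
        by (rule tendsto_mult_left_zero) (rule LIMSEQ_realpow_zero; simp)
    qed (use ge bd in \<open>auto intro!: always_eventually\<close>)
    then have "(\<lambda>n. a (Suc n) x) \<longlonglongrightarrow> r" by (simp add: LIM_zero_iff)
    then show ?thesis unfolding r_def by (rule LIMSEQ_imp_Suc)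
  qed
  show ?thesis using kwong_kernel_limit[OF kw lim] by (simp add: P_def)
qed

text \<open>
  The exponents of the power functions with positive kernel form a closed set that contains
  \<open>1\<close> and \<open>-1\<close> and is closed under midpoints.  If an exponent in between were missing, then the
  midpoint of its nearest neighbours in the set would contradict their choice.
\<close>

lemma kwong_kernel_powr:
  assumes "-1 \<le> r" "r \<le> 1"
  shows "kwong_kernel (\<lambda>x. x powr r)"
proof (rule ccontr)
  define S where "S = {r. kwong_kernel (\<lambda>x. x powr r)}"
  assume "\<not> ?thesis"
  then have r: "r \<notin> S" by (simp add: S_def)
  have one: "1 \<in> S" unfolding S_def
    by (simp, rule kwong_kernel_cong[OF kwong_kernel_id]) simp
  have mone: "-1 \<in> S" unfolding S_def
    by (simp, rule kwong_kernel_cong[OF kwong_kernel_inverse[OF kwong_kernel_id]])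
       (auto simp: powr_minus_divide)
  have mid: "(s + t) / 2 \<in> S" if "s \<in> S" "t \<in> S" for s t
  proof -
    have "kwong_kernel (\<lambda>x. sqrt (x powr s * x powr t))"
      by (rule kwong_kernel_sqrt_mult) (use that in \<open>auto simp: S_def\<close>)
    then have "kwong_kernel (\<lambda>x. x powr ((s + t) / 2))"
    proof (rule kwong_kernel_cong)
      fix x :: real assume "0 < x"
      then show "sqrt (x powr s * x powr t) = x powr ((s + t) / 2)"
        by (simp add: powr_half_sqrt[symmetric] powr_powr powr_add[symmetric])
    qed
    then show ?thesis by (simp add: S_def)
  qed
  have "closed S"
    unfolding closed_sequential_limits
  proof (intro allI impI)
    fix s :: "nat \<Rightarrow> real" and l assume s: "(\<forall>n. s n \<in> S) \<and> s \<longlonglongrightarrow> l"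
    have "kwong_kernel (\<lambda>x. x powr l)"
      by (rule kwong_kernel_limit[of "\<lambda>n x. x powr (s n)"])
         (use s in \<open>auto simp: S_def intro!: tendsto_intros\<close>)
    then show "l \<in> S" by (simp add: S_def)
  qed
  then have cl: "closed (S \<inter> {..r})" "closed (S \<inter> {r..})" by (auto intro: closed_Int)
  define l where "l = Sup (S \<inter> {..r})"
  define u where "u = Inf (S \<inter> {r..})"
  have ne: "S \<inter> {..r} \<noteq> {}" "S \<inter> {r..} \<noteq> {}" using one mone assms by auto
  have bd: "bdd_above (S \<inter> {..r})" "bdd_below (S \<inter> {r..})" by auto
  have l: "l \<in> S \<inter> {..r}" unfolding l_def
    by (rule closed_contains_Sup[OF ne(1) bd(1) cl(1)])
  have u: "u \<in> S \<inter> {r..}" unfolding u_def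
    by (rule closed_contains_Inf[OF ne(2) bd(2) cl(2)])
  have "l < r" "r < u" using l u r by (auto simp: order.strict_iff_order)
  have m: "(l + u) / 2 \<in> S" using mid l u by blast
  show False
  proof (cases "(l + u) / 2 \<le> r")
    case True
    then have "(l + u) / 2 \<le> l" unfolding l_def
      using m bd(1) by (intro cSup_upper) (auto simp: l_def)
    then show False using \<open>l < r\<close> \<open>r < u\<close> by simp
  next
    case False
    then have "u \<le> (l + u) / 2" unfolding u_def
      using m bd(2) by (intro cInf_lower) (auto simp: u_def)
    then show False using \<open>l < r\<close> \<open>r < u\<close> by simp
  qed
qed


section \<open>Interpolation and factorisation of real polynomials\<close>

lemma map_poly_of_real_add:
  "map_poly of_real (p + q) = map_poly of_real p + (map_poly of_real q :: complex poly)"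
  by (intro poly_eqI) (simp add: coeff_map_poly)

lemma map_poly_of_real_mult:
  "map_poly of_real (p * q) = map_poly of_real p * (map_poly of_real q :: complex poly)"
  by (intro poly_eqI) (simp add: coeff_map_poly coeff_mult)

lemma poly_map_poly_of_real:
  "poly (map_poly of_real p) (of_real x) = (of_real (poly p x) :: complex)"
  by (induction p) (simp_all add: map_poly_pCons)

lemma degree_sum_smult_prod_less:
  fixes a b :: "'a \<Rightarrow> real"
  assumes S: "finite S" "S \<noteq> {}"
  shows "degree (\<Sum>s\<in>S. smult (a s) (\<Prod>k\<in>S-{s}. [:b k, 1:])) < card S"
proof -
  have "degree (smult (a s) (\<Prod>k\<in>S-{s}. [:b k, 1:])) \<le> card S - 1" if s: "s \<in> S" for s
  proof -
    have "degree (\<Prod>k\<in>S-{s}. [:b k, 1:]) \<le> (\<Sum>k\<in>S-{s}. degree [:b k, 1:])"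
      using degree_prod_sum_le[of "S - {s}" "\<lambda>k. [:b k, 1:]"] S by (simp add: o_def)
    also have "\<dots> = card S - 1" using s S by simp
    finally show ?thesis using degree_smult_le order_trans by blast
  qed
  then have "degree (\<Sum>s\<in>S. smult (a s) (\<Prod>k\<in>S-{s}. [:b k, 1:])) \<le> card S - 1"
    by (rule degree_sum_le[OF S(1)])
  moreover have "0 < card S" using S by (simp add: card_gt_0_iff)
  ultimately show ?thesis by linarith
qed

lemma lagrange_interpolation:
  fixes q :: "real poly"
  assumes S: "finite S" "degree q < card S"
  shows "poly q z = (\<Sum>s\<in>S. poly q s / (\<Prod>k\<in>S-{s}. s - k) * (\<Prod>k\<in>S-{s}. z - k))"
proof -
  define L where
    "L = (\<Sum>s\<in>S. smult (poly q s / (\<Prod>k\<in>S-{s}. s - k)) (\<Prod>k\<in>S-{s}. [:- k, 1:]))"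
  have L: "poly L z = (\<Sum>s\<in>S. poly q s / (\<Prod>k\<in>S-{s}. s - k) * (\<Prod>k\<in>S-{s}. z - k))" for z
    unfolding L_def poly_sum poly_smult poly_prod by simp
  have "S \<noteq> {}" using S(2) by auto
  with S(1) have dL: "degree L < card S" unfolding L_def by (rule degree_sum_smult_prod_less)
  have "poly q x = poly L x" if x: "x \<in> S" for x
  proof -
    have "poly L x = (\<Sum>s\<in>S. if s = x then poly q x else 0)"
      unfolding L
    proof (intro sum.cong refl)
      fix s assume s: "s \<in> S"
      show "poly q s / (\<Prod>k\<in>S-{s}. s - k) * (\<Prod>k\<in>S-{s}. x - k) =
          (if s = x then poly q x else 0)"
      proof (cases "s = x")
        case True
        have "(\<Prod>k\<in>S-{x}. x - k) \<noteq> 0" using S by (simp add: prod_zero_iff)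
        then show ?thesis using True by simp
      next
        case False
        then have "(\<Prod>k\<in>S-{s}. x - k) = 0" using S x by (auto simp: prod_zero_iff)
        then show ?thesis using False by simp
      qed
    qed
    then show ?thesis using S x by simp
  qed
  then have "q = L" using S(2) dL by (rule poly_eqI_degree[where A=S])
  then have "poly q z = poly L z" by simp
  then show ?thesis unfolding L .
qed

text \<open>
  A negative value of \<open>S\<close> would persist on an interval, on which \<open>D\<close> would then have to vanish.
\<close>

lemma poly_nonneg_cancel:
  fixes D S :: "real poly"
  assumes "\<And>t. 0 \<le> t \<Longrightarrow> 0 \<le> poly (D * S) t" "\<And>t. 0 \<le> t \<Longrightarrow> 0 \<le> poly D t" "D \<noteq> 0" "0 \<le> t"
  shows "0 \<le> poly S t"
proof (rule ccontr)
  assume neg: "\<not> ?thesis"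
  have "isCont (poly S) t" by simp
  moreover have "0 < - poly S t" using neg by simp
  ultimately have "\<exists>d>0. \<forall>x. dist x t < d \<longrightarrow> dist (poly S x) (poly S t) < - poly S t"
    unfolding continuous_at_eps_delta by blast
  then obtain d where d: "d > 0" "\<And>x. \<bar>x - t\<bar> < d \<Longrightarrow> \<bar>poly S x - poly S t\<bar> < - poly S t"
    unfolding dist_real_def by blast
  have "poly D x = 0" if "x \<in> {t<..<t + d}" for x
  proof -
    have "\<bar>poly S x - poly S t\<bar> < - poly S t" by (rule d(2)) (use that in auto)
    then have "poly S x < 0" by simp
    moreover have "0 \<le> x" using that assms(4) by simp
    ultimately show ?thesis
      using assms(1)[of x] assms(2)[of x] by (simp add: zero_le_mult_iff)
  qed
  then have "{t<..<t + d} \<subseteq> {x. poly D x = 0}" by blast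
  then have "finite {t<..<t + d}" using poly_roots_finite[OF assms(3)] finite_subset by blast
  then show False using infinite_Ioo[of t "t + d"] d(1) by simp
qed

text \<open>
  A real polynomial that is non-negative on the positive half-line is a product of a non-negative
  constant, of linear factors with root \<open>\<le> 0\<close> and of quadratic factors with a double positive root
  or with a pair of conjugate roots.  Under \<open>t = - z\<^sup>2\<close> each of these splits into two factors that
  are exchanged by \<open>z \<mapsto> - z\<close>.  This is the half-line form of the Fejer-Riesz factorisation.
\<close>

lemma nonneg_poly_splits:
  fixes P :: "real poly"
  assumes "\<And>t. 0 \<le> t \<Longrightarrow> 0 \<le> poly P t"
  shows "\<exists>Q. degree Q \<le> degree P \<and> (\<forall>z. poly P (- z\<^sup>2) = poly Q z * poly Q (- z))"
  using assms
proof (induction "degree P" arbitrary: P rule: less_induct)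
  case less
  show ?case
  proof (cases "degree P = 0")
    case True
    then obtain c where c: "P = [:c:]" by (meson degree_eq_zeroE)
    with less.prems[of 0] have "0 \<le> c" by simp
    then show ?thesis by (intro exI[of _ "[:sqrt c:]"]) (simp add: c)
  next
    case False
    then have P0: "P \<noteq> 0" by auto
    \<comment> \<open>It suffices to split off one factor \<open>D\<close> that is non-negative and itself splits.\<close>
    have factor: ?thesis
      if PD: "P = D * S" and D: "0 < degree D" "\<And>t. 0 \<le> t \<Longrightarrow> 0 \<le> poly D t"
        and E: "degree E \<le> degree D" "\<And>z. poly D (- z\<^sup>2) = poly E z * poly E (- z)" for D S E
    proof -
      have nz: "D \<noteq> 0" "S \<noteq> 0" using P0 PD by auto
      then have dP: "degree P = degree D + degree S" unfolding PD by (rule degree_mult_eq)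
      have "0 \<le> poly S t" if "0 \<le> t" for t
        using poly_nonneg_cancel[of D S t] less.prems D(2) nz that unfolding PD by blast
      from less.hyps[OF _ this] obtain Q
        where Q: "degree Q \<le> degree S" "\<And>z. poly S (- z\<^sup>2) = poly Q z * poly Q (- z)"
        using dP D(1) by auto
      have "degree (E * Q) \<le> degree P"
        using degree_mult_le[of E Q] E(1) Q(1) dP by linarith
      then show ?thesis
        by (intro exI[of _ "E * Q"]) (simp add: PD E(2) Q(2) mult_ac)
    qed
    \<comment> \<open>The conjugate roots \<open>a \<plusminus> \<i> b\<close> of modulus \<open>r\<close>, or a double root \<open>a = r\<close>.\<close>
    have quadratic: ?thesis if PD: "P = [:r\<^sup>2, - 2 * a, 1:] * S" and r: "0 \<le> r" "\<bar>a\<bar> \<le> r" for a r S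
    proof (rule factor[OF PD])
      show "0 \<le> poly [:r\<^sup>2, - 2 * a, 1:] t" for t
      proof -
        have "a\<^sup>2 \<le> r\<^sup>2" using r by (simp add: abs_le_square_iff[symmetric])
        moreover have "0 \<le> (t - a)\<^sup>2" by simp
        ultimately show ?thesis by (simp add: power2_eq_square algebra_simps)
      qed
      have split: "poly [:r\<^sup>2, - 2 * a, 1:] (- z\<^sup>2) = poly [:r, s, 1:] z * poly [:r, s, 1:] (- z)"
        if "s\<^sup>2 = 2 * r - 2 * a" for s z
      proof -
        have "poly [:r, s, 1:] z * poly [:r, s, 1:] (- z) = (r + z\<^sup>2)\<^sup>2 - s\<^sup>2 * z\<^sup>2"
          by (simp add: power2_eq_square algebra_simps)
        also have "\<dots> = poly [:r\<^sup>2, - 2 * a, 1:] (- z\<^sup>2)"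
          unfolding that by (simp add: power2_eq_square algebra_simps)
        finally show ?thesis by simp
      qed
      have "(sqrt (2 * r - 2 * a))\<^sup>2 = 2 * r - 2 * a" using r by simp
      from split[OF this]
      show "poly [:r\<^sup>2, - 2 * a, 1:] (- z\<^sup>2) =
          poly [:r, sqrt (2 * r - 2 * a), 1:] z * poly [:r, sqrt (2 * r - 2 * a), 1:] (- z)" for z .
    qed simp_all
    have "\<not> constant (poly (map_poly complex_of_real P))"
      using False by (simp add: constant_degree degree_map_poly)
    then obtain \<rho> where \<rho>: "poly (map_poly complex_of_real P) \<rho> = 0"
      using fundamental_theorem_of_algebra by blast
    show ?thesis
    proof (cases "Im \<rho> = 0")
      case True
      define x where "x = Re \<rho>"
      have "\<rho> = complex_of_real x" using True by (simp add: x_def complex_eq_iff)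
      with \<rho> have x: "poly P x = 0" by (simp add: poly_map_poly_of_real)
      then obtain S where S: "P = [:- x, 1:] * S" by (metis dvdE poly_eq_0_iff_dvd)
      show ?thesis
      proof (cases "x \<le> 0")
        case True
        have split: "poly [:- x, 1:] (- z\<^sup>2) = poly [:s, 1:] z * poly [:s, 1:] (- z)"
          if "s * s = - x" for s z
          using that by (simp add: power2_eq_square algebra_simps)
        have "sqrt (- x) * sqrt (- x) = - x" using True by simp
        from split[OF this] show ?thesis using True by (intro factor[OF S, where E="[:sqrt (- x), 1:]"]) auto
      next
        case False
        have "poly (pderiv P) x = 0"
        proof (rule DERIV_local_min[OF poly_DERIV])
          show "0 < x" using False by simp
          show "\<forall>y. \<bar>x - y\<bar> < x \<longrightarrow> poly P x \<le> poly P y"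
            using less.prems by (auto simp: x)
        qed
        then have "poly S x = 0" unfolding S pderiv_mult by (simp add: pderiv_pCons del: mult_pCons_left)
        then obtain S' where "S = [:- x, 1:] * S'" by (metis dvdE poly_eq_0_iff_dvd)
        then have "P = ([:- x, 1:] * [:- x, 1:]) * S'" by (simp only: S mult.assoc)
        then have "P = [:x\<^sup>2, - 2 * x, 1:] * S'" by (simp add: power2_eq_square)
        then show ?thesis by (rule quadratic) (use False in auto)
      qed
    next
      case False
      define D where "D = [:(cmod \<rho>)\<^sup>2, - 2 * Re \<rho>, 1:]"
      define R where "R = P mod D"
      have P: "P = D * (P div D) + R" by (simp add: R_def)
      have D0: "poly (map_poly complex_of_real D) \<rho> = 0"
        unfolding D_def cmod_power2
        by (simp add: map_poly_pCons complex_eq_iff power2_eq_square algebra_simps)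
      have hom: "poly (map_poly complex_of_real (D * T + R)) \<rho> =
          poly (map_poly complex_of_real D) \<rho> * poly (map_poly complex_of_real T) \<rho>
            + poly (map_poly complex_of_real R) \<rho>" for T
        by (simp add: map_poly_of_real_add map_poly_of_real_mult)
      have "poly (map_poly complex_of_real R) \<rho> = 0"
        using hom[of "P div D"] \<rho> D0 P by simp
      moreover obtain c d where R: "R = [:c, d:]"
      proof -
        have "D \<noteq> 0" "degree D = 2" by (simp_all add: D_def)
        then have "R = 0 \<or> degree R < 2" using degree_mod_less[of D P] unfolding R_def by simp
        then have "degree R \<le> 1" by auto
        then have "R = [:coeff R 0, coeff R 1:]"
          by (intro poly_eqI) (auto simp: coeff_pCons coeff_eq_0 split: nat.splits)
        then show ?thesis by (rule that)
      qed
      ultimately have "R = 0" using False by (auto simp: map_poly_pCons complex_eq_iff)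
      with P have "P = D * (P div D)" by simp
      then show ?thesis unfolding D_def
        by (rule quadratic) (auto simp: abs_Re_le_cmod)
    qed
  qed
qed


section \<open>Duality between Kwong kernels and weights\<close>

text \<open>
  As a function of \<open>f\<close> the form is linear.  Everything below compares its weights with those of other
  linear functionals.
\<close>

lemma kwong_form_eq_weighted_sum:
  "kwong_form f c X = (\<Sum>x\<in>X. 2 * c x * (\<Sum>y\<in>X. c y / (x + y)) * f x)"
proof -
  have "kwong_form f c X = (\<Sum>x\<in>X. \<Sum>y\<in>X. c x * (c y / (x + y)) * f x)
      + (\<Sum>x\<in>X. \<Sum>y\<in>X. c x * (c y / (x + y)) * f y)"
    unfolding kwong_form_def sum.distrib[symmetric]
    by (intro sum.cong refl) (simp add: add_divide_distrib algebra_simps)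
  also have "(\<Sum>x\<in>X. \<Sum>y\<in>X. c x * (c y / (x + y)) * f y) =
      (\<Sum>x\<in>X. \<Sum>y\<in>X. c x * (c y / (x + y)) * f x)"
    by (subst sum.swap) (intro sum.cong refl, simp add: add.commute mult.commute mult.left_commute)
  finally show ?thesis
    by (simp add: sum_distrib_left sum_distrib_right mult.assoc flip: sum.distrib)
qed

text \<open>
  The weights of the Kwong form factor: if \<open>Q z / (\<Prod>k. z + k)\<close> has the partial fractions
  \<open>\<Sum>x. w x / (z + x)\<close>, then \<open>w x\<close> is a multiple of \<open>Q (- x)\<close>, and \<open>\<Sum>y. w y / (x + y)\<close> is a multiple of
  \<open>Q x\<close>.
\<close>

lemma kwong_weight_eq_product:
  fixes X :: "real set" and Q w :: "real \<Rightarrow> real"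
  assumes X: "finite X" "X \<subseteq> {0<..}"
    and Q: "\<And>z. Q z = (\<Sum>x\<in>X. w x * (\<Prod>k\<in>X-{x}. z + k))" and x: "x \<in> X"
  shows "Q x * Q (- x) = 2 * w x * (\<Sum>y\<in>X. w y / (x + y)) * x * (\<Prod>k\<in>X-{x}. k\<^sup>2 - x\<^sup>2)"
proof -
  have pos: "0 < x" if "x \<in> X" for x using X that by auto
  have "Q x = (\<Sum>y\<in>X. w y / (x + y) * (\<Prod>k\<in>X. x + k))"
    unfolding Q
  proof (intro sum.cong refl)
    fix y assume y: "y \<in> X"
    have "x + y > 0" using pos x y by (simp add: add_pos_pos)
    then show "w y * (\<Prod>k\<in>X-{y}. x + k) = w y / (x + y) * (\<Prod>k\<in>X. x + k)"
      by (subst prod.remove[OF X(1) y, of "\<lambda>k. x + k"]) simp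
  qed
  also have "\<dots> = (\<Sum>y\<in>X. w y / (x + y)) * ((x + x) * (\<Prod>k\<in>X-{x}. x + k))"
    by (simp add: sum_distrib_right prod.remove[OF X(1) x, of "\<lambda>k. x + k"])
  finally have Qx: "Q x = (\<Sum>y\<in>X. w y / (x + y)) * ((x + x) * (\<Prod>k\<in>X-{x}. x + k))" .
  have "Q (- x) = (\<Sum>y\<in>X. if y = x then w x * (\<Prod>k\<in>X-{x}. k - x) else 0)"
    unfolding Q
  proof (intro sum.cong refl)
    fix y assume "y \<in> X"
    show "w y * (\<Prod>k\<in>X-{y}. - x + k) = (if y = x then w x * (\<Prod>k\<in>X-{x}. k - x) else 0)"
    proof (cases "y = x")
      case False
      then have "(\<Prod>k\<in>X-{y}. - x + k) = 0" using X x by (auto simp: prod_zero_iff)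
      then show ?thesis using False by simp
    qed simp
  qed
  also have "\<dots> = w x * (\<Prod>k\<in>X-{x}. k - x)" using X x by simp
  finally have Qmx: "Q (- x) = w x * (\<Prod>k\<in>X-{x}. k - x)" .
  have "(\<Prod>k\<in>X-{x}. k\<^sup>2 - x\<^sup>2) = (\<Prod>k\<in>X-{x}. x + k) * (\<Prod>k\<in>X-{x}. k - x)"
    unfolding prod.distrib[symmetric]
    by (intro prod.cong refl) (simp add: power2_eq_square algebra_simps)
  then show ?thesis unfolding Qx Qmx by (simp add: algebra_simps)
qed

text \<open>
  A weighted sum that is non-negative on all functions \<open>x / (x\<^sup>2 + l)\<close> is a Kwong form, and so it is
  non-negative on every function with positive kernel.  Clearing denominators turns the hypothesis
  into a polynomial \<open>P\<close> that is non-negative on the half-line.  If \<open>P (- z\<^sup>2) = Q z * Q (- z)\<close>, then the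
  partial fractions of \<open>Q z / (\<Prod>k. z + k)\<close> are the vector of the form.
\<close>

lemma kwong_duality:
  assumes X: "finite X" "X \<subseteq> {0<..}"
    and u: "\<And>l. 0 \<le> l \<Longrightarrow> 0 \<le> (\<Sum>x\<in>X. u x / (x\<^sup>2 + l))"
    and f: "kwong_kernel f"
  shows "0 \<le> (\<Sum>x\<in>X. u x * (f x / x))"
proof (cases "X = {}")
  case False
  have pos: "0 < x" if "x \<in> X" for x using X that by auto
  define P where "P = (\<Sum>x\<in>X. smult (u x) (\<Prod>k\<in>X-{x}. [:k\<^sup>2, 1:]))"
  have P: "poly P l = (\<Sum>x\<in>X. u x * (\<Prod>k\<in>X-{x}. k\<^sup>2 + l))" for l
    by (simp add: P_def poly_sum poly_prod)
  have dP: "degree P < card X"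
    unfolding P_def using X(1) False by (rule degree_sum_smult_prod_less)
  have "0 \<le> poly P l" if l: "0 \<le> l" for l
  proof -
    have "poly P l = (\<Sum>x\<in>X. u x / (x\<^sup>2 + l) * (\<Prod>k\<in>X. k\<^sup>2 + l))"
      unfolding P
    proof (intro sum.cong refl)
      fix x assume x: "x \<in> X"
      have "x\<^sup>2 + l > 0" using pos[OF x] l by (simp add: add_pos_nonneg)
      then show "u x * (\<Prod>k\<in>X-{x}. k\<^sup>2 + l) = u x / (x\<^sup>2 + l) * (\<Prod>k\<in>X. k\<^sup>2 + l)"
        by (subst prod.remove[OF X(1) x, of "\<lambda>k. k\<^sup>2 + l"]) simp
    qed
    also have "\<dots> = (\<Sum>x\<in>X. u x / (x\<^sup>2 + l)) * (\<Prod>k\<in>X. k\<^sup>2 + l)" by (simp add: sum_distrib_right)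
    also have "\<dots> \<ge> 0" using l by (intro mult_nonneg_nonneg u prod_nonneg) auto
    finally show ?thesis .
  qed
  from nonneg_poly_splits[OF this] obtain Q
    where Q: "degree Q \<le> degree P" "\<And>z. poly P (- z\<^sup>2) = poly Q z * poly Q (- z)" by blast
  have dQ: "degree Q < card (uminus ` X)" using Q(1) dP by (simp add: card_image)
  define w where "w x = poly Q (- x) / (\<Prod>k\<in>X-{x}. k - x)" for x
  have lag: "poly Q z = (\<Sum>x\<in>X. w x * (\<Prod>k\<in>X-{x}. z + k))" for z
  proof -
    have im: "uminus ` X - {- x} = uminus ` (X - {x})" for x by auto
    show ?thesis
      by (subst lagrange_interpolation[OF _ dQ])
        (use X in \<open>simp_all add: w_def sum.reindex prod.reindex im\<close>)
  qed
  have uw: "u x = 2 * w x * (\<Sum>y\<in>X. w y / (x + y)) * x" if x: "x \<in> X" for x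
  proof -
    have "(\<Prod>k\<in>X-{x}. k\<^sup>2 - x\<^sup>2) \<noteq> 0"
    proof
      assume "(\<Prod>k\<in>X-{x}. k\<^sup>2 - x\<^sup>2) = 0"
      then obtain k where "k \<in> X" "k \<noteq> x" "k\<^sup>2 = x\<^sup>2" using X(1) by (auto simp: prod_zero_iff)
      then show False using pos[of k] pos[OF x] by (simp add: power2_eq_iff)
    qed
    moreover have "poly P (- x\<^sup>2) = (\<Sum>y\<in>X. if y = x then u x * (\<Prod>k\<in>X-{x}. k\<^sup>2 - x\<^sup>2) else 0)"
      unfolding P
    proof (intro sum.cong refl)
      fix y assume "y \<in> X"
      show "u y * (\<Prod>k\<in>X-{y}. k\<^sup>2 + - x\<^sup>2) = (if y = x then u x * (\<Prod>k\<in>X-{x}. k\<^sup>2 - x\<^sup>2) else 0)"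
      proof (cases "y = x")
        case False
        then have "(\<Prod>k\<in>X-{y}. k\<^sup>2 + - x\<^sup>2) = 0" using X x by (auto simp: prod_zero_iff)
        then show ?thesis using False by simp
      qed simp
    qed
    then have "u x * (\<Prod>k\<in>X-{x}. k\<^sup>2 - x\<^sup>2) = poly Q x * poly Q (- x)"
      using X x by (simp add: Q(2)[symmetric])
    then have "u x * (\<Prod>k\<in>X-{x}. k\<^sup>2 - x\<^sup>2) =
        2 * w x * (\<Sum>y\<in>X. w y / (x + y)) * x * (\<Prod>k\<in>X-{x}. k\<^sup>2 - x\<^sup>2)"
      using kwong_weight_eq_product[OF X lag x] by simp
    ultimately show ?thesis by simp
  qed
  have "(\<Sum>x\<in>X. u x * (f x / x)) = kwong_form f w X"
    unfolding kwong_form_eq_weighted_sum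
    by (intro sum.cong refl) (use uw pos in force)
  then show ?thesis using kwong_kernelD[OF f X] by simp
qed simp

text \<open>
  By duality only \<open>F x = x / (x\<^sup>2 + l)\<close> has to be tested.  For it the new function is the reciprocal of
  \<open>x powr (r - e) + l * x powr (- r - e)\<close>, a sum of powers with exponents in \<open>[-1, 1]\<close>.
\<close>

lemma kwong_kernel_powr_comp:
  assumes F: "kwong_kernel F" and er: "\<bar>e\<bar> + \<bar>r\<bar> \<le> 1"
  shows "kwong_kernel (\<lambda>x. x powr e * F (x powr r))"
proof (cases "r = 0")
  case True
  have "0 \<le> F 1" using F by (rule kwong_kernel_nonneg) simp
  then have "kwong_kernel (\<lambda>x. F 1 * x powr e)"
    using er by (intro kwong_kernel_scale kwong_kernel_powr) auto
  then show ?thesis by (rule kwong_kernel_cong) (simp add: True)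
next
  case False
  show ?thesis
    unfolding kwong_kernel_def
  proof (intro allI impI)
    fix X c assume X: "finite X" "X \<subseteq> {0::real<..}"
    then have pos: "0 < x" if "x \<in> X" for x using that by auto
    define U where "U x = 2 * c x * (\<Sum>y\<in>X. c y / (x + y))" for x
    have form: "kwong_form h c X = (\<Sum>x\<in>X. U x * h x)" for h
      unfolding kwong_form_eq_weighted_sum U_def by simp
    \<comment> \<open>The weights of the form for the new function, carried to the points \<open>y = x powr r\<close>.\<close>
    define u where "u y = U (y powr (1 / r)) * (y powr (1 / r)) powr e * y" for y
    have inv: "(x powr r) powr (1 / r) = x" if "x \<in> X" for x
      unfolding powr_powr using pos[OF that] False by simp
    have inj: "inj_on (\<lambda>x. x powr r) X" by (rule inj_on_inverseI) (rule inv)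
    have "0 \<le> (\<Sum>y\<in>(\<lambda>x. x powr r) ` X. u y * (F y / y))"
    proof (rule kwong_duality[OF _ _ _ F])
      show "finite ((\<lambda>x. x powr r) ` X)" "(\<lambda>x. x powr r) ` X \<subseteq> {0<..}"
        using X pos by auto
      fix l :: real assume l: "0 \<le> l"
      have "kwong_kernel (\<lambda>x. 1 / (x powr (r - e) + l * x powr (- r - e)))"
        by (intro kwong_kernel_inverse kwong_kernel_add kwong_kernel_scale kwong_kernel_powr)
          (use er l in \<open>auto simp: add_pos_nonneg\<close>)
      from kwong_kernelD[OF this X, of c]
      have "0 \<le> (\<Sum>x\<in>X. U x * (1 / (x powr (r - e) + l * x powr (- r - e))))"
        by (simp add: form)
      also have "\<dots> = (\<Sum>x\<in>X. u (x powr r) / ((x powr r)\<^sup>2 + l))"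
      proof (intro sum.cong refl)
        fix x assume x: "x \<in> X"
        have "x powr (r - e) + l * x powr (- r - e) = ((x powr r)\<^sup>2 + l) / (x powr e * x powr r)"
          using pos[OF x]
          by (simp add: powr_diff powr_minus field_simps power2_eq_square)
        then show "U x * (1 / (x powr (r - e) + l * x powr (- r - e))) =
            u (x powr r) / ((x powr r)\<^sup>2 + l)"
          by (simp add: u_def inv[OF x])
      qed
      also have "\<dots> = (\<Sum>y\<in>(\<lambda>x. x powr r) ` X. u y / (y\<^sup>2 + l))"
        by (simp add: sum.reindex[OF inj])
      finally show "0 \<le> (\<Sum>y\<in>(\<lambda>x. x powr r) ` X. u y / (y\<^sup>2 + l))" .
    qed
    also have "\<dots> = (\<Sum>x\<in>X. U x * (x powr e * F (x powr r)))"
      unfolding sum.reindex[OF inj] o_def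
      by (intro sum.cong refl) (use pos in \<open>force simp: u_def inv\<close>)
    finally show "0 \<le> kwong_form (\<lambda>x. x powr e * F (x powr r)) c X" by (simp add: form)
  qed
qed


section \<open>Complex Hilbert spaces and bounded operators\<close>

lemma scaleC_one [simp]: "1 *\<^sub>C x = (x::'h::complex_hilbert_space)"
  using scaleR_scaleC[of 1 x] by simp

lemma scaleC_zero_left [simp]: "0 *\<^sub>C x = (0::'h::complex_hilbert_space)"
  using scaleR_scaleC[of 0 x] by simp

lemma scaleC_zero_right [simp]: "c *\<^sub>C 0 = (0::'h::complex_hilbert_space)"
  using scaleC_add_right[of c 0 0] by simp

lemma scaleC_minus_left: "(- c) *\<^sub>C x = - (c *\<^sub>C (x::'h::complex_hilbert_space))"
  using scaleC_add_left[of "- c" c x] by (simp add: eq_neg_iff_add_eq_0)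

lemma scaleC_minus_right: "c *\<^sub>C (- x) = - (c *\<^sub>C (x::'h::complex_hilbert_space))"
  using scaleC_add_right[of c "- x" x] by (simp add: eq_neg_iff_add_eq_0)

lemma scaleC_diff_right: "c *\<^sub>C (x - y) = c *\<^sub>C x - c *\<^sub>C (y::'h::complex_hilbert_space)"
  using scaleC_add_right[of c x "- y"] by (simp add: scaleC_minus_right)

lemma scaleC_sum_right: "c *\<^sub>C (\<Sum>i\<in>I. f i) = (\<Sum>i\<in>I. c *\<^sub>C (f i :: 'h::complex_hilbert_space))"
  by (induction I rule: infinite_finite_induct) (simp_all add: scaleC_add_right)

lemma scaleC_sum_left: "(\<Sum>i\<in>I. f i) *\<^sub>C x = (\<Sum>i\<in>I. f i *\<^sub>C (x :: 'h::complex_hilbert_space))"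
  by (induction I rule: infinite_finite_induct) (simp_all add: scaleC_add_left)

lemma cinner_add_right: "cinner x (y + z) = cinner x y + cinner (x::'h::complex_hilbert_space) z"
  by (metis cinner_add_left cinner_commute complex_cnj_add)

lemma cinner_scaleC_right: "cinner x (c *\<^sub>C y) = cnj c * cinner (x::'h::complex_hilbert_space) y"
  by (metis cinner_scaleC_left cinner_commute complex_cnj_mult)

lemma cinner_zero_left [simp]: "cinner 0 (x::'h::complex_hilbert_space) = 0"
  using cinner_add_left[of 0 0 x] by simp

lemma cinner_zero_right [simp]: "cinner (x::'h::complex_hilbert_space) 0 = 0"
  using cinner_add_right[of x 0 0] by simp

lemma cinner_minus_left: "cinner (- x) y = - cinner (x::'h::complex_hilbert_space) y"
  using cinner_add_left[of "- x" x y] by (simp add: eq_neg_iff_add_eq_0)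

lemma cinner_diff_left: "cinner (x - y) z = cinner x z - cinner (y::'h::complex_hilbert_space) z"
  using cinner_add_left[of x "- y" z] by (simp add: cinner_minus_left)

lemma cinner_sum_left: "cinner (\<Sum>i\<in>I. f i) y = (\<Sum>i\<in>I. cinner (f i :: 'h::complex_hilbert_space) y)"
  by (induction I rule: infinite_finite_induct) (simp_all add: cinner_add_left)

lemma cinner_sum_right: "cinner y (\<Sum>i\<in>I. f i) = (\<Sum>i\<in>I. cinner y (f i :: 'h::complex_hilbert_space))"
  by (induction I rule: infinite_finite_induct) (simp_all add: cinner_add_right)

lemma cinner_self: "cinner x x = complex_of_real ((norm (x::'h::complex_hilbert_space))\<^sup>2)"
proof -
  have "Im (cinner x x) = 0"
    using arg_cong[OF cinner_commute[of x x], of Im] by simp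
  then show ?thesis
    by (simp add: complex_eq_iff inner_eq_Re_cinner[symmetric] power2_norm_eq_inner)
qed

lemma norm_scaleC: "norm (c *\<^sub>C x) = cmod c * norm (x::'h::complex_hilbert_space)"
proof -
  have "complex_of_real ((norm (c *\<^sub>C x))\<^sup>2) = c * cnj c * complex_of_real ((norm x)\<^sup>2)"
    unfolding cinner_self[symmetric] cinner_scaleC_left cinner_scaleC_right by simp
  also have "\<dots> = complex_of_real ((cmod c * norm x)\<^sup>2)"
    unfolding complex_norm_square[symmetric] by (simp add: power_mult_distrib)
  finally have "(norm (c *\<^sub>C x))\<^sup>2 = (cmod c * norm x)\<^sup>2" by (simp only: of_real_eq_iff)
  then show ?thesis by (simp add: power2_eq_iff_nonneg)
qed

lemma bounded_clinearI:
  fixes A :: "'h::complex_hilbert_space \<Rightarrow> 'h"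
  assumes "\<And>x y. A (x + y) = A x + A y" "\<And>c x. A (c *\<^sub>C x) = c *\<^sub>C A x"
    "\<And>x. norm (A x) \<le> K * norm x"
  shows "bounded_clinear A"
  unfolding bounded_clinear_def
proof
  show "bounded_linear A"
    by (rule bounded_linear_intro[of A K])
      (use assms in \<open>simp_all add: scaleR_scaleC mult.commute\<close>)
qed (use assms in simp)

lemma bounded_clinearD:
  assumes "bounded_clinear A"
  shows "bounded_linear A" "A (c *\<^sub>C x) = c *\<^sub>C A x" "A (x + y) = A x + A y"
    "A (x - y) = A x - A y" "A 0 = 0" "A (r *\<^sub>R x) = r *\<^sub>R A x"
  using assms unfolding bounded_clinear_def
  by (auto simp: bounded_linear.linear linear_add linear_diff linear_0 linear_scale)

lemma bounded_clinear_bound: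
  assumes "bounded_clinear A"
  obtains K where "0 < K" "\<And>x. norm (A x) \<le> K * norm x"
  using bounded_linear.pos_bounded[OF bounded_clinearD(1)[OF assms]]
  by (auto simp: mult.commute)

lemma bounded_clinear_id: "bounded_clinear (\<lambda>x::'h::complex_hilbert_space. x)"
  by (rule bounded_clinearI[where K=1]) auto

lemma bounded_clinear_zero: "bounded_clinear (\<lambda>x::'h::complex_hilbert_space. 0)"
  by (rule bounded_clinearI[where K=0]) auto

lemma bounded_clinear_compose:
  assumes A: "bounded_clinear A" and B: "bounded_clinear B"
  shows "bounded_clinear (\<lambda>x. A (B x))"
  using bounded_linear_compose[OF bounded_clinearD(1)[OF A] bounded_clinearD(1)[OF B]]
  unfolding bounded_clinear_def by (simp add: bounded_clinearD[OF A] bounded_clinearD[OF B])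

lemma bounded_clinear_add:
  assumes A: "bounded_clinear A" and B: "bounded_clinear B"
  shows "bounded_clinear (\<lambda>x. A x + B x)"
  using bounded_linear_add[OF bounded_clinearD(1)[OF A] bounded_clinearD(1)[OF B]]
  unfolding bounded_clinear_def
  by (simp add: bounded_clinearD[OF A] bounded_clinearD[OF B] scaleC_add_right)

lemma bounded_clinear_scaleC:
  assumes A: "bounded_clinear A"
  shows "bounded_clinear (\<lambda>x. c *\<^sub>C A x)"
proof -
  obtain K where K: "\<And>x. norm (A x) \<le> K * norm x" using bounded_clinear_bound[OF A] by blast
  show ?thesis
  proof (rule bounded_clinearI)
    fix x show "norm (c *\<^sub>C A x) \<le> (cmod c * K) * norm x"
      using K[of x] by (simp add: norm_scaleC mult.assoc mult_left_mono)
  qed (simp_all add: bounded_clinearD[OF A] scaleC_add_right scaleC_scaleC mult.commute)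
qed

lemma bounded_clinear_diff:
  assumes A: "bounded_clinear A" and B: "bounded_clinear B"
  shows "bounded_clinear (\<lambda>x. A x - B x)"
  using bounded_clinear_add[OF A bounded_clinear_scaleC[OF B, of "-1"]]
  by (simp add: scaleC_minus_left)

lemma selfadjointD:
  assumes "selfadjoint A"
  shows "bounded_clinear A" "cinner (A x) y = cinner x (A y)" "inner (A x) y = inner x (A y)"
  using assms by (auto simp: selfadjoint_def inner_eq_Re_cinner)

lemma op_le_iff:
  assumes "selfadjoint A" "selfadjoint B"
  shows "op_le A B \<longleftrightarrow> (\<forall>x. inner (A x) x \<le> inner (B x) x)"
proof -
  have real: "Im (cinner (T x) x) = 0" if "selfadjoint T" for T and x :: 'a
    using selfadjointD(2)[OF that, of x x] arg_cong[OF cinner_commute[of "T x" x], of Im] by simp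
  show ?thesis
    unfolding op_le_def positive_op_def
    by (simp add: real[OF assms(1)] real[OF assms(2)] complex_nonneg_Reals_iff cinner_diff_left inner_eq_Re_cinner)
qed


section \<open>Polynomials of an operator\<close>

text \<open>
  Complex coefficients allow a polynomial of an operator to be split into linear factors.
\<close>

definition cpoly_op :: "complex poly \<Rightarrow> ('h::complex_hilbert_space \<Rightarrow> 'h) \<Rightarrow> 'h \<Rightarrow> 'h" where
  "cpoly_op p A x = (\<Sum>i\<le>degree p. coeff p i *\<^sub>C (A ^^ i) x)"

lemma cpoly_op_eq:
  assumes "degree p \<le> N"
  shows "cpoly_op p A x = (\<Sum>i\<le>N. coeff p i *\<^sub>C (A ^^ i) x)"
  unfolding cpoly_op_def
  by (rule sum.mono_neutral_left) (use assms in \<open>auto simp: coeff_eq_0\<close>)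

lemma cpoly_op_0 [simp]: "cpoly_op 0 A x = 0"
  by (simp add: cpoly_op_def)

lemma cpoly_op_add: "cpoly_op (p + q) A x = cpoly_op p A x + cpoly_op q A x"
proof -
  define N where "N = max (degree p) (degree q)"
  have "degree (p + q) \<le> N" "degree p \<le> N" "degree q \<le> N"
    by (auto simp: N_def degree_add_le_max)
  then show ?thesis
    by (simp add: cpoly_op_eq[of _ N] scaleC_add_left sum.distrib)
qed

lemma cpoly_op_smult: "cpoly_op (smult c p) A x = c *\<^sub>C cpoly_op p A x"
  using cpoly_op_eq[OF degree_smult_le[of c p], of A x]
  by (simp add: cpoly_op_def[of p] scaleC_sum_right scaleC_scaleC)

lemma cpoly_op_pCons:
  assumes "bounded_clinear A"
  shows "cpoly_op (pCons a p) A x = a *\<^sub>C x + A (cpoly_op p A x)"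
proof -
  have "cpoly_op (pCons a p) A x = (\<Sum>i\<le>Suc (degree p). coeff (pCons a p) i *\<^sub>C (A ^^ i) x)"
    by (rule cpoly_op_eq) (rule degree_pCons_le)
  also have "\<dots> = a *\<^sub>C x + (\<Sum>i\<le>degree p. coeff p i *\<^sub>C A ((A ^^ i) x))"
    by (subst sum.atMost_Suc_shift) simp
  also have "(\<Sum>i\<le>degree p. coeff p i *\<^sub>C A ((A ^^ i) x)) = A (cpoly_op p A x)"
    unfolding cpoly_op_def
    by (simp add: linear_sum[OF bounded_linear.linear[OF bounded_clinearD(1)[OF assms]]]
        bounded_clinearD(2)[OF assms])
  finally show ?thesis .
qed

lemma cpoly_op_mult:
  assumes "bounded_clinear A"
  shows "cpoly_op (p * q) A x = cpoly_op p A (cpoly_op q A x)"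
  by (induction p)
    (simp_all add: cpoly_op_pCons[OF assms] cpoly_op_add cpoly_op_smult)

lemma poly_op_eq_cpoly_op: "poly_op q A x = cpoly_op (map_poly of_real q) A x"
  by (simp add: poly_op_def cpoly_op_def degree_map_poly coeff_map_poly scaleR_scaleC)

lemma poly_op_add: "poly_op (p + q) A x = poly_op p A x + poly_op q A x"
  by (simp add: poly_op_eq_cpoly_op map_poly_of_real_add cpoly_op_add)

lemma poly_op_mult:
  "bounded_clinear A \<Longrightarrow> poly_op (p * q) A x = poly_op p A (poly_op q A x)"
  by (simp add: poly_op_eq_cpoly_op map_poly_of_real_mult cpoly_op_mult)

lemma poly_op_pCons:
  "bounded_clinear A \<Longrightarrow> poly_op (pCons a p) A x = a *\<^sub>R x + A (poly_op p A x)"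
  by (simp add: poly_op_eq_cpoly_op map_poly_pCons cpoly_op_pCons scaleR_scaleC)

lemma poly_op_0 [simp]: "poly_op 0 A x = 0"
  by (simp add: poly_op_def)

lemma poly_op_diff: "poly_op (p - q) A x = poly_op p A x - poly_op q A x"
  using poly_op_add[of "p - q" q A x] by simp

lemma bounded_clinear_scaleR:
  "bounded_clinear A \<Longrightarrow> bounded_clinear (\<lambda>x. r *\<^sub>R A x)"
  using bounded_clinear_scaleC[of A "of_real r"] by (simp add: scaleR_scaleC)

lemma bounded_clinear_poly_op:
  assumes "bounded_clinear A"
  shows "bounded_clinear (poly_op p A)"
proof (induction p)
  case 0
  then show ?case using bounded_clinear_zero by (simp add: poly_op_def[abs_def])
next
  case (pCons a p)
  have "bounded_clinear (\<lambda>x. a *\<^sub>R x + A (poly_op p A x))"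
    by (intro bounded_clinear_add bounded_clinear_compose[OF assms pCons.IH]
        bounded_clinear_scaleR bounded_clinear_id)
  then show ?case by (simp add: poly_op_pCons[OF assms, abs_def])
qed

lemma selfadjoint_poly_op:
  assumes A: "selfadjoint A"
  shows "selfadjoint (poly_op p A)"
  unfolding selfadjoint_def
proof (intro conjI allI)
  note lin = selfadjointD(1)[OF A]
  show "bounded_clinear (poly_op p A)" by (rule bounded_clinear_poly_op[OF lin])
  have comm: "A (poly_op p A x) = poly_op p A (A x)" for p x
    by (induction p) (simp_all add: poly_op_pCons[OF lin] bounded_clinearD[OF lin])
  show "cinner (poly_op p A x) y = cinner x (poly_op p A y)" for x y
    by (induction p arbitrary: x y)
      (simp_all add: poly_op_pCons[OF lin] cinner_add_left cinner_add_right scaleR_scaleC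
        cinner_scaleC_left cinner_scaleC_right selfadjointD(2)[OF A] comm)
qed


section \<open>The norm of a polynomial of a self-adjoint operator\<close>

definition bounded_below :: "('h::real_normed_vector \<Rightarrow> 'h) \<Rightarrow> bool" where
  "bounded_below A \<longleftrightarrow> (\<exists>e>0. \<forall>x. e * norm x \<le> norm (A x))"

lemma bounded_below_compose:
  assumes "bounded_below A" "bounded_below B"
  shows "bounded_below (\<lambda>x. A (B x))"
proof -
  obtain d e where d: "d > 0" "\<And>x. d * norm x \<le> norm (A x)"
    and e: "e > 0" "\<And>x. e * norm x \<le> norm (B x)"
    using assms unfolding bounded_below_def by blast
  have "d * e * norm x \<le> norm (A (B x))" for x
  proof -
    have "d * (e * norm x) \<le> d * norm (B x)" using d(1) by (intro mult_left_mono e) auto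
    also have "\<dots> \<le> norm (A (B x))" by (rule d(2))
    finally show ?thesis by (simp add: mult.assoc)
  qed
  then show ?thesis
    unfolding bounded_below_def using d(1) e(1) by (intro exI[of _ "d * e"]) simp
qed

lemma bounded_below_of_resolvent:
  assumes "z \<notin> op_spectrum A"
  shows "bounded_below (\<lambda>x. A x - z *\<^sub>C x)"
proof -
  obtain R where R: "bounded_clinear R" "\<And>x. R (A x - z *\<^sub>C x) = x"
    using assms unfolding op_spectrum_def by blast
  obtain K where K: "0 < K" "\<And>x. norm (R x) \<le> K * norm x" using bounded_clinear_bound[OF R(1)] by blast
  have "1 / K * norm x \<le> norm (A x - z *\<^sub>C x)" for x
    using K(2)[of "A x - z *\<^sub>C x"] K(1) by (simp add: R(2) field_simps)
  then show ?thesis unfolding bounded_below_def using K(1) by (intro exI[of _ "1 / K"]) simp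
qed

text \<open>
  One half of the spectral mapping theorem: each factor \<open>A - z\<close> at a root \<open>z\<close> outside the spectrum is
  bounded below, and hence their product is.
\<close>

lemma bounded_below_cpoly_op:
  assumes A: "bounded_clinear A" and "p \<noteq> 0"
    and "\<And>z. poly p z = 0 \<Longrightarrow> z \<notin> op_spectrum A"
  shows "bounded_below (cpoly_op p A)"
  using assms(2,3)
proof (induction "degree p" arbitrary: p)
  case 0
  then obtain c where c: "p = [:c:]" "c \<noteq> 0" by (metis degree_eq_zeroE pCons_0_0)
  then show ?case
    unfolding bounded_below_def
    by (intro exI[of _ "cmod c"]) (simp add: cpoly_op_pCons[OF A] norm_scaleC bounded_clinearD[OF A])
next
  case (Suc n)
  then have "\<not> constant (poly p)" by (simp add: constant_degree)
  then obtain z where z: "poly p z = 0" using fundamental_theorem_of_algebra by blast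
  then obtain r where p: "p = [:- z, 1:] * r" by (metis dvdE poly_eq_0_iff_dvd)
  then have "r \<noteq> 0" using Suc.prems by auto
  then have "degree p = Suc (degree r)" unfolding p by (subst degree_mult_eq) auto
  then have "n = degree r" using Suc by simp
  then have r: "bounded_below (cpoly_op r A)"
    using \<open>r \<noteq> 0\<close> Suc.prems p by (intro Suc.hyps) auto
  have eq: "cpoly_op p A = (\<lambda>x. A (cpoly_op r A x) - z *\<^sub>C cpoly_op r A x)"
    unfolding p cpoly_op_mult[OF A, abs_def]
    by (simp add: cpoly_op_pCons[OF A] bounded_clinearD[OF A] scaleC_minus_left)
  show ?case
    unfolding eq
    by (rule bounded_below_compose[OF bounded_below_of_resolvent[OF Suc.prems(2)[OF z]] r])
qed

text \<open>
  A self-adjoint \<open>S\<close> nearly attains its norm \<open>c\<close> at some unit vectors \<open>x\<close>, and then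
  \<open>\<parallel>S (S x) - c\<^sup>2 x\<parallel>\<^sup>2 \<le> c\<^sup>2 (c\<^sup>2 - \<parallel>S x\<parallel>\<^sup>2)\<close> is small.
\<close>

lemma onorm_square_not_bounded_below:
  fixes S :: "'h::complex_hilbert_space \<Rightarrow> 'h"
  assumes S: "selfadjoint S" and x0: "(x0::'h) \<noteq> 0"
  shows "\<not> bounded_below (\<lambda>x. S (S x) - (onorm S)\<^sup>2 *\<^sub>R x)"
proof
  define c where "c = onorm S"
  have lin: "bounded_linear S" using selfadjointD(1)[OF S] bounded_clinearD by blast
  have c0: "0 \<le> c" unfolding c_def by (rule onorm_pos_le[OF lin])
  have bd: "norm (S x) \<le> c * norm x" for x unfolding c_def by (rule onorm[OF lin])
  assume "bounded_below (\<lambda>x. S (S x) - (onorm S)\<^sup>2 *\<^sub>R x)"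
  then obtain e where e: "e > 0" "\<And>x. e * norm x \<le> norm (S (S x) - c\<^sup>2 *\<^sub>R x)"
    unfolding bounded_below_def c_def by blast
  have key: "c\<^sup>2 * (norm (S x))\<^sup>2 \<le> (c ^ 4 - e\<^sup>2) * (norm x)\<^sup>2" for x
  proof -
    have "inner (S (S x)) x = (norm (S x))\<^sup>2"
      by (simp add: selfadjointD(3)[OF S] power2_norm_eq_inner)
    moreover have "(norm (c\<^sup>2 *\<^sub>R x))\<^sup>2 = c ^ 4 * (norm x)\<^sup>2"
      by (simp add: power_mult_distrib)
    ultimately have "(norm (S (S x) - c\<^sup>2 *\<^sub>R x))\<^sup>2 =
        (norm (S (S x)))\<^sup>2 - 2 * (c\<^sup>2 * (norm (S x))\<^sup>2) + c ^ 4 * (norm x)\<^sup>2"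
      using dot_norm_neg[of "S (S x)" "c\<^sup>2 *\<^sub>R x"] by simp
    moreover have "(norm (S (S x)))\<^sup>2 \<le> c\<^sup>2 * (norm (S x))\<^sup>2"
      using power_mono[OF bd[of "S x"], of 2] by (simp add: power_mult_distrib)
    moreover have "e\<^sup>2 * (norm x)\<^sup>2 \<le> (norm (S (S x) - c\<^sup>2 *\<^sub>R x))\<^sup>2"
      using power_mono[OF e(2)[of x], of 2] e(1) by (simp add: power_mult_distrib)
    ultimately show ?thesis by (simp add: algebra_simps)
  qed
  have "0 \<le> (c ^ 4 - e\<^sup>2) * (norm x0)\<^sup>2" by (rule order_trans[OF _ key[of x0]]) simp
  then have pos: "0 \<le> c ^ 4 - e\<^sup>2" using x0 by (simp add: zero_le_mult_iff)
  then have "c \<noteq> 0" using e(1) by auto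
  then have c: "c > 0" using c0 by simp
  define k where "k = sqrt ((c ^ 4 - e\<^sup>2) / c\<^sup>2)"
  have k2: "k\<^sup>2 = (c ^ 4 - e\<^sup>2) / c\<^sup>2" and k0: "0 \<le> k" using pos by (simp_all add: k_def)
  have "norm (S x) \<le> k * norm x" for x
  proof (rule power2_le_imp_le)
    show "(norm (S x))\<^sup>2 \<le> (k * norm x)\<^sup>2"
      unfolding power_mult_distrib k2 using key[of x] c by (simp add: field_simps)
  qed (use k0 in simp)
  then have "c \<le> k" unfolding c_def by (rule onorm_bound[OF k0])
  then have "c\<^sup>2 \<le> k\<^sup>2" using c by (intro power_mono) auto
  then have "c ^ 4 \<le> c ^ 4 - e\<^sup>2" unfolding k2 using c by (simp add: field_simps numeral_eq_Suc)
  then show False using e(1) by simp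
qed

text \<open>
  With \<open>c\<close> the norm of \<open>q(A)\<close>, the operator \<open>(q\<^sup>2 - c\<^sup>2)(A)\<close> is not bounded below, so \<open>q\<^sup>2 - c\<^sup>2\<close> vanishes at
  a point of the spectrum, where \<open>q\<close> takes the value \<open>c\<close> or \<open>- c\<close>.
\<close>

lemma poly_op_norm_le:
  fixes A :: "'h::complex_hilbert_space \<Rightarrow> 'h"
  assumes A: "selfadjoint A" and real: "op_spectrum A \<subseteq> range complex_of_real"
    and M: "0 \<le> M" "\<And>t. complex_of_real t \<in> op_spectrum A \<Longrightarrow> \<bar>poly q t\<bar> \<le> M"
  shows "norm (poly_op q A x) \<le> M * norm x"
proof (cases "x = 0")
  case False
  note lin = selfadjointD(1)[OF A]
  define c where "c q = onorm (poly_op q A)" for q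
  have S: "bounded_linear (poly_op q A)" for q
    using bounded_clinear_poly_op[OF lin] bounded_clinearD(1) by blast
  have not_bb: "\<not> bounded_below (poly_op (q * q - [:(c q)\<^sup>2:]) A)" for q
  proof -
    have "poly_op (q * q - [:(c q)\<^sup>2:]) A = (\<lambda>x. poly_op q A (poly_op q A x) - (c q)\<^sup>2 *\<^sub>R x)"
      by (rule ext)
        (simp add: poly_op_diff poly_op_mult[OF lin] poly_op_pCons[OF lin] bounded_clinearD[OF lin])
    then show ?thesis
      using onorm_square_not_bounded_below[OF selfadjoint_poly_op[OF A] False] by (simp add: c_def)
  qed
  have root: "\<exists>t. complex_of_real t \<in> op_spectrum A \<and> (poly q t)\<^sup>2 = (c q)\<^sup>2"
    if "q * q - [:(c q)\<^sup>2:] \<noteq> 0" for q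
  proof -
    let ?p = "map_poly complex_of_real (q * q - [:(c q)\<^sup>2:])"
    have "?p \<noteq> 0" using that by (simp add: map_poly_eq_0_iff)
    moreover have "\<not> bounded_below (cpoly_op ?p A)"
      using not_bb[of q] by (simp add: poly_op_eq_cpoly_op[abs_def])
    ultimately obtain z where z: "poly ?p z = 0" "z \<in> op_spectrum A"
      using bounded_below_cpoly_op[OF lin] by blast
    then obtain t where t: "z = complex_of_real t" using real by blast
    with z(1) have "poly (q * q - [:(c q)\<^sup>2:]) t = 0" by (simp only: poly_map_poly_of_real of_real_eq_0_iff)
    then show ?thesis using z(2) t by (auto simp: power2_eq_square)
  qed
  have "\<exists>t. complex_of_real t \<in> op_spectrum A \<and> (poly q t)\<^sup>2 = (c q)\<^sup>2"
  proof (cases "q * q - [:(c q)\<^sup>2:] = 0")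
    case True
    \<comment> \<open>Here \<open>q\<close> is constant, and any point of the spectrum will do.\<close>
    have "[:0, 1:] * [:0, 1:] - [:(c [:0, 1:])\<^sup>2:] \<noteq> 0" by simp
    from root[OF this] obtain t where "complex_of_real t \<in> op_spectrum A" by blast
    moreover have "poly (q * q - [:(c q)\<^sup>2:]) t = 0" using True by simp
    then have "(poly q t)\<^sup>2 = (c q)\<^sup>2" by (simp add: power2_eq_square)
    ultimately show ?thesis by blast
  qed (rule root)
  then obtain t where t: "complex_of_real t \<in> op_spectrum A" "(poly q t)\<^sup>2 = (c q)\<^sup>2" by blast
  have "c q \<le> \<bar>poly q t\<bar>"
    using t(2) by (metis abs_ge_self power2_eq_iff abs_minus_cancel)
  also have "\<dots> \<le> M" by (rule M(2)[OF t(1)])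
  finally have "c q * norm x \<le> M * norm x" by (simp add: mult_right_mono)
  then show ?thesis using onorm[OF S, of q x] unfolding c_def by simp
qed (simp add: bounded_clinearD(5)[OF bounded_clinear_poly_op[OF selfadjointD(1)[OF A]]])


section \<open>The spectrum of a bounded operator\<close>

text \<open>
  Banach's fixed point theorem, applied to \<open>x \<mapsto> T x + y\<close>, solves \<open>x - T x = y\<close>.
\<close>

lemma neumann_inverse:
  fixes T :: "'h::complex_hilbert_space \<Rightarrow> 'h"
  assumes T: "bounded_clinear T" and k: "0 \<le> k" "k < 1" "\<And>x. norm (T x) \<le> k * norm x"
  shows "\<exists>R. bounded_clinear R \<and> (\<forall>x. R (x - T x) = x) \<and> (\<forall>x. R x - T (R x) = x)"
proof -
  have "\<exists>!x. T x + y = x" for y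
  proof (rule banach_fix_type[OF k(1,2)], intro allI)
    fix u v
    show "dist (T u + y) (T v + y) \<le> k * dist u v"
      using k(3)[of "u - v"] by (simp add: dist_norm bounded_clinearD[OF T])
  qed
  then have ex: "\<exists>!x. x - T x = y" for y by (simp add: algebra_simps eq_commute)
  define R where "R y = (THE x. x - T x = y)" for y
  have R: "R y - T (R y) = y" for y unfolding R_def by (rule theI'[OF ex])
  have R': "R y = x" if "x - T x = y" for x y using ex[of y] R[of y] that by blast
  have "bounded_clinear R"
  proof (rule bounded_clinearI)
    show "R (x + y) = R x + R y" for x y
    proof (rule R')
      have "R x + R y - T (R x + R y) = (R x - T (R x)) + (R y - T (R y))"
        by (simp add: bounded_clinearD[OF T])
      then show "R x + R y - T (R x + R y) = x + y" by (simp only: R)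
    qed
    show "R (c *\<^sub>C x) = c *\<^sub>C R x" for c x
    proof (rule R')
      have "c *\<^sub>C R x - T (c *\<^sub>C R x) = c *\<^sub>C (R x - T (R x))"
        by (simp add: bounded_clinearD[OF T] scaleC_diff_right)
      then show "c *\<^sub>C R x - T (c *\<^sub>C R x) = c *\<^sub>C x" by (simp only: R)
    qed
    show "norm (R x) \<le> 1 / (1 - k) * norm x" for x
    proof -
      have "norm (R x) = norm (x + T (R x))" by (metis R diff_add_cancel)
      also have "\<dots> \<le> norm x + k * norm (R x)" using norm_triangle_ineq k(3) by (metis add_left_mono order_trans)
      finally show ?thesis using k(2) by (simp add: field_simps)
    qed
  qed
  then show ?thesis using R R' by blast
qed

text \<open>
  The spectrum is bounded, and it avoids a neighbourhood of \<open>0\<close> because \<open>A\<close> is invertible.  The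
  functional calculus can therefore work with uniform approximation on a compact interval.
\<close>

lemma op_spectrum_subset_interval:
  fixes A :: "'h::complex_hilbert_space \<Rightarrow> 'h"
  assumes A: "bounded_clinear A" and spec: "op_spectrum A \<subseteq> complex_of_real ` {0<..}"
  obtains a b where "0 < a" "a < b" "op_spectrum A \<subseteq> complex_of_real ` {a..b}"
proof -
  obtain K where K: "0 < K" "\<And>x. norm (A x) \<le> K * norm x" using bounded_clinear_bound[OF A] by blast
  have "0 \<notin> op_spectrum A" using spec by auto
  then obtain R0 where R0: "bounded_clinear R0" "\<And>x. R0 (A x) = x" "\<And>x. A (R0 x) = x"
    unfolding op_spectrum_def by auto
  obtain K0 where K0: "0 < K0" "\<And>x. norm (R0 x) \<le> K0 * norm x" using bounded_clinear_bound[OF R0(1)] by blast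
  have upper: "cmod z \<le> K" if z: "z \<in> op_spectrum A" for z
  proof (rule ccontr)
    assume "\<not> ?thesis"
    then have zK: "K < cmod z" by simp
    then have z0: "z \<noteq> 0" "cmod z > 0" using K(1) by auto
    define T where "T x = (1 / z) *\<^sub>C A x" for x
    have T: "bounded_clinear T" unfolding T_def by (rule bounded_clinear_scaleC[OF A])
    have AT: "A x - z *\<^sub>C x = (- z) *\<^sub>C (x - T x)" for x
      using z0 by (simp add: T_def scaleC_minus_left scaleC_diff_right scaleC_scaleC)
    have "norm (T x) \<le> K / cmod z * norm x" for x
      using divide_right_mono[OF K(2)[of x], of "cmod z"]
      by (simp add: T_def norm_scaleC norm_divide)
    moreover have "0 \<le> K / cmod z" "K / cmod z < 1" using K(1) zK by (simp_all add: divide_less_eq)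
    ultimately obtain R
      where R: "bounded_clinear R" "\<And>x. R (x - T x) = x" "\<And>x. R x - T (R x) = x"
      using neumann_inverse[OF T] by blast
    have "bounded_clinear (\<lambda>x. R ((- 1 / z) *\<^sub>C x))"
      by (intro bounded_clinear_compose[OF R(1)] bounded_clinear_scaleC bounded_clinear_id)
    moreover have "R ((- 1 / z) *\<^sub>C (A x - z *\<^sub>C x)) = x" for x
      unfolding AT scaleC_scaleC using z0 R(2) by simp
    moreover have "A (R ((- 1 / z) *\<^sub>C x)) - z *\<^sub>C R ((- 1 / z) *\<^sub>C x) = x" for x
      unfolding AT R(3) scaleC_scaleC using z0 by simp
    ultimately have "z \<notin> op_spectrum A" unfolding op_spectrum_def by blast
    then show False using z by simp
  qed
  have lower: "1 / K0 \<le> cmod z" if z: "z \<in> op_spectrum A" for z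
  proof (rule ccontr)
    assume "\<not> ?thesis"
    then have zK: "cmod z * K0 < 1" using K0(1) by (simp add: field_simps)
    define T where "T x = z *\<^sub>C R0 x" for x
    have T: "bounded_clinear T" unfolding T_def by (rule bounded_clinear_scaleC[OF R0(1)])
    have "norm (T x) \<le> (cmod z * K0) * norm x" for x
      using K0(2)[of x] by (simp add: T_def norm_scaleC mult.assoc mult_left_mono)
    moreover have "0 \<le> cmod z * K0" using K0(1) by simp
    ultimately obtain R
      where R: "bounded_clinear R" "\<And>x. R (x - T x) = x" "\<And>x. R x - T (R x) = x"
      using neumann_inverse[OF T] zK by blast
    have "bounded_clinear (\<lambda>x. R (R0 x))" by (rule bounded_clinear_compose[OF R(1) R0(1)])
    moreover have "R (R0 (A x - z *\<^sub>C x)) = x" for x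
      using R(2)[of x] by (simp add: bounded_clinearD[OF R0(1)] R0(2) T_def)
    moreover have "A (R (R0 x)) - z *\<^sub>C R (R0 x) = x" for x
    proof -
      have "A (R (R0 x) - T (R (R0 x))) = A (R0 x)" by (simp only: R(3))
      then show ?thesis by (simp add: bounded_clinearD[OF A] R0(3) T_def)
    qed
    ultimately have "z \<notin> op_spectrum A" unfolding op_spectrum_def by blast
    then show False using z by simp
  qed
  show ?thesis
  proof
    show "0 < 1 / K0" "1 / K0 < K + 1 / K0" using K(1) K0(1) by auto
    show "op_spectrum A \<subseteq> complex_of_real ` {1 / K0..K + 1 / K0}"
    proof
      fix z assume z: "z \<in> op_spectrum A"
      then obtain t where t: "z = complex_of_real t" "0 < t" using spec by auto
      have "1 / K0 \<le> t" "t \<le> K" using lower[OF z] upper[OF z] t by auto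
      moreover have "0 < 1 / K0" using K0(1) by simp
      ultimately have "t \<in> {1 / K0..K + 1 / K0}" unfolding atLeastAtMost_iff by linarith
      then show "z \<in> complex_of_real ` {1 / K0..K + 1 / K0}" using t(1) by blast
    qed
  qed
qed


section \<open>Functional calculus\<close>

lemma poly_uniform_approximation:
  fixes h :: "real \<Rightarrow> real"
  assumes "continuous_on {a..b} h"
  obtains q :: "nat \<Rightarrow> real poly" where "uniform_limit {a..b} (\<lambda>n. poly (q n)) h sequentially"
proof -
  have "\<exists>p::real poly. \<forall>t\<in>{a..b}. \<bar>h t - poly p t\<bar> < 1 / Suc n" for n :: nat
  proof -
    have "0 < 1 / real (Suc n)" by simp
    then obtain g where g: "real_polynomial_function g" "\<And>t. t \<in> {a..b} \<Longrightarrow> \<bar>h t - g t\<bar> < 1 / Suc n"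
      using Stone_Weierstrass_real_polynomial_function[OF compact_Icc assms] by blast
    obtain c N where "g = (\<lambda>t. \<Sum>i\<le>(N::nat). c i * t ^ i)"
      using real_polynomial_function_imp_sum[OF g(1)] by blast
    then have "g t = poly (\<Sum>i\<le>N. monom (c i) i) t" for t
      by (simp add: poly_sum poly_monom)
    then show ?thesis using g(2) by metis
  qed
  then obtain q where q: "\<And>n t. t \<in> {a..b} \<Longrightarrow> \<bar>h t - poly (q n) t\<bar> < 1 / real (Suc n)" by metis
  have "uniform_limit {a..b} (\<lambda>n. poly (q n)) h sequentially"
  proof (rule uniform_limitI)
    fix e :: real assume "0 < e"
    then obtain N where N: "1 / real (Suc N) < e" using nat_approx_posE by blast
    show "\<forall>\<^sub>F n in sequentially. \<forall>t\<in>{a..b}. dist (poly (q n) t) (h t) < e"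
    proof (rule eventually_sequentiallyI[of N], intro ballI)
      fix n t assume n: "N \<le> n" and t: "t \<in> {a..b}"
      have "1 / real (Suc n) \<le> 1 / real (Suc N)" using n by (simp add: frac_le)
      then show "dist (poly (q n) t) (h t) < e"
        using q[OF t, of n] N by (simp add: dist_real_def abs_minus_commute)
    qed
  qed
  then show ?thesis by (rule that)
qed

lemma tendsto_of_onorm:
  fixes T :: "'a::real_normed_vector \<Rightarrow> 'b::real_normed_vector"
  assumes "\<And>n. bounded_linear (\<lambda>x. S n x - T x)" "(\<lambda>n. onorm (\<lambda>x. S n x - T x)) \<longlonglongrightarrow> 0"
  shows "(\<lambda>n. S n x) \<longlonglongrightarrow> T x"
proof -
  have "(\<lambda>n. S n x - T x) \<longlonglongrightarrow> 0"
  proof (rule Lim_null_comparison)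
    show "\<forall>\<^sub>F n in sequentially. norm (S n x - T x) \<le> onorm (\<lambda>x. S n x - T x) * norm x"
      using onorm[OF assms(1)] by (intro always_eventually allI)
    show "(\<lambda>n. onorm (\<lambda>x. S n x - T x) * norm x) \<longlonglongrightarrow> 0"
      using tendsto_mult_left_zero[OF assms(2)] .
  qed
  then show ?thesis by (simp add: LIM_zero_iff)
qed

lemma fun_calc_cong:
  assumes "\<And>t. complex_of_real t \<in> op_spectrum A \<Longrightarrow> h t = g t"
  shows "fun_calc h A = fun_calc g A"
proof -
  have "uniform_limit {t. complex_of_real t \<in> op_spectrum A} F h sequentially \<longleftrightarrow>
      uniform_limit {t. complex_of_real t \<in> op_spectrum A} F g sequentially" for F
    by (rule uniform_limit_cong') (use assms in auto)
  then show ?thesis unfolding fun_calc_def by simp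
qed

locale spectrum_in_interval =
  fixes A :: "'h::complex_hilbert_space \<Rightarrow> 'h" and a b :: real
  assumes A: "selfadjoint A" and spec: "op_spectrum A \<subseteq> complex_of_real ` {a..b}"
begin

lemmas lin = selfadjointD(1)[OF A]

abbreviation "rspec \<equiv> {t. complex_of_real t \<in> op_spectrum A}"

lemma rspec_subset: "rspec \<subseteq> {a..b}"
  using spec by (auto simp: image_iff)

lemma poly_op_norm_le_rspec:
  assumes "0 \<le> M" "\<And>t. t \<in> rspec \<Longrightarrow> \<bar>poly q t\<bar> \<le> M"
  shows "norm (poly_op q A x) \<le> M * norm x"
  by (rule poly_op_norm_le[OF A]) (use spec assms in auto)

lemma poly_op_diff_eventually:
  assumes p: "uniform_limit rspec (\<lambda>n. poly (p n)) h sequentially"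
    and q: "uniform_limit rspec (\<lambda>n. poly (q n)) h sequentially" and e: "0 < e"
  shows "\<exists>N. \<forall>m\<ge>N. \<forall>n\<ge>N. \<forall>x. norm (poly_op (p m) A x - poly_op (q n) A x) \<le> e * norm x"
proof -
  from uniform_limitD[OF p, of "e / 2"] uniform_limitD[OF q, of "e / 2"] e
  obtain N where N: "\<And>n t. n \<ge> N \<Longrightarrow> t \<in> rspec \<Longrightarrow> dist (poly (p n) t) (h t) < e / 2"
    "\<And>n t. n \<ge> N \<Longrightarrow> t \<in> rspec \<Longrightarrow> dist (poly (q n) t) (h t) < e / 2"
    unfolding eventually_sequentially by (metis (no_types, lifting) half_gt_zero max.bounded_iff)
  have "norm (poly_op (p m) A x - poly_op (q n) A x) \<le> e * norm x" if "m \<ge> N" "n \<ge> N" for m n x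
    unfolding poly_op_diff[symmetric]
  proof (rule poly_op_norm_le_rspec)
    fix t assume t: "t \<in> rspec"
    show "\<bar>poly (p m - q n) t\<bar> \<le> e"
      using N(1)[OF that(1) t] N(2)[OF that(2) t] unfolding dist_real_def poly_diff by linarith
  qed (use e in simp)
  then show ?thesis by blast
qed

text \<open>
  If \<open>q\<^sub>n\<close> converges uniformly on the spectrum, then \<open>q\<^sub>n(A)\<close> is a Cauchy sequence in norm, by the norm
  bound for polynomials.  Polynomials from the Weierstrass theorem pin down the limit.
\<close>

lemma calculus_exists:
  assumes h: "continuous_on {a..b} h"
  shows "\<exists>!T. bounded_clinear T \<and>
     (\<forall>q :: nat \<Rightarrow> real poly. uniform_limit rspec (\<lambda>n. poly (q n)) h sequentially \<longrightarrow>
        (\<lambda>n. onorm (\<lambda>x. poly_op (q n) A x - T x)) \<longlonglongrightarrow> 0)"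
proof -
  obtain p where "uniform_limit {a..b} (\<lambda>n. poly (p n)) h sequentially"
    using poly_uniform_approximation[OF h] by blast
  then have p: "uniform_limit rspec (\<lambda>n. poly (p n)) h sequentially"
    using rspec_subset uniform_limit_on_subset by blast
  have "Cauchy (\<lambda>n. poly_op (p n) A x)" for x
  proof (rule metric_CauchyI)
    fix e :: real assume e: "0 < e"
    define e' where "e' = e / (norm x + 1)"
    have e': "0 < e'" using e by (simp add: e'_def add_nonneg_pos)
    have "e' * norm x < e' * (norm x + 1)" using e' by (intro mult_strict_left_mono) auto
    also have "\<dots> = e" by (simp add: e'_def add_nonneg_pos less_imp_neq[symmetric])
    finally have small: "e' * norm x < e" .
    from poly_op_diff_eventually[OF p p e'] obtain N
      where "\<And>m n. m \<ge> N \<Longrightarrow> n \<ge> N \<Longrightarrow> norm (poly_op (p m) A x - poly_op (p n) A x) \<le> e' * norm x"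
      by blast
    then show "\<exists>N. \<forall>m\<ge>N. \<forall>n\<ge>N. dist (poly_op (p m) A x) (poly_op (p n) A x) < e"
      using small unfolding dist_norm by (meson le_less_trans)
  qed
  then have "\<exists>y. (\<lambda>n. poly_op (p n) A x) \<longlonglongrightarrow> y" for x
    using Cauchy_convergent convergent_def by blast
  then obtain T where T: "\<And>x. (\<lambda>n. poly_op (p n) A x) \<longlonglongrightarrow> T x" by metis
  have close: "\<exists>N. \<forall>n\<ge>N. \<forall>x. norm (poly_op (q n) A x - T x) \<le> e * norm x"
    if q: "uniform_limit rspec (\<lambda>n. poly (q n)) h sequentially" and e: "0 < e" for q e
  proof -
    from poly_op_diff_eventually[OF p q e] obtain N where
      N: "\<And>m n x. m \<ge> N \<Longrightarrow> n \<ge> N \<Longrightarrow> norm (poly_op (p m) A x - poly_op (q n) A x) \<le> e * norm x"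
      by blast
    have "norm (poly_op (q n) A x - T x) \<le> e * norm x" if n: "n \<ge> N" for n x
    proof -
      have "norm (T x - poly_op (q n) A x) \<le> e * norm x"
      proof (rule LIMSEQ_le_const2)
        show "(\<lambda>m. norm (poly_op (p m) A x - poly_op (q n) A x)) \<longlonglongrightarrow> norm (T x - poly_op (q n) A x)"
          by (intro tendsto_intros T)
      qed (use N n in blast)
      then show ?thesis by (simp add: norm_minus_commute)
    qed
    then show ?thesis by blast
  qed
  have pl: "bounded_clinear (poly_op q A)" for q by (rule bounded_clinear_poly_op[OF lin])
  have Tlin: "bounded_clinear T"
  proof -
    obtain N where N: "\<And>n x. n \<ge> N \<Longrightarrow> norm (poly_op (p n) A x - T x) \<le> 1 * norm x"
      using close[OF p, of 1] by auto
    obtain K where K: "\<And>x. norm (poly_op (p N) A x) \<le> K * norm x"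
      using bounded_clinear_bound[OF pl] by blast
    show ?thesis
    proof (rule bounded_clinearI)
      fix x y c
      have "(\<lambda>n. poly_op (p n) A (x + y)) \<longlonglongrightarrow> T x + T y"
        unfolding bounded_clinearD(3)[OF pl] by (intro tendsto_add T)
      then show "T (x + y) = T x + T y" using T LIMSEQ_unique by blast
      have "bounded_linear (\<lambda>x::'h. c *\<^sub>C x)"
        using bounded_clinearD(1)[OF bounded_clinear_scaleC[OF bounded_clinear_id]] .
      then have "(\<lambda>n. poly_op (p n) A (c *\<^sub>C x)) \<longlonglongrightarrow> c *\<^sub>C T x"
        unfolding bounded_clinearD(2)[OF pl] by (rule bounded_linear.tendsto) (rule T)
      then show "T (c *\<^sub>C x) = c *\<^sub>C T x" using T LIMSEQ_unique by blast
      show "norm (T x) \<le> (K + 1) * norm x"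
        using norm_triangle_ineq4[of "poly_op (p N) A x" "poly_op (p N) A x - T x"]
          N[of N x] K[of x] by (simp add: algebra_simps)
    qed
  qed
  have onorm_lim: "(\<lambda>n. onorm (\<lambda>x. poly_op (q n) A x - T x)) \<longlonglongrightarrow> 0"
    if q: "uniform_limit rspec (\<lambda>n. poly (q n)) h sequentially" for q
  proof (rule LIMSEQ_I)
    fix e :: real assume e: "0 < e"
    then obtain N where N: "\<And>n x. n \<ge> N \<Longrightarrow> norm (poly_op (q n) A x - T x) \<le> e / 2 * norm x"
      using close[OF q, of "e / 2"] by auto
    have "norm (onorm (\<lambda>x. poly_op (q n) A x - T x) - 0) < e" if "n \<ge> N" for n
    proof -
      have "onorm (\<lambda>x. poly_op (q n) A x - T x) \<le> e / 2"
        by (rule onorm_bound) (use e N that in auto)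
      moreover have "0 \<le> onorm (\<lambda>x. poly_op (q n) A x - T x)"
        by (rule onorm_pos_le) (rule bounded_clinearD(1)[OF bounded_clinear_diff[OF pl Tlin]])
      ultimately show ?thesis using e by simp
    qed
    then show "\<exists>N. \<forall>n\<ge>N. norm (onorm (\<lambda>x. poly_op (q n) A x - T x) - 0) < e" by blast
  qed
  show ?thesis
  proof (rule ex1I[of _ T])
    fix T' assume T': "bounded_clinear T' \<and>
     (\<forall>q :: nat \<Rightarrow> real poly. uniform_limit rspec (\<lambda>n. poly (q n)) h sequentially \<longrightarrow>
        (\<lambda>n. onorm (\<lambda>x. poly_op (q n) A x - T' x)) \<longlonglongrightarrow> 0)"
    show "T' = T"
    proof
      fix x
      have "(\<lambda>n. poly_op (p n) A x) \<longlonglongrightarrow> T' x"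
      proof (rule tendsto_of_onorm[where S="\<lambda>n. poly_op (p n) A" and T=T'])
        show "bounded_linear (\<lambda>x. poly_op (p n) A x - T' x)" for n
          using bounded_clinearD(1)[OF bounded_clinear_diff[OF pl]] T' by blast
        show "(\<lambda>n. onorm (\<lambda>x. poly_op (p n) A x - T' x)) \<longlonglongrightarrow> 0" using T' p by blast
      qed
      then show "T' x = T x" using T LIMSEQ_unique by blast
    qed
  qed (use Tlin onorm_lim in blast)
qed

lemma
  assumes h: "continuous_on {a..b} h"
  shows bounded_clinear_fun_calc: "bounded_clinear (fun_calc h A)"
    and fun_calc_onorm_tendsto: "uniform_limit rspec (\<lambda>n. poly (q n)) h sequentially \<Longrightarrow>
        (\<lambda>n. onorm (\<lambda>x. poly_op (q n) A x - fun_calc h A x)) \<longlonglongrightarrow> 0"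
proof -
  have "bounded_clinear (fun_calc h A) \<and>
     (\<forall>q :: nat \<Rightarrow> real poly. uniform_limit rspec (\<lambda>n. poly (q n)) h sequentially \<longrightarrow>
        (\<lambda>n. onorm (\<lambda>x. poly_op (q n) A x - fun_calc h A x)) \<longlonglongrightarrow> 0)"
    unfolding fun_calc_def by (rule theI'[OF calculus_exists[OF h]])
  then show "bounded_clinear (fun_calc h A)"
    "uniform_limit rspec (\<lambda>n. poly (q n)) h sequentially \<Longrightarrow>
        (\<lambda>n. onorm (\<lambda>x. poly_op (q n) A x - fun_calc h A x)) \<longlonglongrightarrow> 0" by blast+
qed

lemma fun_calc_tendsto:
  assumes h: "continuous_on {a..b} h" and q: "uniform_limit {a..b} (\<lambda>n. poly (q n)) h sequentially"
  shows "(\<lambda>n. poly_op (q n) A x) \<longlonglongrightarrow> fun_calc h A x"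
proof (rule tendsto_of_onorm[where S="\<lambda>n. poly_op (q n) A" and T="fun_calc h A"])
  show "bounded_linear (\<lambda>x. poly_op (q n) A x - fun_calc h A x)" for n
    by (intro bounded_clinearD(1) bounded_clinear_diff bounded_clinear_poly_op lin
        bounded_clinear_fun_calc h)
  show "(\<lambda>n. onorm (\<lambda>x. poly_op (q n) A x - fun_calc h A x)) \<longlonglongrightarrow> 0"
    by (rule fun_calc_onorm_tendsto[OF h]) (rule uniform_limit_on_subset[OF q rspec_subset])
qed

lemma fun_calc_eqI:
  assumes "continuous_on {a..b} h" "uniform_limit {a..b} (\<lambda>n. poly (q n)) h sequentially"
    "(\<lambda>n. poly_op (q n) A x) \<longlonglongrightarrow> y"
  shows "fun_calc h A x = y"
  using fun_calc_tendsto[OF assms(1,2)] assms(3) LIMSEQ_unique by blast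

lemma selfadjoint_fun_calc:
  assumes h: "continuous_on {a..b} h"
  shows "selfadjoint (fun_calc h A)"
  unfolding selfadjoint_def
proof (intro conjI allI)
  show "bounded_clinear (fun_calc h A)" by (rule bounded_clinear_fun_calc[OF h])
  fix x y
  obtain q where q: "uniform_limit {a..b} (\<lambda>n. poly (q n)) h sequentially"
    using poly_uniform_approximation[OF h] by blast
  have "inner (fun_calc h A x) y = inner x (fun_calc h A y)" for x y
  proof (rule LIMSEQ_unique)
    show "(\<lambda>n. inner (poly_op (q n) A x) y) \<longlonglongrightarrow> inner (fun_calc h A x) y"
      by (intro tendsto_intros fun_calc_tendsto[OF h q])
    show "(\<lambda>n. inner (poly_op (q n) A x) y) \<longlonglongrightarrow> inner x (fun_calc h A y)"
      unfolding selfadjointD(3)[OF selfadjoint_poly_op[OF A]]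
      by (intro tendsto_intros fun_calc_tendsto[OF h q])
  qed
  note re = this
  have "Im (cinner u v) = Re (cinner u (\<i> *\<^sub>C v))" for u v :: 'h
    by (simp add: cinner_scaleC_right)
  then show "cinner (fun_calc h A x) y = cinner x (fun_calc h A y)"
    using re[of x y] re[of x "\<i> *\<^sub>C y"] bounded_clinearD(2)[OF bounded_clinear_fun_calc[OF h]]
    by (simp add: complex_eq_iff inner_eq_Re_cinner)
qed

lemma fun_calc_norm_le:
  assumes h: "continuous_on {a..b} h" and M: "0 \<le> M" "\<And>t. t \<in> {a..b} \<Longrightarrow> \<bar>h t\<bar> \<le> M"
  shows "norm (fun_calc h A x) \<le> M * norm x"
proof (rule field_le_epsilon)
  fix e :: real assume e: "0 < e"
  obtain q where q: "uniform_limit {a..b} (\<lambda>n. poly (q n)) h sequentially"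
    using poly_uniform_approximation[OF h] by blast
  define e' where "e' = e / (norm x + 1)"
  have e': "0 < e'" using e by (simp add: e'_def add_nonneg_pos)
  have "e' * norm x \<le> e' * (norm x + 1)" using e' by (intro mult_left_mono) auto
  also have "\<dots> = e" by (simp add: e'_def add_nonneg_pos less_imp_neq[symmetric])
  finally have small: "e' * norm x \<le> e" .
  have ev: "\<forall>\<^sub>F n in sequentially. norm (poly_op (q n) A x) \<le> (M + e') * norm x"
    using uniform_limitD[OF q e']
  proof eventually_elim
    case (elim n)
    show ?case
    proof (rule poly_op_norm_le_rspec)
      fix t assume "t \<in> rspec"
      then have t: "t \<in> {a..b}" using rspec_subset by blast
      with elim have "dist (poly (q n) t) (h t) < e'" by blast
      then show "\<bar>poly (q n) t\<bar> \<le> M + e'" using M(2)[OF t] unfolding dist_real_def by linarith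
    qed (use M e' in simp)
  qed
  have "norm (fun_calc h A x) \<le> (M + e') * norm x"
    by (rule tendsto_upperbound[OF tendsto_norm[OF fun_calc_tendsto[OF h q]] ev]) simp
  then show "norm (fun_calc h A x) \<le> M * norm x + e" using small by (simp add: algebra_simps)
qed

lemma fun_calc_add:
  assumes h: "continuous_on {a..b} h" and g: "continuous_on {a..b} g"
  shows "fun_calc (\<lambda>t. h t + g t) A x = fun_calc h A x + fun_calc g A x"
proof -
  obtain p where p: "uniform_limit {a..b} (\<lambda>n. poly (p n)) h sequentially"
    using poly_uniform_approximation[OF h] by blast
  obtain q where q: "uniform_limit {a..b} (\<lambda>n. poly (q n)) g sequentially"
    using poly_uniform_approximation[OF g] by blast
  show ?thesis
  proof (rule fun_calc_eqI)
    show "uniform_limit {a..b} (\<lambda>n. poly (p n + q n)) (\<lambda>t. h t + g t) sequentially"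
      using uniform_limit_add[OF p q] by (simp add: poly_add[abs_def])
    show "(\<lambda>n. poly_op (p n + q n) A x) \<longlonglongrightarrow> fun_calc h A x + fun_calc g A x"
      unfolding poly_op_add by (intro tendsto_add fun_calc_tendsto assms p q)
  qed (intro continuous_intros assms)
qed

lemma fun_calc_poly: "fun_calc (poly p) A x = poly_op p A x"
  by (rule fun_calc_eqI[where q="\<lambda>_. p"]) (auto intro!: continuous_intros uniform_limit_const)

lemma fun_calc_poly_mult:
  assumes h: "continuous_on {a..b} h"
  shows "fun_calc (\<lambda>t. poly p t * h t) A x = poly_op p A (fun_calc h A x)"
proof -
  obtain q where q: "uniform_limit {a..b} (\<lambda>n. poly (q n)) h sequentially"
    using poly_uniform_approximation[OF h] by blast
  have bdd: "bounded (f ` {a..b})" if "continuous_on {a..b} f" for f :: "real \<Rightarrow> real"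
    using compact_imp_bounded[OF compact_continuous_image[OF that compact_Icc]] .
  show ?thesis
  proof (rule fun_calc_eqI)
    show "uniform_limit {a..b} (\<lambda>n. poly (p * q n)) (\<lambda>t. poly p t * h t) sequentially"
      unfolding poly_mult[abs_def]
      by (intro uniform_lim_mult uniform_limit_const q bdd h continuous_intros)
    show "(\<lambda>n. poly_op (p * q n) A x) \<longlonglongrightarrow> poly_op p A (fun_calc h A x)"
      unfolding poly_op_mult[OF lin]
      by (rule bounded_linear.tendsto[OF bounded_clinearD(1)[OF bounded_clinear_poly_op[OF lin]]])
         (rule fun_calc_tendsto[OF h q])
  qed (intro continuous_intros assms)
qed

lemma fun_calc_scale:
  assumes h: "continuous_on {a..b} h"
  shows "fun_calc (\<lambda>t. c * h t) A x = c *\<^sub>R fun_calc h A x"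
  using fun_calc_poly_mult[OF h, of "[:c:]" x]
  by (simp add: poly_op_pCons[OF lin] bounded_clinearD[OF lin])

lemma fun_calc_resolvent:
  assumes "0 < a" "0 \<le> l"
  shows "A (fun_calc (\<lambda>t. 1 / (t + l)) A x) + l *\<^sub>R fun_calc (\<lambda>t. 1 / (t + l)) A x = x"
proof -
  define h where "h t = 1 / (t + l)" for t
  have pos: "t + l > 0" if "t \<in> {a..b}" for t using that assms by auto
  have h: "continuous_on {a..b} h"
    unfolding h_def by (intro continuous_intros) (use pos in force)
  have "fun_calc (\<lambda>t. poly [:l, 1:] t * h t) A = fun_calc (poly [:1:]) A"
  proof (rule fun_calc_cong)
    fix t assume "complex_of_real t \<in> op_spectrum A"
    then have "t \<in> {a..b}" using rspec_subset by blast
    then show "poly [:l, 1:] t * h t = poly [:1:] t" using pos[of t] by (simp add: h_def field_simps)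
  qed
  then have "poly_op [:l, 1:] A (fun_calc h A x) = poly_op [:1:] A x"
    by (metis fun_calc_poly_mult[OF h] fun_calc_poly)
  then show ?thesis
    unfolding h_def[symmetric]
    by (simp add: poly_op_pCons[OF lin] bounded_clinearD[OF lin] add.commute)
qed

lemma inner_nonneg:
  assumes "0 \<le> a"
  shows "0 \<le> inner (A x) x"
proof -
  define c where "c = max a b"
  have "norm (poly_op [:- c, 1:] A x) \<le> c * norm x"
    by (rule poly_op_norm_le_rspec) (use assms rspec_subset in \<open>force simp: c_def\<close>)+
  moreover have "poly_op [:- c, 1:] A x = A x - c *\<^sub>R x"
    by (simp add: poly_op_pCons[OF lin] bounded_clinearD[OF lin])
  ultimately have "\<bar>inner (A x - c *\<^sub>R x) x\<bar> \<le> c * norm x * norm x"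
    using Cauchy_Schwarz_ineq2[of "A x - c *\<^sub>R x" x]
    by (metis mult_right_mono norm_ge_zero order_trans)
  then show ?thesis
    by (simp add: inner_diff_left power2_norm_eq_inner[symmetric] power2_eq_square)
qed

end


section \<open>Functionals that are non-negative on the resolvent functions\<close>

text \<open>
  Normalised tent functions on a finite net.  The right end point \<open>b\<close> is put into the net because a
  correction mass will be placed there.
\<close>

lemma partition_of_unity_interval:
  fixes a b e :: real
  assumes ab: "a \<le> b" and e: "0 < e"
  obtains S :: "real set" and \<phi> :: "real \<Rightarrow> real \<Rightarrow> real" where "finite S" "S \<subseteq> {a..b}" "b \<in> S"
    "\<And>s. continuous_on {a..b} (\<phi> s)" "\<And>s t. t \<in> {a..b} \<Longrightarrow> 0 \<le> \<phi> s t"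
    "\<And>t. t \<in> {a..b} \<Longrightarrow> (\<Sum>s\<in>S. \<phi> s t) = 1"
    "\<And>s t. \<phi> s t \<noteq> 0 \<Longrightarrow> \<bar>t - s\<bar> < e"
proof -
  obtain S0 where S0: "finite S0" "S0 \<subseteq> {a..b}" "{a..b} \<subseteq> (\<Union>s\<in>S0. ball s e)"
  proof (rule compactE_image[of "{a..b}" "{a..b}" "\<lambda>s. ball s e"])
    show "{a..b} \<subseteq> (\<Union>s\<in>{a..b}. ball s e)" using e by force
  qed auto
  define S where "S = insert b S0"
  define \<psi> where "\<psi> s t = max 0 (e - \<bar>t - s\<bar>)" for s t
  define \<phi> where "\<phi> s t = \<psi> s t / (\<Sum>r\<in>S. \<psi> r t)" for s t
  have fin: "finite S" using S0 by (simp add: S_def)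
  have nn: "0 \<le> \<psi> s t" for s t by (simp add: \<psi>_def)
  have pos: "0 < (\<Sum>r\<in>S. \<psi> r t)" if t: "t \<in> {a..b}" for t
  proof -
    obtain s where s: "s \<in> S0" "t \<in> ball s e" using S0(3) t by blast
    then have "0 < \<psi> s t" by (simp add: \<psi>_def dist_real_def abs_minus_commute)
    then show ?thesis using s fin nn by (intro sum_pos2[of S s]) (auto simp: S_def)
  qed
  show ?thesis
  proof
    show "finite S" "S \<subseteq> {a..b}" "b \<in> S" using S0 ab by (auto simp: S_def)
    show "continuous_on {a..b} (\<phi> s)" for s
      unfolding \<phi>_def \<psi>_def
      by (intro continuous_intros) (use pos in \<open>force simp: \<psi>_def\<close>)
    show "0 \<le> \<phi> s t" if "t \<in> {a..b}" for s t unfolding \<phi>_def using nn by (intro divide_nonneg_nonneg sum_nonneg)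
    show "(\<Sum>s\<in>S. \<phi> s t) = 1" if "t \<in> {a..b}" for t
      unfolding \<phi>_def sum_divide_distrib[symmetric] using pos[OF that] by simp
    show "\<bar>t - s\<bar> < e" if "\<phi> s t \<noteq> 0" for s t
      using that by (auto simp: \<phi>_def \<psi>_def max_def split: if_splits)
  qed
qed

lemma partition_interpolation_error:
  assumes S: "finite S" and nn: "\<And>s. 0 \<le> \<phi> s" and one: "(\<Sum>s\<in>S. \<phi> s) = (1::real)"
    and near: "\<And>s. s \<in> S \<Longrightarrow> \<phi> s \<noteq> 0 \<Longrightarrow> \<bar>c t - c s\<bar> \<le> (d::real)"
  shows "\<bar>c t - (\<Sum>s\<in>S. c s * \<phi> s)\<bar> \<le> d"
proof -
  have "c t - (\<Sum>s\<in>S. c s * \<phi> s) = (\<Sum>s\<in>S. (c t - c s) * \<phi> s)"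
    by (simp add: left_diff_distrib sum_subtractf sum_distrib_left[symmetric] one)
  also have "\<bar>\<dots>\<bar> \<le> (\<Sum>s\<in>S. \<bar>(c t - c s) * \<phi> s\<bar>)" by (rule sum_abs)
  also have "\<dots> \<le> (\<Sum>s\<in>S. d * \<phi> s)"
  proof (rule sum_mono)
    fix s assume "s \<in> S"
    then show "\<bar>(c t - c s) * \<phi> s\<bar> \<le> d * \<phi> s"
      using near[of s] nn[of s] by (cases "\<phi> s = 0") (auto simp: abs_mult intro: mult_right_mono)
  qed
  also have "\<dots> = d" by (simp add: sum_distrib_left[symmetric] one)
  finally show ?thesis .
qed

text \<open>
  The continuous version of the duality.  A partition of unity replaces \<open>L\<close> by finitely many weights at the
  net points.  They are non-negative on the functions \<open>m t / (t + l)\<close> only up to an error, but this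
  error is at most \<open>\<delta> / (a + l)\<close> uniformly in \<open>l\<close>.  A small mass at \<open>b\<close>, whose contribution
  \<open>m b / (b + l)\<close> decays in \<open>l\<close> at the same rate, compensates it exactly, and the duality
  applies.
\<close>

lemma functional_nonneg_of_kwong:
  fixes L :: "(real \<Rightarrow> real) \<Rightarrow> real"
  assumes ab: "0 < a" "a \<le> b"
    and add: "\<And>h g. continuous_on {a..b} h \<Longrightarrow> continuous_on {a..b} g \<Longrightarrow>
        L (\<lambda>t. h t + g t) = L h + L g"
    and scale: "\<And>c h. continuous_on {a..b} h \<Longrightarrow> L (\<lambda>t. c * h t) = c * L h"
    and bound: "\<And>h M. continuous_on {a..b} h \<Longrightarrow> (\<And>t. t \<in> {a..b} \<Longrightarrow> \<bar>h t\<bar> \<le> M) \<Longrightarrow> \<bar>L h\<bar> \<le> C * M"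
    and C: "0 \<le> C"
    and m: "continuous_on {a..b} m" "0 < m b" "0 \<le> \<kappa>"
      "\<And>l s t. 0 \<le> l \<Longrightarrow> s \<in> {a..b} \<Longrightarrow> t \<in> {a..b} \<Longrightarrow>
          \<bar>m t / (t + l) - m s / (s + l)\<bar> \<le> \<kappa> * \<bar>t - s\<bar> / (a + l)"
    and nonneg: "\<And>l. 0 \<le> l \<Longrightarrow> 0 \<le> L (\<lambda>t. m t / (t + l))"
    and f: "kwong_kernel f" "continuous_on {0<..} f"
  shows "0 \<le> L (\<lambda>t. m t * (f (sqrt t) / sqrt t))"
proof -
  define h where "h t = m t * (f (sqrt t) / sqrt t)" for t
  have h: "continuous_on {a..b} h"
    unfolding h_def
    by (intro continuous_intros m(1) continuous_on_compose2[OF f(2)]) (use ab in auto)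
  have hb: "0 \<le> h b"
    unfolding h_def using m(2) ab by (intro mult_nonneg_nonneg divide_nonneg_nonneg kwong_kernel_nonneg[OF f(1)]) auto
  have sum: "continuous_on {a..b} (\<lambda>t. \<Sum>s\<in>S. c s * \<phi> s t) \<and>
      L (\<lambda>t. \<Sum>s\<in>S. c s * \<phi> s t) = (\<Sum>s\<in>S. c s * L (\<phi> s))"
    if "finite S" "\<And>s. continuous_on {a..b} (\<phi> s)" for S and c :: "real \<Rightarrow> real" and \<phi>
    using that(1)
  proof (induction S)
    case empty
    then show ?case using scale[of "\<lambda>_. 0" 0] by simp
  next
    case (insert s S)
    have cs: "continuous_on {a..b} (\<lambda>t. c s * \<phi> s t)" by (intro continuous_intros that(2))
    have IH: "continuous_on {a..b} (\<lambda>t. \<Sum>s\<in>S. c s * \<phi> s t)"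
      "L (\<lambda>t. \<Sum>s\<in>S. c s * \<phi> s t) = (\<Sum>s\<in>S. c s * L (\<phi> s))" using insert.IH by auto
    show ?case
      using insert.hyps add[OF cs IH(1)] scale[OF that(2), of "c s" s] IH(2)
        continuous_on_add[OF cs IH(1)] by simp
  qed
  \<comment> \<open>The functional is compared with the weights it gives to a fine partition of unity.\<close>
  have main: "- L h \<le> d * (C * \<kappa> * b / (a * m b) * h b + C)" if d: "0 < d" for d
  proof -
    have "uniformly_continuous_on {a..b} h" by (rule compact_uniformly_continuous[OF h]) simp
    then obtain e1 where e1: "0 < e1"
      "\<And>s t. s \<in> {a..b} \<Longrightarrow> t \<in> {a..b} \<Longrightarrow> \<bar>t - s\<bar> < e1 \<Longrightarrow> \<bar>h t - h s\<bar> < d"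
      using d unfolding uniformly_continuous_on_def dist_real_def by metis
    define e where "e = min e1 d"
    have "0 < e" using e1(1) d by (simp add: e_def)
    with ab(2) obtain S and \<phi> :: "real \<Rightarrow> real \<Rightarrow> real" where S: "finite S" "S \<subseteq> {a..b}" "b \<in> S"
      and cont: "\<And>s. continuous_on {a..b} (\<phi> s)" and nn: "\<And>s t. t \<in> {a..b} \<Longrightarrow> 0 \<le> \<phi> s t"
      and one: "\<And>t. t \<in> {a..b} \<Longrightarrow> (\<Sum>s\<in>S. \<phi> s t) = 1"
      and near: "\<And>s t. \<phi> s t \<noteq> 0 \<Longrightarrow> \<bar>t - s\<bar> < e"
      using partition_of_unity_interval by metis
    have approx: "\<bar>L c - (\<Sum>s\<in>S. c s * L (\<phi> s))\<bar> \<le> C * M"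
      if c: "continuous_on {a..b} c"
        "\<And>s t. s \<in> {a..b} \<Longrightarrow> t \<in> {a..b} \<Longrightarrow> \<bar>t - s\<bar> < e \<Longrightarrow> \<bar>c t - c s\<bar> \<le> M" for c M
    proof -
      note sc = sum[OF S(1) cont, of c]
      have "\<bar>L (\<lambda>t. c t + (-1) * (\<Sum>s\<in>S. c s * \<phi> s t))\<bar> \<le> C * M"
      proof (rule bound)
        fix t assume t: "t \<in> {a..b}"
        have "\<bar>c t - (\<Sum>s\<in>S. c s * \<phi> s t)\<bar> \<le> M"
          by (rule partition_interpolation_error[OF S(1)])
             (use nn one near c(2) t S(2) in auto)
        then show "\<bar>c t + (-1) * (\<Sum>s\<in>S. c s * \<phi> s t)\<bar> \<le> M" by simp
      qed (intro continuous_intros c(1) cont)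
      also have "L (\<lambda>t. c t + (-1) * (\<Sum>s\<in>S. c s * \<phi> s t)) = L c - (\<Sum>s\<in>S. c s * L (\<phi> s))"
        using add[OF c(1) continuous_on_mult_left[OF conjunct1[OF sc], of "-1"]]
          scale[OF conjunct1[OF sc], of "-1"] sc by simp
      finally show ?thesis .
    qed
    \<comment> \<open>The least mass at \<open>b\<close> that outweighs the interpolation error for every \<open>l\<close>.\<close>
    define \<eta> where "\<eta> = C * \<kappa> * d * b / (a * m b)"
    define u where "u s = L (\<phi> s) + (if s = b then \<eta> else 0)" for s
    have usum: "(\<Sum>s\<in>S. u s * c s) = (\<Sum>s\<in>S. c s * L (\<phi> s)) + \<eta> * c b" for c
    proof -
      have "(\<Sum>s\<in>S. u s * c s) = (\<Sum>s\<in>S. c s * L (\<phi> s)) + (\<Sum>s\<in>S. if s = b then \<eta> * c b else 0)"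
        unfolding sum.distrib[symmetric] by (intro sum.cong refl) (simp add: u_def algebra_simps)
      then show ?thesis using S by simp
    qed
    have pos: "0 < s" if "s \<in> S" for s using that S(2) ab(1) by force
    have u_nonneg: "0 \<le> (\<Sum>s\<in>S. u s * (m s / (s + l)))" if l: "0 \<le> l" for l
    proof -
      let ?c = "\<lambda>t. m t / (t + l)"
      have "\<bar>L ?c - (\<Sum>s\<in>S. ?c s * L (\<phi> s))\<bar> \<le> C * (\<kappa> * d / (a + l))"
      proof (rule approx)
        show "continuous_on {a..b} ?c" by (intro continuous_intros m(1)) (use ab l in auto)
        fix s t assume st: "s \<in> {a..b}" "t \<in> {a..b}" "\<bar>t - s\<bar> < e"
        have "\<bar>?c t - ?c s\<bar> \<le> \<kappa> * \<bar>t - s\<bar> / (a + l)" by (rule m(4)[OF l st(1,2)])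
        also have "\<dots> \<le> \<kappa> * d / (a + l)"
          using st(3) m(3) ab l by (intro divide_right_mono mult_left_mono) (auto simp: e_def)
        finally show "\<bar>?c t - ?c s\<bar> \<le> \<kappa> * d / (a + l)" .
      qed
      moreover have "C * (\<kappa> * d / (a + l)) \<le> \<eta> * ?c b"
      proof -
        have "1 / (a + l) \<le> b / (a * (b + l))"
        proof -
          have "a * (b + l) \<le> b * (a + l)" using mult_right_mono[OF ab(2) l] by (simp add: algebra_simps)
          then have "(1 * a * (b + l)) / (a * (b + l) * (a + l)) \<le> (b * (a + l)) / (a * (b + l) * (a + l))"
            using ab l by (intro divide_right_mono) auto
          then show ?thesis using ab l by simp
        qed
        then have "C * \<kappa> * d * (1 / (a + l)) \<le> C * \<kappa> * d * (b / (a * (b + l)))"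
          using C m(3) d by (intro mult_left_mono) auto
        then show ?thesis using m(2) ab l by (simp add: \<eta>_def mult.assoc)
      qed
      ultimately show ?thesis unfolding usum using nonneg[OF l] by linarith
    qed
    have inj: "inj_on sqrt S" by (intro inj_onI) simp
    have "0 \<le> (\<Sum>x\<in>sqrt ` S. u (x\<^sup>2) * m (x\<^sup>2) * (f x / x))"
    proof (rule kwong_duality[OF _ _ _ f(1)])
      show "finite (sqrt ` S)" "sqrt ` S \<subseteq> {0<..}" using S(1) pos by auto
      fix l :: real assume l: "0 \<le> l"
      have "(\<Sum>x\<in>sqrt ` S. u (x\<^sup>2) * m (x\<^sup>2) / (x\<^sup>2 + l)) = (\<Sum>s\<in>S. u s * (m s / (s + l)))"
        unfolding sum.reindex[OF inj] by (intro sum.cong refl) (simp add: less_imp_le pos)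
      then show "0 \<le> (\<Sum>x\<in>sqrt ` S. u (x\<^sup>2) * m (x\<^sup>2) / (x\<^sup>2 + l))" using u_nonneg[OF l] by simp
    qed
    also have "\<dots> = (\<Sum>s\<in>S. u s * h s)"
      unfolding sum.reindex[OF inj] by (intro sum.cong refl) (simp add: less_imp_le pos h_def)
    finally have "0 \<le> (\<Sum>s\<in>S. h s * L (\<phi> s)) + \<eta> * h b" unfolding usum .
    moreover have "\<bar>L h - (\<Sum>s\<in>S. h s * L (\<phi> s))\<bar> \<le> C * d"
      by (rule approx[OF h]) (use e1(2) in \<open>force simp: e_def\<close>)
    moreover have "\<eta> * h b + C * d = d * (C * \<kappa> * b / (a * m b) * h b + C)"
      by (simp add: \<eta>_def algebra_simps)
    ultimately show ?thesis by linarith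
  qed
  define k where "k = C * \<kappa> * b / (a * m b) * h b + C"
  have k: "0 \<le> k" unfolding k_def using C m ab hb by simp
  have "- L h \<le> 0 + e" if "0 < e" for e
  proof -
    have "- L h \<le> e / (k + 1) * k" using main[of "e / (k + 1)"] that k unfolding k_def by simp
    also have "\<dots> \<le> e" using that k by (simp add: field_simps)
    finally show ?thesis by simp
  qed
  then have "- L h \<le> 0" by (rule field_le_epsilon)
  then show ?thesis unfolding h_def by simp
qed


section \<open>Kwong functions give operator monotone functions\<close>

locale ordered_pair =
  A: spectrum_in_interval A a b + B: spectrum_in_interval B a b
  for A B :: "'h::complex_hilbert_space \<Rightarrow> 'h" and a b +
  assumes ab: "0 < a" "a \<le> b" and le: "op_le A B"
begin

text \<open>
  The functional to which the preceding section is applied, for a fixed vector \<open>v\<close>.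
\<close>

definition gap :: "'h \<Rightarrow> (real \<Rightarrow> real) \<Rightarrow> real" where
  "gap v h = inner (fun_calc h B v) v - inner (fun_calc h A v) v"

lemma gap_add:
  assumes "continuous_on {a..b} h" "continuous_on {a..b} g"
  shows "gap v (\<lambda>t. h t + g t) = gap v h + gap v g"
  by (simp add: gap_def A.fun_calc_add[OF assms] B.fun_calc_add[OF assms] inner_add_left)

lemma gap_scale: "continuous_on {a..b} h \<Longrightarrow> gap v (\<lambda>t. c * h t) = c * gap v h"
  by (simp add: gap_def A.fun_calc_scale B.fun_calc_scale algebra_simps)

lemma gap_bound:
  assumes h: "continuous_on {a..b} h" "\<And>t. t \<in> {a..b} \<Longrightarrow> \<bar>h t\<bar> \<le> M"
  shows "\<bar>gap v h\<bar> \<le> 2 * (norm v)\<^sup>2 * M"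
proof -
  have "0 \<le> M" using h(2)[of a] ab by auto
  then have n: "norm (fun_calc h A v) \<le> M * norm v" "norm (fun_calc h B v) \<le> M * norm v"
    using A.fun_calc_norm_le[OF h(1)] B.fun_calc_norm_le[OF h(1)] h(2) by auto
  have "\<bar>inner y v\<bar> \<le> M * (norm v)\<^sup>2" if "norm y \<le> M * norm v" for y
  proof -
    have "\<bar>inner y v\<bar> \<le> norm y * norm v" by (rule Cauchy_Schwarz_ineq2)
    also have "\<dots> \<le> M * norm v * norm v" using that by (intro mult_right_mono) auto
    finally show ?thesis by (simp add: power2_eq_square)
  qed
  from this[OF n(1)] this[OF n(2)]
  have "\<bar>gap v h\<bar> \<le> M * (norm v)\<^sup>2 + M * (norm v)\<^sup>2" unfolding gap_def by linarith
  then show ?thesis by (simp add: algebra_simps)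
qed

lemma gap_cong:
  assumes "\<And>t. t \<in> {a..b} \<Longrightarrow> h t = g t"
  shows "gap v h = gap v g"
proof -
  have "fun_calc h A = fun_calc g A" "fun_calc h B = fun_calc g B"
    by (rule fun_calc_cong; use assms A.rspec_subset B.rspec_subset in blast)+
  then show ?thesis by (simp add: gap_def)
qed

text \<open>
  Inversion is antitone.  With \<open>x = (B + l)\<^bsup>-1\<^esup> v\<close> and \<open>y = (A + l)\<^bsup>-1\<^esup> v\<close>, expand
  \<open>0 \<le> \<langle>(A + l)(x - y), x - y\<rangle>\<close> and use \<open>\<langle>(A + l) x, x\<rangle> \<le> \<langle>(B + l) x, x\<rangle> = \<langle>v, x\<rangle>\<close>.
\<close>

lemma resolvent_gap:
  assumes l: "0 \<le> l"
  shows "gap v (\<lambda>t. 1 / (t + l)) \<le> 0"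
proof -
  define x where "x = fun_calc (\<lambda>t. 1 / (t + l)) B v"
  define y where "y = fun_calc (\<lambda>t. 1 / (t + l)) A v"
  have x: "B x + l *\<^sub>R x = v" unfolding x_def by (rule B.fun_calc_resolvent[OF ab(1) l])
  have y: "A y + l *\<^sub>R y = v" unfolding y_def by (rule A.fun_calc_resolvent[OF ab(1) l])
  have "0 \<le> inner (A (x - y)) (x - y) + l * inner (x - y) (x - y)"
    using A.inner_nonneg[of "x - y"] ab(1) l by simp
  also have "\<dots> = inner (A x + l *\<^sub>R x) x - 2 * inner (A y + l *\<^sub>R y) x + inner (A y + l *\<^sub>R y) y"
    using selfadjointD(3)[OF A.A, of x y] selfadjointD(3)[OF A.A, of y x]
    by (simp add: bounded_clinearD[OF A.lin] inner_diff_left inner_diff_right inner_add_left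
        inner_commute algebra_simps)
  also have "\<dots> = inner (A x + l *\<^sub>R x) x - 2 * inner v x + inner v y" by (simp only: y)
  also have "inner (A x + l *\<^sub>R x) x \<le> inner (B x + l *\<^sub>R x) x"
    using le op_le_iff[OF A.A B.A] by (simp add: inner_add_left)
  finally have "inner x v \<le> inner y v" unfolding x by (simp add: inner_commute)
  then show ?thesis unfolding gap_def x_def y_def by simp
qed

text \<open>
  The multiplier \<open>m t = t\<close> tests on \<open>t / (t + l) = 1 - l / (t + l)\<close> and gives the increasing case; \<open>m = 1\<close>
  tests on the resolvents themselves and gives the decreasing case.
\<close>

lemma gap_kwong:
  assumes f: "kwong_kernel f" "continuous_on {0<..} f"
  shows "0 \<le> gap v (\<lambda>t. t * (f (sqrt t) / sqrt t))" (is ?inc)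
    and "gap v (\<lambda>t. 1 * (f (sqrt t) / sqrt t)) \<le> 0" (is ?dec)
proof -
  have cont: "continuous_on {a..b} (\<lambda>t. 1 / (t + l))" if "0 \<le> l" for l
    by (intro continuous_intros) (use ab that in auto)
  show ?inc
  proof (rule functional_nonneg_of_kwong[OF ab gap_add gap_scale gap_bound, where \<kappa>=1])
    fix l s t :: real assume l: "0 \<le> l"
    assume "s \<in> {a..b}" "t \<in> {a..b}"
    then have st: "a \<le> s" "a \<le> t" by auto
    have p: "0 < a + l" "0 < s + l" "0 < t + l" using st l ab by auto
    have "\<bar>t / (t + l) - s / (s + l)\<bar> = \<bar>t - s\<bar> * l / ((t + l) * (s + l))"
    proof -
      have "t / (t + l) - s / (s + l) = (t - s) * l / ((t + l) * (s + l))"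
        using p by (simp add: field_simps)
      then show ?thesis using p l by (simp add: abs_mult)
    qed
    also have "\<dots> \<le> \<bar>t - s\<bar> * (t + l) / ((t + l) * (a + l))"
      using p st l ab by (intro frac_le mult_left_mono) auto
    also have "\<dots> = 1 * \<bar>t - s\<bar> / (a + l)" using p by simp
    finally show "\<bar>t / (t + l) - s / (s + l)\<bar> \<le> 1 * \<bar>t - s\<bar> / (a + l)" .
  next
    fix l :: real assume l: "0 \<le> l"
    have "gap v (\<lambda>t. t / (t + l)) = gap v (\<lambda>t. poly [:1:] t + (- l) * (1 / (t + l)))"
      by (rule gap_cong) (use ab l in \<open>simp add: field_simps\<close>)
    also have "\<dots> = gap v (poly [:1:]) + (- l) * gap v (\<lambda>t. 1 / (t + l))"
      unfolding gap_scale[OF cont[OF l], symmetric]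
      by (intro gap_add continuous_on_mult_left cont[OF l]) (intro continuous_intros)
    also have "gap v (poly [:1:]) = 0"
      by (simp add: gap_def A.fun_calc_poly B.fun_calc_poly poly_op_pCons A.lin B.lin
          bounded_clinearD[OF A.lin] bounded_clinearD[OF B.lin] del: poly_pCons)
    finally show "0 \<le> gap v (\<lambda>t. t / (t + l))"
      using resolvent_gap[OF l, of v] l by (simp add: mult_nonneg_nonpos)
  qed (use ab f in \<open>auto intro!: continuous_intros\<close>)
  have "0 \<le> - gap v (\<lambda>t. 1 * (f (sqrt t) / sqrt t))"
  proof (rule functional_nonneg_of_kwong[OF ab, where L="\<lambda>h. - gap v h" and m="\<lambda>_. 1"
        and C="2 * (norm v)\<^sup>2" and \<kappa>="1 / a"])
    fix l s t :: real assume l: "0 \<le> l"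
    assume "s \<in> {a..b}" "t \<in> {a..b}"
    then have st: "a \<le> s" "a \<le> t" by auto
    have p: "0 < a + l" "0 < s + l" "0 < t + l" using st l ab by auto
    have "1 / (t + l) - 1 / (s + l) = (s - t) / ((t + l) * (s + l))"
      using p by (simp add: field_simps)
    then have "\<bar>1 / (t + l) - 1 / (s + l)\<bar> = \<bar>t - s\<bar> / ((t + l) * (s + l))"
      using p by (simp add: abs_mult abs_minus_commute)
    also have "\<dots> \<le> \<bar>t - s\<bar> / (a * (a + l))"
      using p st l ab by (intro divide_left_mono mult_mono) auto
    finally show "\<bar>1 / (t + l) - 1 / (s + l)\<bar> \<le> 1 / a * \<bar>t - s\<bar> / (a + l)" by simp
  next
    fix h :: "real \<Rightarrow> real" and M assume "continuous_on {a..b} h" "\<And>t. t \<in> {a..b} \<Longrightarrow> \<bar>h t\<bar> \<le> M"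
    then show "\<bar>- gap v h\<bar> \<le> 2 * (norm v)\<^sup>2 * M" using gap_bound by simp
  qed (use ab f resolvent_gap in \<open>auto simp: gap_add gap_scale\<close>)
  then show ?dec by simp
qed

end

lemma op_le_fun_calc_of_kwong:
  fixes A B :: "'h::complex_hilbert_space \<Rightarrow> 'h"
  assumes A: "selfadjoint A" "op_spectrum A \<subseteq> complex_of_real ` {0<..}"
    and B: "selfadjoint B" "op_spectrum B \<subseteq> complex_of_real ` {0<..}"
    and le: "op_le A B" and f: "kwong_kernel f" "continuous_on {0<..} f"
  shows "op_le (fun_calc (\<lambda>t. t * (f (sqrt t) / sqrt t)) A) (fun_calc (\<lambda>t. t * (f (sqrt t) / sqrt t)) B)"
    and "op_le (fun_calc (\<lambda>t. f (sqrt t) / sqrt t) B) (fun_calc (\<lambda>t. f (sqrt t) / sqrt t) A)"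
proof -
  obtain a1 b1 where 1: "0 < a1" "a1 < b1" "op_spectrum A \<subseteq> complex_of_real ` {a1..b1}"
    using op_spectrum_subset_interval[OF selfadjointD(1)[OF A(1)] A(2)] by blast
  obtain a2 b2 where 2: "0 < a2" "a2 < b2" "op_spectrum B \<subseteq> complex_of_real ` {a2..b2}"
    using op_spectrum_subset_interval[OF selfadjointD(1)[OF B(1)] B(2)] by blast
  define a b where "a = min a1 a2" and "b = max b1 b2"
  have "{a1..b1} \<subseteq> {a..b}" "{a2..b2} \<subseteq> {a..b}" by (auto simp: a_def b_def)
  then interpret ordered_pair A B a b
    using 1 2 A B le by unfold_locales (blast | simp add: a_def b_def)+
  have cont: "continuous_on {a..b} (\<lambda>t. f (sqrt t) / sqrt t)"
    by (intro continuous_intros continuous_on_compose2[OF f(2)]) (use ab in auto)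
  have cont2: "continuous_on {a..b} (\<lambda>t. t * (f (sqrt t) / sqrt t))"
    by (intro continuous_on_mult continuous_on_id cont)
  show "op_le (fun_calc (\<lambda>t. t * (f (sqrt t) / sqrt t)) A) (fun_calc (\<lambda>t. t * (f (sqrt t) / sqrt t)) B)"
    unfolding op_le_iff[OF A.selfadjoint_fun_calc[OF cont2] B.selfadjoint_fun_calc[OF cont2]]
    using gap_kwong(1)[OF f] unfolding gap_def diff_ge_0_iff_ge by blast
  show "op_le (fun_calc (\<lambda>t. f (sqrt t) / sqrt t) B) (fun_calc (\<lambda>t. f (sqrt t) / sqrt t) A)"
    unfolding op_le_iff[OF B.selfadjoint_fun_calc[OF cont] A.selfadjoint_fun_calc[OF cont]]
    using gap_kwong(2)[OF f] unfolding gap_def diff_le_0_iff_le mult_1 by blast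
qed


section \<open>Operators that are diagonal on an orthonormal family\<close>

lemma cmod_cinner_le: "cmod (cinner x y) \<le> norm x * norm (y::'h::complex_hilbert_space)"
proof (cases "cinner x y = 0")
  case False
  define c where "c = cnj (cinner x y) / cmod (cinner x y)"
  have c: "cmod c = 1" using False by (simp add: c_def norm_divide)
  have "cinner (c *\<^sub>C x) y = complex_of_real (cmod (cinner x y))"
    using False complex_norm_square[of "cinner x y"]
    by (simp add: cinner_scaleC_left c_def field_simps power2_eq_square)
  then have "cmod (cinner x y) = inner (c *\<^sub>C x) y" by (simp add: inner_eq_Re_cinner)
  also have "\<dots> \<le> norm (c *\<^sub>C x) * norm y" by (rule norm_cauchy_schwarz)
  finally show ?thesis by (simp add: norm_scaleC c)
qed simp

lemma poly_interpolation:
  fixes h :: "real \<Rightarrow> real"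
  assumes "finite S"
  shows "\<exists>p. \<forall>s\<in>S. poly p s = h s"
  using assms
proof (induction S)
  case (insert x S)
  then obtain p where p: "\<forall>s\<in>S. poly p s = h s" by blast
  define q where "q = (\<Prod>s\<in>S. [:- s, 1:])"
  have q: "poly q t = (\<Prod>s\<in>S. t - s)" for t by (simp add: q_def poly_prod)
  have "poly q x \<noteq> 0" "\<And>s. s \<in> S \<Longrightarrow> poly q s = 0"
    using insert.hyps by (auto simp: q prod_zero_iff)
  then have "\<forall>s\<in>insert x S. poly (p + smult ((h x - poly p x) / poly q x) q) s = h s"
    using p by auto
  then show ?case by blast
qed simp

locale orthonormal_family =
  fixes I :: "'i set" and f :: "'i \<Rightarrow> 'h::complex_hilbert_space"
  assumes fin: "finite I"
    and ortho: "\<And>i j. i \<in> I \<Longrightarrow> j \<in> I \<Longrightarrow> cinner (f i) (f j) = (if i = j then 1 else 0)"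
begin

definition comb :: "('i \<Rightarrow> complex) \<Rightarrow> 'h" where
  "comb c = (\<Sum>i\<in>I. c i *\<^sub>C f i)"

text \<open>
  The operator that multiplies \<open>f i\<close> by \<open>\<theta> i\<close> and acts as \<open>\<mu>\<close> on the orthogonal complement of the
  family.  This transplants diagonal matrices to an arbitrary Hilbert space.
\<close>

definition diag :: "complex \<Rightarrow> ('i \<Rightarrow> complex) \<Rightarrow> 'h \<Rightarrow> 'h" where
  "diag \<mu> \<theta> x = \<mu> *\<^sub>C x + comb (\<lambda>i. (\<theta> i - \<mu>) * cinner x (f i))"

lemma comb_add: "comb c + comb d = comb (\<lambda>i. c i + d i)"
  by (simp add: comb_def sum.distrib scaleC_add_left)

lemma comb_scale: "a *\<^sub>C comb c = comb (\<lambda>i. a * c i)"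
  by (simp add: comb_def scaleC_sum_right scaleC_scaleC)

lemma comb_cong: "(\<And>i. i \<in> I \<Longrightarrow> c i = d i) \<Longrightarrow> comb c = comb d"
  by (simp add: comb_def)

lemma cinner_comb_right: "cinner x (comb c) = (\<Sum>i\<in>I. cnj (c i) * cinner x (f i))"
  by (simp add: comb_def cinner_sum_right cinner_scaleC_right)

lemma cinner_comb_basis:
  assumes "j \<in> I"
  shows "cinner (comb c) (f j) = c j"
proof -
  have "cinner (comb c) (f j) = (\<Sum>i\<in>I. if i = j then c j else 0)"
    unfolding comb_def cinner_sum_left
    by (intro sum.cong refl) (use assms in \<open>simp add: cinner_scaleC_left ortho\<close>)
  then show ?thesis using assms fin by simp
qed

lemma cinner_comb_comb: "cinner (comb c) (comb d) = (\<Sum>i\<in>I. c i * cnj (d i))"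
  unfolding cinner_comb_right by (intro sum.cong refl) (simp add: cinner_comb_basis)

lemma diag_comb: "diag \<mu> \<theta> (comb c) = comb (\<lambda>i. \<theta> i * c i)"
  unfolding diag_def comb_scale comb_add
  by (rule comb_cong) (simp add: cinner_comb_basis algebra_simps)

lemma cinner_diag_basis:
  assumes "j \<in> I"
  shows "cinner (diag \<mu> \<theta> x) (f j) = \<theta> j * cinner x (f j)"
  unfolding diag_def
  by (simp add: cinner_add_left cinner_scaleC_left cinner_comb_basis[OF assms] algebra_simps)

lemma diag_diag: "diag \<mu> \<theta> (diag \<nu> \<eta> x) = diag (\<mu> * \<nu>) (\<lambda>i. \<theta> i * \<eta> i) x"
proof -
  have "diag \<mu> \<theta> (diag \<nu> \<eta> x) =
      \<mu> *\<^sub>C diag \<nu> \<eta> x + comb (\<lambda>i. (\<theta> i - \<mu>) * (\<eta> i * cinner x (f i)))"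
    unfolding diag_def[of \<mu>] by (intro arg_cong2[of _ _ _ _ "(+)"] refl comb_cong)
      (simp add: cinner_diag_basis)
  also have "\<dots> = diag (\<mu> * \<nu>) (\<lambda>i. \<theta> i * \<eta> i) x"
    unfolding diag_def scaleC_add_right scaleC_scaleC comb_scale add.assoc comb_add
    by (intro arg_cong2[of _ _ _ _ "(+)"] refl comb_cong) (simp add: algebra_simps)
  finally show ?thesis .
qed

lemma diag_add: "diag \<mu> \<theta> x + diag \<nu> \<eta> x = diag (\<mu> + \<nu>) (\<lambda>i. \<theta> i + \<eta> i) x"
proof -
  have "diag \<mu> \<theta> x + diag \<nu> \<eta> x = (\<mu> + \<nu>) *\<^sub>C x
      + (comb (\<lambda>i. (\<theta> i - \<mu>) * cinner x (f i)) + comb (\<lambda>i. (\<eta> i - \<nu>) * cinner x (f i)))"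
    by (simp add: diag_def scaleC_add_left)
  also have "\<dots> = diag (\<mu> + \<nu>) (\<lambda>i. \<theta> i + \<eta> i) x"
    unfolding diag_def comb_add
    by (intro arg_cong2[of _ _ _ _ "(+)"] refl comb_cong) (simp add: algebra_simps)
  finally show ?thesis .
qed

lemma diag_const: "diag c (\<lambda>_. c) x = c *\<^sub>C x"
  by (simp add: diag_def comb_def)

lemma diag_cong:
  assumes "\<mu> = \<nu>" "\<And>i. i \<in> I \<Longrightarrow> \<theta> i = \<eta> i"
  shows "diag \<mu> \<theta> x = diag \<nu> \<eta> x"
  by (simp add: diag_def comb_def assms)

lemma bounded_clinear_diag: "bounded_clinear (diag \<mu> \<theta>)"
proof -
  have rank_one: "bounded_clinear (\<lambda>x. ((\<theta> i - \<mu>) * cinner x (f i)) *\<^sub>C f i)" for i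
  proof (rule bounded_clinearI)
    fix x
    have "cmod (\<theta> i - \<mu>) * cmod (cinner x (f i)) * norm (f i)
        \<le> cmod (\<theta> i - \<mu>) * (norm x * norm (f i)) * norm (f i)"
      by (intro mult_right_mono mult_left_mono cmod_cinner_le) auto
    then show "norm (((\<theta> i - \<mu>) * cinner x (f i)) *\<^sub>C f i)
        \<le> (cmod (\<theta> i - \<mu>) * norm (f i) * norm (f i)) * norm x"
      by (simp add: norm_scaleC norm_mult mult_ac)
  qed (simp_all add: cinner_add_left cinner_scaleC_left scaleC_scaleC scaleC_add_left[symmetric]
      algebra_simps)
  have sum: "bounded_clinear (\<lambda>x. \<Sum>i\<in>J. ((\<theta> i - \<mu>) * cinner x (f i)) *\<^sub>C f i)" if "finite J" for J
    using that
    by (induction J) (auto intro: bounded_clinear_zero bounded_clinear_add[OF rank_one])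
  show ?thesis
    unfolding diag_def[abs_def] comb_def
    by (intro bounded_clinear_add bounded_clinear_scaleC bounded_clinear_id sum[OF fin])
qed

lemma selfadjoint_diag: "selfadjoint (diag (of_real \<mu>) (\<lambda>i. of_real (\<theta> i)))"
  unfolding selfadjoint_def
proof (intro conjI allI bounded_clinear_diag)
  fix x y
  have "cinner (comb (\<lambda>i. (of_real (\<theta> i) - of_real \<mu>) * cinner x (f i))) y =
      cinner x (comb (\<lambda>i. (of_real (\<theta> i) - of_real \<mu>) * cinner y (f i)))"
    unfolding cinner_comb_right
    by (simp add: comb_def cinner_sum_left cinner_scaleC_left cinner_commute[of y] mult_ac)
  then show "cinner (diag (of_real \<mu>) (\<lambda>i. of_real (\<theta> i)) x) y =
      cinner x (diag (of_real \<mu>) (\<lambda>i. of_real (\<theta> i)) y)"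
    by (simp add: diag_def cinner_add_left cinner_add_right cinner_scaleC_left cinner_scaleC_right)
qed

lemma op_spectrum_diag: "op_spectrum (diag \<mu> \<theta>) \<subseteq> insert \<mu> (\<theta> ` I)"
proof
  fix z assume z: "z \<in> op_spectrum (diag \<mu> \<theta>)"
  show "z \<in> insert \<mu> (\<theta> ` I)"
  proof (rule ccontr)
    assume nz: "z \<notin> insert \<mu> (\<theta> ` I)"
    define R where "R = diag (1 / (\<mu> - z)) (\<lambda>i. 1 / (\<theta> i - z))"
    have shift: "diag \<mu> \<theta> x - z *\<^sub>C x = diag (\<mu> - z) (\<lambda>i. \<theta> i - z) x" for x
      using diag_add[of "\<mu> - z" "\<lambda>i. \<theta> i - z" x z "\<lambda>_. z"] by (simp add: diag_const diff_eq_eq)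
    have "R (diag \<mu> \<theta> x - z *\<^sub>C x) = diag 1 (\<lambda>_. 1) x" for x
      unfolding shift R_def diag_diag by (rule diag_cong) (use nz in auto)
    moreover have "diag \<mu> \<theta> (R x) - z *\<^sub>C R x = diag 1 (\<lambda>_. 1) x" for x
      unfolding shift unfolding R_def diag_diag by (rule diag_cong) (use nz in auto)
    ultimately have "z \<notin> op_spectrum (diag \<mu> \<theta>)"
      unfolding op_spectrum_def using bounded_clinear_diag[of "1 / (\<mu> - z)"]
      by (auto simp: diag_const R_def)
    then show False using z by simp
  qed
qed

lemma op_spectrum_diag_of_real:
  assumes "insert \<mu> (\<theta> ` I) \<subseteq> S"
  shows "op_spectrum (diag (of_real \<mu>) (\<lambda>i. of_real (\<theta> i))) \<subseteq> complex_of_real ` S"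
proof -
  have "insert (of_real \<mu>) ((\<lambda>i. of_real (\<theta> i)) ` I) = complex_of_real ` insert \<mu> (\<theta> ` I)"
    by (simp add: image_image)
  also have "\<dots> \<subseteq> complex_of_real ` S" by (rule image_mono[OF assms])
  finally show ?thesis using op_spectrum_diag by (rule order_trans[rotated])
qed

lemma poly_op_diag:
  "poly_op q (diag (of_real \<mu>) (\<lambda>i. of_real (\<theta> i))) x =
      diag (of_real (poly q \<mu>)) (\<lambda>i. of_real (poly q (\<theta> i))) x"
proof (induction q arbitrary: x)
  case 0
  then show ?case using diag_const[of 0] by simp
next
  case (pCons a q)
  have "a *\<^sub>R x = diag (of_real a) (\<lambda>_. of_real a) x" by (simp add: diag_const scaleR_scaleC)
  then show ?case
    by (simp add: poly_op_pCons[OF bounded_clinear_diag] pCons.IH diag_diag diag_add)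
qed

text \<open>
  The spectrum is finite, so \<open>h\<close> may be replaced by an interpolating polynomial.
\<close>

lemma fun_calc_diag:
  "fun_calc h (diag (of_real \<mu>) (\<lambda>i. of_real (\<theta> i))) x =
      diag (of_real (h \<mu>)) (\<lambda>i. of_real (h (\<theta> i))) x"
proof -
  let ?D = "diag (of_real \<mu>) (\<lambda>i. of_real (\<theta> i))"
  define S where "S = insert \<mu> (\<theta> ` I)"
  have S: "finite S" using fin by (simp add: S_def)
  have specS: "op_spectrum ?D \<subseteq> complex_of_real ` S"
    by (rule op_spectrum_diag_of_real) (simp add: S_def)
  have "S \<subseteq> {Min S..Max S}" using S by auto
  then interpret spectrum_in_interval ?D "Min S" "Max S"
    using specS selfadjoint_diag by unfold_locales blast+
  obtain p where p: "\<forall>s\<in>S. poly p s = h s" using poly_interpolation[OF S] by blast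
  have "fun_calc h ?D = fun_calc (poly p) ?D"
  proof (rule fun_calc_cong)
    fix t assume "complex_of_real t \<in> op_spectrum ?D"
    then have "t \<in> S" using specS by auto
    then show "h t = poly p t" using p by simp
  qed
  then have "fun_calc h ?D x = diag (of_real (poly p \<mu>)) (\<lambda>i. of_real (poly p (\<theta> i))) x"
    by (simp add: fun_calc_poly poly_op_diag)
  also have "\<dots> = diag (of_real (h \<mu>)) (\<lambda>i. of_real (h (\<theta> i))) x"
    using p by (auto simp: S_def intro!: diag_cong)
  finally show ?thesis .
qed

end

lemma orthonormal_family_exists:
  assumes inf: "infinite_dimensional TYPE('h::complex_hilbert_space)" and "finite I"
  shows "\<exists>f :: 'i \<Rightarrow> 'h. orthonormal_family I f"
  using assms(2)
proof (induction I)
  case empty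
  then show ?case by (auto simp: orthonormal_family_def)
next
  case (insert k I)
  then obtain f :: "'i \<Rightarrow> 'h" where "orthonormal_family I f" by blast
  then interpret orthonormal_family I f .
  have inj: "inj_on f I"
  proof (rule inj_onI)
    fix i j assume "i \<in> I" "j \<in> I" "f i = f j"
    then show "i = j" using ortho[of i j] ortho[of i i] by (auto split: if_splits)
  qed
  have "\<not> (\<forall>x. \<exists>c. x = (\<Sum>b\<in>f ` I. c b *\<^sub>C b))"
    using inf fin unfolding infinite_dimensional_def by blast
  then obtain x where x: "\<And>c. x \<noteq> (\<Sum>b\<in>f ` I. c b *\<^sub>C b)" by blast
  define y where "y = x - comb (\<lambda>i. cinner x (f i))"
  have "y \<noteq> 0"
    using x[of "\<lambda>b. cinner x b"] by (simp add: y_def comb_def sum.reindex[OF inj])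
  define e where "e = complex_of_real (1 / norm y) *\<^sub>C y"
  have orth: "cinner e (f j) = 0" if "j \<in> I" for j
    using that by (simp add: e_def y_def cinner_scaleC_left cinner_diff_left cinner_comb_basis)
  then have orth': "cinner (f j) e = 0" if "j \<in> I" for j
    using that by (metis cinner_commute complex_cnj_zero)
  have "norm e = 1" using \<open>y \<noteq> 0\<close> by (simp add: e_def norm_scaleC norm_divide)
  then have unit: "cinner e e = 1" by (simp add: cinner_self)
  have "orthonormal_family (insert k I) (f(k := e))"
  proof
    show "finite (insert k I)" using insert.hyps by simp
    fix i j assume "i \<in> insert k I" "j \<in> insert k I"
    then show "cinner ((f(k := e)) i) ((f(k := e)) j) = (if i = j then 1 else 0)"
      using orth orth' unit ortho insert.hyps by auto
  qed
  then show ?case by blast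
qed


section \<open>Jensen's operator inequality\<close>

text \<open>
  Let \<open>N\<close> have eigenvalues \<open>\<theta> k\<close>, and let the rows of \<open>U\<close> be orthonormal vectors on whose span the
  compression of \<open>N\<close> is diagonal with entries \<open>\<sigma> j\<close>.  For \<open>\<eta> > 0\<close> and large \<open>\<Lambda>\<close>, the operator \<open>N\<close> lies below
  the one that is \<open>\<sigma> j + \<eta>\<close> on these vectors and \<open>\<Lambda>\<close> on their complement.  Apply \<open>H\<close>, evaluate at a vector
  of the span, where \<open>\<Lambda>\<close> disappears, and let \<open>\<eta>\<close> tend to \<open>0\<close>.
\<close>

lemma operator_jensen:
  fixes H :: "real \<Rightarrow> real" and U :: "'j \<Rightarrow> 'k \<Rightarrow> real"
  assumes inf: "infinite_dimensional TYPE('h::complex_hilbert_space)"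
    and mono: "operator_monotone_on TYPE('h) {0<..} H"
    and K: "finite K" "\<And>k. k \<in> K \<Longrightarrow> 0 < \<theta> k" and J: "finite J" "\<And>j. j \<in> J \<Longrightarrow> 0 < \<sigma> j"
    and U: "\<And>i j. i \<in> J \<Longrightarrow> j \<in> J \<Longrightarrow> (\<Sum>k\<in>K. U i k * U j k) = (if i = j then 1 else 0)"
    and compr: "\<And>i j. i \<in> J \<Longrightarrow> j \<in> J \<Longrightarrow> (\<Sum>k\<in>K. \<theta> k * U i k * U j k) = (if i = j then \<sigma> i else 0)"
  shows "(\<Sum>k\<in>K. H (\<theta> k) * (\<Sum>j\<in>J. a j * U j k)\<^sup>2) \<le> (\<Sum>j\<in>J. H (\<sigma> j) * (a j)\<^sup>2)"
proof -
  obtain f :: "'k \<Rightarrow> 'h" where "orthonormal_family K f"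
    using orthonormal_family_exists[OF inf K(1)] by blast
  then interpret F: orthonormal_family K f .
  define d where "d j = F.comb (\<lambda>k. of_real (U j k))" for j
  have dd: "cinner (d i) (d j) = (if i = j then 1 else 0)" if "i \<in> J" "j \<in> J" for i j
    unfolding d_def F.cinner_comb_comb using arg_cong[OF U[OF that], of complex_of_real] by simp
  interpret D: orthonormal_family J d
    by unfold_locales (use J dd in auto)
  let ?c = complex_of_real
  have cn: "z * cnj z = (?c (cmod z))\<^sup>2" for z using complex_norm_square[of z] by simp
  define N where "N = F.diag (?c 1) (\<lambda>k. ?c (\<theta> k))"
  have N: "selfadjoint N" unfolding N_def by (rule F.selfadjoint_diag)
  note Nlin = selfadjointD(1)[OF N]
  have specN: "op_spectrum N \<subseteq> ?c ` {0<..}"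
    unfolding N_def by (rule F.op_spectrum_diag_of_real) (use K(2) in auto)
  have Nd: "cinner (N (d i)) (d j) = (if i = j then ?c (\<sigma> i) else 0)" if "i \<in> J" "j \<in> J" for i j
    unfolding N_def d_def F.diag_comb F.cinner_comb_comb
    using arg_cong[OF compr[OF that], of complex_of_real] by simp
  define v where "v = D.comb (\<lambda>j. ?c (a j))"
  have v: "v = F.comb (\<lambda>k. ?c (\<Sum>j\<in>J. a j * U j k))"
    unfolding v_def D.comb_def d_def F.comb_def scaleC_sum_right scaleC_scaleC
    by (subst sum.swap) (simp add: scaleC_sum_left)
  have lhs: "inner (fun_calc H N v) v = (\<Sum>k\<in>K. H (\<theta> k) * (\<Sum>j\<in>J. a j * U j k)\<^sup>2)"
    unfolding N_def F.fun_calc_diag unfolding v F.diag_comb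
    by (simp add: inner_eq_Re_cinner F.cinner_comb_comb power2_eq_square mult.assoc)
  obtain C where C: "0 < C" "\<And>x. norm (N x) \<le> C * norm x"
    using bounded_clinear_bound[OF Nlin] by blast
  \<comment> \<open>On the span of the \<open>d j\<close>, raising the compression by \<open>\<eta>\<close> pays for the off-diagonal part of \<open>N\<close>.\<close>
  have main: "inner (fun_calc H N v) v \<le> (\<Sum>j\<in>J. H (\<sigma> j + \<eta>) * (a j)\<^sup>2)" if \<eta>: "0 < \<eta>" for \<eta>
  proof -
    \<comment> \<open>The term \<open>C\<^sup>2 / \<eta>\<close> absorbs the off-diagonal part of \<open>N\<close>, the term \<open>C\<close> its block on the complement.\<close>
    define \<Lambda> where "\<Lambda> = C\<^sup>2 / \<eta> + C"
    have \<Lambda>: "0 < \<Lambda>" unfolding \<Lambda>_def using C \<eta> by (simp add: add_nonneg_pos)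
    define P where "P = D.diag (?c \<Lambda>) (\<lambda>j. ?c (\<sigma> j + \<eta>))"
    have P: "selfadjoint P" unfolding P_def by (rule D.selfadjoint_diag)
    have specP: "op_spectrum P \<subseteq> ?c ` {0<..}"
      unfolding P_def
      by (rule D.op_spectrum_diag_of_real) (use J(2) \<Lambda> \<eta> in \<open>auto simp: add_pos_pos\<close>)
    have "inner (N x) x \<le> inner (P x) x" for x
    proof -
      define x' where "x' j = cinner x (d j)" for j
      define w where "w = D.comb x'"
      define z where "z = x - w"
      have x: "x = w + z" by (simp add: z_def)
      have zd: "cinner z (d j) = 0" if "j \<in> J" for j
        unfolding z_def w_def by (simp add: cinner_diff_left D.cinner_comb_basis[OF that] x'_def)
      then have zw: "cinner z (D.comb c) = 0" for c
        by (simp add: D.cinner_comb_right)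
      then have wz: "cinner (D.comb c) z = 0" for c
        by (metis cinner_commute complex_cnj_zero)
      have ww: "(norm w)\<^sup>2 = (\<Sum>j\<in>J. (cmod (x' j))\<^sup>2)"
      proof -
        have "cinner w w = ?c (\<Sum>j\<in>J. (cmod (x' j))\<^sup>2)"
          unfolding w_def D.cinner_comb_comb by (simp add: cn)
        then show ?thesis by (simp only: cinner_self of_real_eq_iff)
      qed
      have Nw: "inner (N w) w = (\<Sum>j\<in>J. \<sigma> j * (cmod (x' j))\<^sup>2)"
      proof -
        have "N w = (\<Sum>i\<in>J. x' i *\<^sub>C N (d i))"
          unfolding w_def D.comb_def
          by (simp add: linear_sum[OF bounded_linear.linear[OF bounded_clinearD(1)[OF Nlin]]]
              bounded_clinearD(2)[OF Nlin])
        then have "cinner (N w) w = (\<Sum>j\<in>J. \<Sum>i\<in>J. cnj (x' j) * (x' i * cinner (N (d i)) (d j)))"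
          by (simp add: w_def D.cinner_comb_right cinner_sum_left cinner_scaleC_left sum_distrib_left)
        also have "\<dots> = (\<Sum>j\<in>J. \<Sum>i\<in>J. if i = j then ?c (\<sigma> j) * (x' j * cnj (x' j)) else 0)"
          by (intro sum.cong refl) (simp add: Nd)
        also have "\<dots> = ?c (\<Sum>j\<in>J. \<sigma> j * (cmod (x' j))\<^sup>2)"
          using J(1) by (simp add: cn)
        finally show ?thesis by (simp add: inner_eq_Re_cinner)
      qed
      have Px: "inner (P x) x = \<Lambda> * (norm z)\<^sup>2 + (\<Sum>j\<in>J. (\<sigma> j + \<eta>) * (cmod (x' j))\<^sup>2)"
      proof -
        have "P x = ?c \<Lambda> *\<^sub>C z + P w"
        proof -
          have "P z = ?c \<Lambda> *\<^sub>C z"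
            unfolding P_def D.diag_def D.comb_def using zd by simp
          then show ?thesis
            unfolding x using bounded_clinearD(3)[OF selfadjointD(1)[OF P]] by (simp add: add.commute)
        qed
        also have "P w = D.comb (\<lambda>j. ?c (\<sigma> j + \<eta>) * x' j)" unfolding P_def w_def D.diag_comb ..
        finally have "cinner (P x) x = ?c \<Lambda> * cinner z z
            + cinner (D.comb (\<lambda>j. ?c (\<sigma> j + \<eta>) * x' j)) w"
          unfolding x w_def using zw wz
          by (simp add: cinner_add_left cinner_add_right cinner_scaleC_left)
        also have "\<dots> = ?c (\<Lambda> * (norm z)\<^sup>2 + (\<Sum>j\<in>J. (\<sigma> j + \<eta>) * (cmod (x' j))\<^sup>2))"
          unfolding w_def D.cinner_comb_comb cinner_self
          by (simp add: cn mult.assoc)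
        finally show ?thesis by (simp add: inner_eq_Re_cinner)
      qed
      have cross: "2 * inner (N w) z \<le> \<eta> * (norm w)\<^sup>2 + C\<^sup>2 / \<eta> * (norm z)\<^sup>2"
      proof -
        have "inner (N w) z \<le> norm (N w) * norm z" by (rule norm_cauchy_schwarz)
        also have "\<dots> \<le> C * norm w * norm z" by (intro mult_right_mono C(2)) simp
        finally have 1: "2 * inner (N w) z \<le> 2 * (C * norm w * norm z)" by simp
        have "0 \<le> (\<eta> * norm w - C * norm z)\<^sup>2 / \<eta>" using \<eta> by simp
        also have "\<dots> = \<eta> * (norm w)\<^sup>2 + C\<^sup>2 / \<eta> * (norm z)\<^sup>2 - 2 * (C * norm w * norm z)"
          using \<eta> by (simp add: power2_eq_square field_simps)
        finally show ?thesis using 1 by linarith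
      qed
      have Nz: "inner (N z) z \<le> C * (norm z)\<^sup>2"
      proof -
        have "inner (N z) z \<le> norm (N z) * norm z" by (rule norm_cauchy_schwarz)
        also have "\<dots> \<le> C * norm z * norm z" by (intro mult_right_mono C(2)) simp
        finally show ?thesis by (simp add: power2_eq_square)
      qed
      have "inner (N x) x = inner (N w) w + 2 * inner (N w) z + inner (N z) z"
        unfolding x using selfadjointD(3)[OF N, of z w]
        by (simp add: bounded_clinearD[OF Nlin] inner_add_left inner_add_right inner_commute)
      also have "\<dots> \<le> (\<Sum>j\<in>J. \<sigma> j * (cmod (x' j))\<^sup>2) + (\<eta> * (norm w)\<^sup>2 + C\<^sup>2 / \<eta> * (norm z)\<^sup>2)
          + C * (norm z)\<^sup>2"
        using Nw cross Nz by linarith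
      also have "\<dots> = inner (P x) x"
        unfolding Px ww \<Lambda>_def by (simp add: algebra_simps sum.distrib sum_distrib_left)
      finally show ?thesis .
    qed
    then have "op_le N P" using op_le_iff[OF N P] by blast
    then have "op_le (fun_calc H N) (fun_calc H P)"
      using mono N P specN specP unfolding operator_monotone_on_def by blast
    moreover have "selfadjoint (fun_calc H N)" "selfadjoint (fun_calc H P)"
      unfolding N_def P_def F.fun_calc_diag[abs_def] D.fun_calc_diag[abs_def]
      by (rule F.selfadjoint_diag D.selfadjoint_diag)+
    ultimately have "inner (fun_calc H N v) v \<le> inner (fun_calc H P v) v"
      using op_le_iff by blast
    also have "\<dots> = (\<Sum>j\<in>J. H (\<sigma> j + \<eta>) * (a j)\<^sup>2)"
      unfolding P_def D.fun_calc_diag unfolding v_def D.diag_comb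
      by (simp add: inner_eq_Re_cinner D.cinner_comb_comb power2_eq_square mult.assoc)
    finally show ?thesis .
  qed
  have cont: "continuous_on {0<..} H" using mono unfolding operator_monotone_on_def by blast
  have "(\<lambda>n. \<Sum>j\<in>J. H (\<sigma> j + 1 / real (Suc n)) * (a j)\<^sup>2) \<longlonglongrightarrow> (\<Sum>j\<in>J. H (\<sigma> j) * (a j)\<^sup>2)"
  proof (intro tendsto_sum tendsto_mult tendsto_const)
    fix j assume j: "j \<in> J"
    have "isCont H (\<sigma> j)" using cont J(2)[OF j] by (simp add: continuous_on_eq_continuous_at)
    moreover have "(\<lambda>n. \<sigma> j + 1 / real (Suc n)) \<longlonglongrightarrow> \<sigma> j + 0"
      by (intro tendsto_add tendsto_const LIMSEQ_Suc[OF lim_1_over_n])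
    ultimately show "(\<lambda>n. H (\<sigma> j + 1 / real (Suc n))) \<longlonglongrightarrow> H (\<sigma> j)"
      using isCont_tendsto_compose by fastforce
  qed
  then show ?thesis unfolding lhs[symmetric]
    by (rule LIMSEQ_le_const) (use main in auto)
qed


section \<open>Divided differences of operator monotone functions\<close>

text \<open>
  The derivative at the node \<open>z\<close> of the monic polynomial with simple roots \<open>Z\<close>; its reciprocals are the
  coefficients of the divided difference at \<open>Z\<close>.
\<close>

definition node_prod :: "real set \<Rightarrow> real \<Rightarrow> real" where
  "node_prod Z z = (\<Prod>k\<in>Z-{z}. z - k)"

lemma node_prod_nonzero: "finite Z \<Longrightarrow> node_prod Z z \<noteq> 0"
  by (auto simp: node_prod_def prod_zero_iff)

lemma node_prod_insert:
  assumes "finite Z" "e \<notin> Z"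
  shows "node_prod (insert e Z) e = (\<Prod>k\<in>Z. e - k)"
    and "z \<in> Z \<Longrightarrow> node_prod (insert e Z) z = node_prod Z z * (z - e)"
proof -
  have "insert e Z - {e} = Z" using assms by auto
  then show "node_prod (insert e Z) e = (\<Prod>k\<in>Z. e - k)" by (simp add: node_prod_def)
  assume "z \<in> Z"
  then have "insert e Z - {z} = insert e (Z - {z})" using assms by auto
  then show "node_prod (insert e Z) z = node_prod Z z * (z - e)"
    using assms by (simp add: node_prod_def)
qed

lemma lagrange_quotient:
  fixes q :: "real poly"
  assumes S: "finite S" "degree q < card S" "z \<notin> S"
  shows "(\<Sum>s\<in>S. poly q s / (node_prod S s * (z - s))) = poly q z / (\<Prod>k\<in>S. z - k)"
proof -
  have nz: "(\<Prod>k\<in>S. z - k) \<noteq> 0" using S by (auto simp: prod_zero_iff)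
  have "poly q z = (\<Sum>s\<in>S. poly q s / node_prod S s * (\<Prod>k\<in>S-{s}. z - k))"
    unfolding node_prod_def by (rule lagrange_interpolation[OF S(1,2)])
  also have "\<dots> = (\<Sum>s\<in>S. poly q s / (node_prod S s * (z - s)) * (\<Prod>k\<in>S. z - k))"
  proof (intro sum.cong refl)
    fix s assume s: "s \<in> S"
    then have "z - s \<noteq> 0" using S(3) by auto
    then show "poly q s / node_prod S s * (\<Prod>k\<in>S-{s}. z - k) =
        poly q s / (node_prod S s * (z - s)) * (\<Prod>k\<in>S. z - k)"
      by (subst prod.remove[OF S(1) s, of "\<lambda>k. z - k"]) simp
  qed
  also have "\<dots> = (\<Sum>s\<in>S. poly q s / (node_prod S s * (z - s))) * (\<Prod>k\<in>S. z - k)"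
    by (rule sum_distrib_right[symmetric])
  finally have eq: "poly q z = (\<Sum>s\<in>S. poly q s / (node_prod S s * (z - s))) * (\<Prod>k\<in>S. z - k)" .
  show ?thesis unfolding eq by (rule nonzero_mult_div_cancel_right[OF nz, symmetric])
qed

text \<open>
  The signs alternate along the nodes, starting with a positive sign at the largest one.
\<close>

lemma card_node_prod_sign:
  assumes "finite Z"
  shows "card {z\<in>Z. 0 < node_prod Z z} = (card Z + 1) div 2 \<and>
         card {z\<in>Z. node_prod Z z < 0} = card Z div 2"
  using assms
proof (induction Z rule: finite_linorder_max_induct)
  case (insert e Z)
  have e: "e \<notin> Z" using insert.hyps by auto
  have top: "0 < node_prod (insert e Z) e"
    unfolding node_prod_insert(1)[OF insert.hyps(1) e]
    by (rule prod_pos) (use insert.hyps in auto)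
  have sgn: "0 < node_prod (insert e Z) z \<longleftrightarrow> node_prod Z z < 0"
    "node_prod (insert e Z) z < 0 \<longleftrightarrow> 0 < node_prod Z z" if "z \<in> Z" for z
    using insert.hyps(2) that
    unfolding node_prod_insert(2)[OF insert.hyps(1) e that]
    by (auto simp: zero_less_mult_iff mult_less_0_iff)
  have "{z \<in> insert e Z. 0 < node_prod (insert e Z) z} = insert e {z\<in>Z. node_prod Z z < 0}"
    "{z \<in> insert e Z. node_prod (insert e Z) z < 0} = {z\<in>Z. 0 < node_prod Z z}"
    using top sgn e by auto
  then show ?case using insert e by simp
qed simp

text \<open>
  The nodes split into interlacing sets \<open>T\<close> and \<open>S\<close> according to the sign of their coefficient, with one
  more node in \<open>T\<close>.  The Cauchy matrix with entries \<open>1 / (t - s)\<close>, after scaling of its rows and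
  columns, has orthonormal rows that compress the diagonal matrix \<open>T\<close> to the diagonal matrix \<open>S\<close>.  The scaling
  factors are the residues \<open>\<alpha>\<close> of \<open>p / m\<close> and the squared norms \<open>\<beta>\<close> of the rows, where \<open>p\<close> and \<open>m\<close> are the monic polynomials
  with roots \<open>S\<close> and \<open>T\<close>; interlacing makes \<open>\<alpha>\<close> positive.  Jensen's inequality at the vector whose
  coordinates come from the values of \<open>q\<close> on \<open>S\<close> is the claim.
\<close>

lemma divided_difference_nonpos:
  fixes H :: "real \<Rightarrow> real" and q :: "real poly"
  assumes inf: "infinite_dimensional TYPE('h::complex_hilbert_space)"
    and mono: "operator_monotone_on TYPE('h) {0<..} H"
    and Z: "finite Z" "Z \<subseteq> {0<..}" "odd (card Z)" and q: "degree q < card Z div 2"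
  shows "(\<Sum>z\<in>Z. H z * (poly q z)\<^sup>2 / node_prod Z z) \<le> 0"
proof -
  define T where "T = {z\<in>Z. 0 < node_prod Z z}"
  define S where "S = {z\<in>Z. node_prod Z z < 0}"
  have cards: "card T = Suc (card S)" "degree q < card S"
    using card_node_prod_sign[OF Z(1)] Z(3) q unfolding T_def S_def by (auto elim!: oddE)
  have fin: "finite T" "finite S" using Z(1) by (auto simp: T_def S_def)
  have disj: "T \<inter> S = {}" by (auto simp: T_def S_def)
  have ZTS: "Z = T \<union> S" using node_prod_nonzero[OF Z(1)] by (auto simp: T_def S_def neq_iff)
  define p where "p z = (\<Prod>s\<in>S. z - s)" for z
  define m where "m z = (\<Prod>t\<in>T. z - t)" for z
  have npT: "node_prod Z t = p t * node_prod T t" if t: "t \<in> T" for t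
  proof -
    have "Z - {t} = S \<union> (T - {t})" "S \<inter> (T - {t}) = {}" using t disj ZTS by auto
    then show ?thesis unfolding node_prod_def p_def using fin by (simp add: prod.union_disjoint)
  qed
  have npS: "node_prod Z s = m s * node_prod S s" if s: "s \<in> S" for s
  proof -
    have "Z - {s} = T \<union> (S - {s})" "T \<inter> (S - {s}) = {}" using s disj ZTS by auto
    then show ?thesis unfolding node_prod_def m_def using fin by (simp add: prod.union_disjoint)
  qed
  have ts: "t - s \<noteq> 0" if "t \<in> T" "s \<in> S" for t s using that disj by auto
  have ts': "t \<notin> S" if "t \<in> T" for t using that disj by auto
  have st': "s \<notin> T" if "s \<in> S" for s using that disj by auto
  have pm: "p t \<noteq> 0" if "t \<in> T" for t using ts'[OF that] fin by (auto simp: p_def prod_zero_iff)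
  have mn: "m s \<noteq> 0" if "s \<in> S" for s using st'[OF that] fin by (auto simp: m_def prod_zero_iff)
  define \<alpha> where "\<alpha> t = p t / node_prod T t" for t
  have \<alpha>: "0 < \<alpha> t" if t: "t \<in> T" for t
  proof -
    have "0 < p t * node_prod T t" using t npT[OF t] unfolding T_def by auto
    then show ?thesis unfolding \<alpha>_def by (simp add: zero_less_divide_iff zero_less_mult_iff)
  qed
  \<comment> \<open>Partial fractions of \<open>p / m\<close> at its zeros \<open>s\<close>: up to sign, the value and the derivative.\<close>
  have zero: "(\<Sum>t\<in>T. \<alpha> t / (t - s)) = 0" if s: "s \<in> S" for s
  proof -
    define P where "P = (\<Prod>s\<in>S. [:- s, 1:])"
    have P: "poly P z = p z" for z by (simp add: P_def p_def poly_prod)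
    have "degree P \<le> card S"
      using degree_prod_sum_le[of S "\<lambda>s. [:- s, 1:]"] fin by (simp add: P_def o_def)
    then have "(\<Sum>t\<in>T. poly P t / (node_prod T t * (s - t))) = poly P s / m s"
      unfolding m_def using cards st'[OF s] by (intro lagrange_quotient fin) auto
    moreover have "p s = 0" using s fin by (auto simp: p_def prod_zero_iff)
    moreover have "poly P t / (node_prod T t * (s - t)) = - (\<alpha> t / (t - s))" if "t \<in> T" for t
    proof -
      have "node_prod T t * (s - t) = - (node_prod T t * (t - s))" by (simp add: algebra_simps)
      then show ?thesis unfolding P \<alpha>_def by (simp only: divide_minus_right divide_divide_eq_left)
    qed
    ultimately have "(\<Sum>t\<in>T. - (\<alpha> t / (t - s))) = 0" unfolding P by simp
    then show ?thesis by (simp add: sum_negf)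
  qed
  define \<beta> where "\<beta> s = (\<Sum>t\<in>T. \<alpha> t / (t - s)\<^sup>2)" for s
  have \<beta>_eq: "\<beta> s = - node_prod S s / m s" if s: "s \<in> S" for s
  proof -
    define P where "P = (\<Prod>k\<in>S-{s}. [:- k, 1:])"
    have P: "poly P z = (\<Prod>k\<in>S-{s}. z - k)" for z by (simp add: P_def poly_prod)
    have "degree P \<le> card S - 1"
      using degree_prod_sum_le[of "S - {s}" "\<lambda>s. [:- s, 1:]"] fin s by (simp add: P_def o_def)
    then have "(\<Sum>t\<in>T. poly P t / (node_prod T t * (s - t))) = poly P s / m s"
      unfolding m_def using cards st'[OF s] by (intro lagrange_quotient fin) auto
    also have "poly P s = node_prod S s" by (simp add: P node_prod_def)
    also have "(\<Sum>t\<in>T. poly P t / (node_prod T t * (s - t))) = (\<Sum>t\<in>T. - (\<alpha> t / (t - s)\<^sup>2))"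
    proof (intro sum.cong refl)
      fix t assume t: "t \<in> T"
      have "p t = (t - s) * poly P t" unfolding P p_def using fin(2) s by (rule prod.remove)
      then show "poly P t / (node_prod T t * (s - t)) = - (\<alpha> t / (t - s)\<^sup>2)"
        using ts[OF t s] node_prod_nonzero[OF fin(1), of t]
        by (simp add: \<alpha>_def power2_eq_square divide_simps) (simp add: algebra_simps)
    qed
    finally show ?thesis by (simp add: \<beta>_def sum_negf)
  qed
  have "T \<noteq> {}" using cards by auto
  then have \<beta>: "0 < \<beta> s" if "s \<in> S" for s
    unfolding \<beta>_def using \<alpha> ts that fin by (intro sum_pos divide_pos_pos) auto
  have off: "(\<Sum>t\<in>T. \<alpha> t / ((t - s) * (t - s'))) = (if s = s' then \<beta> s else 0)"
    if s: "s \<in> S" "s' \<in> S" for s s'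
  proof (cases "s = s'")
    case False
    have "(s - s') * (\<Sum>t\<in>T. \<alpha> t / ((t - s) * (t - s'))) = (\<Sum>t\<in>T. \<alpha> t / (t - s) - \<alpha> t / (t - s'))"
      unfolding sum_distrib_left
    proof (intro sum.cong refl)
      fix t assume t: "t \<in> T"
      show "(s - s') * (\<alpha> t / ((t - s) * (t - s'))) = \<alpha> t / (t - s) - \<alpha> t / (t - s')"
        using ts[OF t s(1)] ts[OF t s(2)] by (simp add: field_simps)
    qed
    also have "\<dots> = 0" by (simp add: sum_subtractf zero s)
    finally show ?thesis using False by simp
  qed (simp add: \<beta>_def power2_eq_square)
  define U where "U s t = sqrt (\<alpha> t) / ((t - s) * sqrt (\<beta> s))" for s t
  have UU: "U s t * U s' t = \<alpha> t / ((t - s) * (t - s')) / (sqrt (\<beta> s) * sqrt (\<beta> s'))"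
    if "t \<in> T" for s s' t
    using \<alpha>[OF that] by (simp add: U_def)
  \<comment> \<open>By Lagrange interpolation on \<open>S\<close>, these coefficients produce the coordinates \<open>sqrt (\<alpha> t) * poly q t / p t\<close>.\<close>
  have "(\<Sum>t\<in>T. H t * (\<Sum>s\<in>S. (poly q s / node_prod S s * sqrt (\<beta> s)) * U s t)\<^sup>2)
      \<le> (\<Sum>s\<in>S. H s * (poly q s / node_prod S s * sqrt (\<beta> s))\<^sup>2)"
  proof (rule operator_jensen[OF inf mono fin(1) _ fin(2)])
    show "0 < t" if "t \<in> T" for t using that ZTS Z(2) by auto
    show "0 < s" if "s \<in> S" for s using that ZTS Z(2) by auto
    fix s s' assume s: "s \<in> S" "s' \<in> S"
    have "(\<Sum>t\<in>T. U s t * U s' t) =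
        (\<Sum>t\<in>T. \<alpha> t / ((t - s) * (t - s'))) / (sqrt (\<beta> s) * sqrt (\<beta> s'))"
      unfolding sum_divide_distrib by (intro sum.cong refl) (rule UU)
    then show "(\<Sum>t\<in>T. U s t * U s' t) = (if s = s' then 1 else 0)"
      using off[OF s] \<beta>[OF s(1)] \<beta>[OF s(2)] by simp
    have "(\<Sum>t\<in>T. t * U s t * U s' t) =
        (\<Sum>t\<in>T. \<alpha> t / (t - s') + s * (\<alpha> t / ((t - s) * (t - s')))) / (sqrt (\<beta> s) * sqrt (\<beta> s'))"
      unfolding sum_divide_distrib
    proof (intro sum.cong refl)
      fix t assume t: "t \<in> T"
      have "\<alpha> t / (t - s') = (t - s) * (\<alpha> t / ((t - s) * (t - s')))"
        using ts[OF t s(1)] by simp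
      then have "t * (\<alpha> t / ((t - s) * (t - s'))) = \<alpha> t / (t - s') + s * (\<alpha> t / ((t - s) * (t - s')))"
        by (simp only: left_diff_distrib diff_add_cancel)
      then show "t * U s t * U s' t = (\<alpha> t / (t - s') + s * (\<alpha> t / ((t - s) * (t - s'))))
          / (sqrt (\<beta> s) * sqrt (\<beta> s'))"
        unfolding mult.assoc UU[OF t] by (simp only: times_divide_eq_right)
    qed
    also have "(\<Sum>t\<in>T. \<alpha> t / (t - s') + s * (\<alpha> t / ((t - s) * (t - s')))) =
        s * (if s = s' then \<beta> s else 0)"
      unfolding sum.distrib sum_distrib_left[symmetric] zero[OF s(2)] off[OF s] by simp
    finally show "(\<Sum>t\<in>T. t * U s t * U s' t) = (if s = s' then s else 0)"
      using \<beta>[OF s(1)] \<beta>[OF s(2)] by simp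
  qed
  also have "(\<Sum>t\<in>T. H t * (\<Sum>s\<in>S. (poly q s / node_prod S s * sqrt (\<beta> s)) * U s t)\<^sup>2) =
      (\<Sum>t\<in>T. H t * (poly q t)\<^sup>2 / node_prod Z t)"
  proof (intro sum.cong refl)
    fix t assume t: "t \<in> T"
    have "(\<Sum>s\<in>S. (poly q s / node_prod S s * sqrt (\<beta> s)) * U s t) =
        sqrt (\<alpha> t) * (\<Sum>s\<in>S. poly q s / (node_prod S s * (t - s)))"
      unfolding sum_distrib_left
      by (intro sum.cong refl) (use \<beta> in \<open>force simp: U_def\<close>)
    also have "(\<Sum>s\<in>S. poly q s / (node_prod S s * (t - s))) = poly q t / p t"
      unfolding p_def by (rule lagrange_quotient[OF fin(2) cards(2) ts'[OF t]])
    finally have "(\<Sum>s\<in>S. (poly q s / node_prod S s * sqrt (\<beta> s)) * U s t)\<^sup>2 =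
        \<alpha> t * ((poly q t)\<^sup>2 / (p t)\<^sup>2)"
      using \<alpha>[OF t] by (simp add: power_mult_distrib power_divide)
    also have "\<dots> = (poly q t)\<^sup>2 / node_prod Z t"
      unfolding npT[OF t] \<alpha>_def using pm[OF t] by (simp add: power2_eq_square)
    finally show "H t * (\<Sum>s\<in>S. (poly q s / node_prod S s * sqrt (\<beta> s)) * U s t)\<^sup>2 =
        H t * (poly q t)\<^sup>2 / node_prod Z t" by simp
  qed
  also have "(\<Sum>s\<in>S. H s * (poly q s / node_prod S s * sqrt (\<beta> s))\<^sup>2) =
      (\<Sum>s\<in>S. - (H s * (poly q s)\<^sup>2 / node_prod Z s))"
  proof (intro sum.cong refl)
    fix s assume s: "s \<in> S"
    have "(poly q s / node_prod S s * sqrt (\<beta> s))\<^sup>2 = (poly q s)\<^sup>2 / (node_prod S s)\<^sup>2 * \<beta> s"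
      using \<beta>[OF s] by (simp add: power_mult_distrib power_divide)
    also have "\<dots> = - ((poly q s)\<^sup>2 / node_prod Z s)"
      unfolding \<beta>_eq[OF s] npS[OF s]
      using node_prod_nonzero[OF fin(2), of s] mn[OF s] by (simp add: power2_eq_square)
    finally show "H s * (poly q s / node_prod S s * sqrt (\<beta> s))\<^sup>2 =
        - (H s * (poly q s)\<^sup>2 / node_prod Z s)" by simp
  qed
  finally show ?thesis
    unfolding ZTS using fin disj by (simp add: sum.union_disjoint sum_negf)
qed


section \<open>Operator monotone functions give Kwong kernels\<close>

lemma even_odd_parts:
  fixes Q :: "real poly"
  assumes "degree Q < 2 * n"
  obtains E D :: "real poly" where "degree E < n" "degree D < n"
    "\<And>x. poly Q x = poly E (x\<^sup>2) + x * poly D (x\<^sup>2)"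
proof
  have n: "0 < n" using assms by simp
  have deg: "degree (\<Sum>i<n. monom (c i) i) < n" for c :: "nat \<Rightarrow> real"
  proof -
    have "degree (\<Sum>i<n. monom (c i) i) \<le> n - 1"
      by (rule degree_sum_le) (auto intro: order_trans[OF degree_monom_le])
    then show ?thesis using n by simp
  qed
  show "degree (\<Sum>i<n. monom (coeff Q (2 * i)) i) < n"
    "degree (\<Sum>i<n. monom (coeff Q (2 * i + 1)) i) < n" by (rule deg)+
  fix x
  have split: "(\<Sum>i<2 * m. g i) = (\<Sum>i<m. g (2 * i)) + (\<Sum>i<m. g (2 * i + 1))" for g :: "nat \<Rightarrow> real" and m
    by (induction m) simp_all
  have "poly Q x = (\<Sum>i<2 * n. coeff Q i * x ^ i)"
    unfolding poly_altdef
    by (rule sum.mono_neutral_left) (use assms in \<open>auto simp: coeff_eq_0\<close>)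
  also have "\<dots> = (\<Sum>i<n. coeff Q (2 * i) * (x\<^sup>2) ^ i) + x * (\<Sum>i<n. coeff Q (2 * i + 1) * (x\<^sup>2) ^ i)"
    unfolding split sum_distrib_left
    by (intro arg_cong2[of _ _ _ _ "(+)"] sum.cong refl)
      (simp_all add: power_mult[symmetric] mult_ac)
  finally show "poly Q x = poly (\<Sum>i<n. monom (coeff Q (2 * i)) i) (x\<^sup>2)
      + x * poly (\<Sum>i<n. monom (coeff Q (2 * i + 1)) i) (x\<^sup>2)"
    by (simp add: poly_sum poly_monom)
qed

text \<open>
  The term of the extra node \<open>e\<close> is non-negative and can be dropped.
\<close>

lemma extra_node_nonpos:
  fixes H :: "real \<Rightarrow> real" and q :: "real poly"
  assumes inf: "infinite_dimensional TYPE('h::complex_hilbert_space)"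
    and mono: "operator_monotone_on TYPE('h) {0<..} H" and H: "\<And>x. 0 < x \<Longrightarrow> 0 \<le> H x"
    and S: "finite S" "S \<subseteq> {0<..}" "even (card S)" and q: "degree q < card S div 2"
    and e: "0 < e" "e \<notin> S" "0 < (\<Prod>k\<in>S. e - k)"
  shows "(\<Sum>s\<in>S. H s * (poly q s)\<^sup>2 / (node_prod S s * (s - e))) \<le> 0"
proof -
  have "(\<Sum>z\<in>insert e S. H z * (poly q z)\<^sup>2 / node_prod (insert e S) z) \<le> 0"
    by (rule divided_difference_nonpos[OF inf mono]) (use S q e in auto)
  moreover have "0 \<le> H e * (poly q e)\<^sup>2 / node_prod (insert e S) e"
    unfolding node_prod_insert(1)[OF S(1) e(2)] using H e by simp
  moreover have "(\<Sum>z\<in>S. H z * (poly q z)\<^sup>2 / node_prod (insert e S) z) =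
      (\<Sum>s\<in>S. H s * (poly q s)\<^sup>2 / (node_prod S s * (s - e)))"
    by (intro sum.cong refl) (simp add: node_prod_insert(2)[OF S(1) e(2)])
  ultimately show ?thesis using S(1) e(2) by simp
qed

text \<open>
  The extra node moves to \<open>0\<close> in the first inequality.  In the second it moves to infinity as \<open>1 / e\<close>,
  after multiplication by \<open>- 1 / e\<close>.
\<close>

lemma divided_difference_limits:
  fixes H :: "real \<Rightarrow> real"
  assumes inf: "infinite_dimensional TYPE('h::complex_hilbert_space)"
    and mono: "operator_monotone_on TYPE('h) {0<..} H" and H: "\<And>x. 0 < x \<Longrightarrow> 0 \<le> H x"
    and S: "finite S" "S \<subseteq> {0<..}" "even (card S)" and q: "degree q < card S div 2"
  shows "(\<Sum>s\<in>S. H s * (poly q s)\<^sup>2 / (node_prod S s * s)) \<le> 0"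
    and "0 \<le> (\<Sum>s\<in>S. H s * (poly q s)\<^sup>2 / node_prod S s)"
proof -
  have S0: "S \<noteq> {}" using q by auto
  have pos: "0 < s" if "s \<in> S" for s using S that by auto
  note extra = extra_node_nonpos[OF inf mono H S q]
  define l where "l = Min S"
  have l: "0 < l" "\<And>s. s \<in> S \<Longrightarrow> l \<le> s" using S S0 pos by (auto simp: l_def)
  have ev: "\<forall>\<^sub>F e in at_right 0. (\<Sum>s\<in>S. H s * (poly q s)\<^sup>2 / (node_prod S s * (s - e))) \<le> 0"
    using eventually_at_right_real[OF l(1)]
  proof eventually_elim
    case (elim e)
    have "(\<Prod>k\<in>S. e - k) = (\<Prod>k\<in>S. k - e)"
      using prod.distrib[of "\<lambda>_. - 1" "\<lambda>k. k - e" S] S(3) by simp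
    also have "\<dots> > 0" using elim l by (intro prod_pos) force
    finally show ?case using elim l by (intro extra) force+
  qed
  have "((\<lambda>e. \<Sum>s\<in>S. H s * (poly q s)\<^sup>2 / (node_prod S s * (s - e))) \<longlongrightarrow>
      (\<Sum>s\<in>S. H s * (poly q s)\<^sup>2 / (node_prod S s * (s - 0)))) (at_right 0)"
    by (intro tendsto_intros) (use node_prod_nonzero[OF S(1)] pos in force)
  from tendsto_upperbound[OF this ev]
  show "(\<Sum>s\<in>S. H s * (poly q s)\<^sup>2 / (node_prod S s * s)) \<le> 0" by simp
  define u where "u = Max S"
  have u: "0 < u" "\<And>s. s \<in> S \<Longrightarrow> s \<le> u" using S S0 pos by (auto simp: u_def)
  have "0 < 1 / u" using u by simp
  from eventually_at_right_real[OF this]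
  have ev: "\<forall>\<^sub>F e in at_right 0. 0 \<le> (\<Sum>s\<in>S. H s * (poly q s)\<^sup>2 / (node_prod S s * (1 - s * e)))"
  proof eventually_elim
    case (elim e)
    have e: "0 < e" "u < 1 / e" using elim u by (auto simp: field_simps)
    have "0 < (\<Prod>k\<in>S. 1 / e - k)" using e u by (intro prod_pos) force
    then have "(\<Sum>s\<in>S. H s * (poly q s)\<^sup>2 / (node_prod S s * (s - 1 / e))) \<le> 0"
      using e u by (intro extra) force+
    then have "0 \<le> (- 1 / e) * (\<Sum>s\<in>S. H s * (poly q s)\<^sup>2 / (node_prod S s * (s - 1 / e)))"
      using e by (intro mult_nonpos_nonpos) auto
    also have "\<dots> = (\<Sum>s\<in>S. H s * (poly q s)\<^sup>2 / (node_prod S s * (1 - s * e)))"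
      unfolding sum_distrib_left
    proof (intro sum.cong refl)
      fix s assume "s \<in> S"
      then have "s < 1 / e" using u e by force
      have "node_prod S s * (1 - s * e) = - e * (node_prod S s * (s - 1 / e))"
        using e by (simp add: algebra_simps)
      then show "(- 1 / e) * (H s * (poly q s)\<^sup>2 / (node_prod S s * (s - 1 / e))) =
          H s * (poly q s)\<^sup>2 / (node_prod S s * (1 - s * e))" by simp
    qed
    finally show ?case .
  qed
  have "((\<lambda>e. \<Sum>s\<in>S. H s * (poly q s)\<^sup>2 / (node_prod S s * (1 - s * e))) \<longlongrightarrow>
      (\<Sum>s\<in>S. H s * (poly q s)\<^sup>2 / (node_prod S s * (1 - s * 0)))) (at_right 0)"
    by (intro tendsto_intros) (use node_prod_nonzero[OF S(1)] in force)
  from tendsto_lowerbound[OF this ev]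
  show "0 \<le> (\<Sum>s\<in>S. H s * (poly q s)\<^sup>2 / node_prod S s)" by simp
qed

text \<open>
  Up to factors that depend only on the points, the weights of the Kwong form are
  \<open>Q x * Q (- x) = (E s)\<^sup>2 - s * (D s)\<^sup>2\<close> with \<open>s = x\<^sup>2\<close>, where
  \<open>E\<close> and \<open>D\<close> are the even and odd parts of \<open>Q\<close>.  The two squares are handled by the two limiting
  divided differences.  These require an even number of points, which a point of weight zero
  achieves.
\<close>

lemma kwong_kernel_of_operator_monotone:
  fixes H :: "real \<Rightarrow> real"
  assumes inf: "infinite_dimensional TYPE('h::complex_hilbert_space)"
    and mono: "operator_monotone_on TYPE('h) {0<..} H" and H: "\<And>x. 0 < x \<Longrightarrow> 0 \<le> H x"
  shows "kwong_kernel (\<lambda>y. H (y\<^sup>2) / y)"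
proof -
  let ?F = "\<lambda>y. H (y\<^sup>2) / y"
  have even_case: "0 \<le> kwong_form ?F c X"
    if X: "finite X" "X \<subseteq> {0<..}" "even (card X)" for X c
  proof (cases "X = {}")
    case False
    have pos: "0 < x" if "x \<in> X" for x using X that by auto
    define n where "n = card X div 2"
    have card: "card X = 2 * n" using X(3) by (simp add: n_def)
    define Q where "Q = (\<Sum>x\<in>X. smult (c x) (\<Prod>k\<in>X-{x}. [:k, 1:]))"
    have Q: "poly Q z = (\<Sum>x\<in>X. c x * (\<Prod>k\<in>X-{x}. z + k))" for z
      by (simp add: Q_def poly_sum poly_prod add.commute)
    have "degree Q < card X" unfolding Q_def using X(1) False by (rule degree_sum_smult_prod_less)
    then obtain E D where ED: "degree E < n" "degree D < n"
      "\<And>x. poly Q x = poly E (x\<^sup>2) + x * poly D (x\<^sup>2)"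
      using even_odd_parts[of Q n] card by auto
    define S where "S = (\<lambda>x. x\<^sup>2) ` X"
    have inj: "inj_on (\<lambda>x. x\<^sup>2) X"
      by (rule inj_onI) (metis pos less_imp_le power2_eq_iff_nonneg)
    have S: "finite S" "S \<subseteq> {0<..}" "even (card S)" "card S div 2 = n"
      using X pos by (auto simp: S_def card_image[OF inj] n_def)
    have reindex: "(\<Sum>s\<in>S. g s) = (\<Sum>x\<in>X. g (x\<^sup>2))" for g :: "real \<Rightarrow> real"
      by (simp add: S_def sum.reindex[OF inj])
    have np: "(\<Prod>k\<in>X-{x}. k\<^sup>2 - x\<^sup>2) = - node_prod S (x\<^sup>2)" if x: "x \<in> X" for x
    proof -
      have "S - {x\<^sup>2} = (\<lambda>x. x\<^sup>2) ` (X - {x})" using inj x by (auto simp: S_def inj_on_def)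
      then have "node_prod S (x\<^sup>2) = (\<Prod>k\<in>X-{x}. x\<^sup>2 - k\<^sup>2)"
        unfolding node_prod_def
        by (simp add: prod.reindex[OF inj_on_subset[OF inj Diff_subset]])
      also have "\<dots> = (\<Prod>k\<in>X-{x}. - 1) * (\<Prod>k\<in>X-{x}. k\<^sup>2 - x\<^sup>2)"
        unfolding prod.distrib[symmetric] by simp
      also have "(\<Prod>k\<in>X-{x}. - 1) = (- 1 :: real)"
        using X x False by (simp add: card_gt_0_iff)
      finally show ?thesis by simp
    qed
    have "kwong_form ?F c X = (\<Sum>x\<in>X. - (H (x\<^sup>2) * (poly E (x\<^sup>2))\<^sup>2 / (node_prod S (x\<^sup>2) * x\<^sup>2))
        + H (x\<^sup>2) * (poly D (x\<^sup>2))\<^sup>2 / node_prod S (x\<^sup>2))"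
      unfolding kwong_form_eq_weighted_sum
    proof (intro sum.cong refl)
      fix x assume x: "x \<in> X"
      define U where "U = 2 * c x * (\<Sum>y\<in>X. c y / (x + y))"
      define N where "N = node_prod S (x\<^sup>2)"
      have N: "N \<noteq> 0" unfolding N_def by (rule node_prod_nonzero[OF S(1)])
      have "poly Q x * poly Q (- x) = U * x * (- N)"
        unfolding U_def N_def np[OF x, symmetric]
        by (rule kwong_weight_eq_product[OF X(1,2) Q x])
      also have "poly Q x * poly Q (- x) = (poly E (x\<^sup>2))\<^sup>2 - x\<^sup>2 * (poly D (x\<^sup>2))\<^sup>2"
        unfolding ED(3) by (simp add: power2_eq_square algebra_simps)
      finally have "((poly E (x\<^sup>2))\<^sup>2 - x\<^sup>2 * (poly D (x\<^sup>2))\<^sup>2) = U * x * (- N)" .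
      then have Ueq: "U = ((poly E (x\<^sup>2))\<^sup>2 - x\<^sup>2 * (poly D (x\<^sup>2))\<^sup>2) / (- (x * N))"
        using N pos[OF x] by (simp add: field_simps)
      have "U * (H (x\<^sup>2) / x) = - (H (x\<^sup>2) * (poly E (x\<^sup>2))\<^sup>2 / (N * x\<^sup>2))
        + H (x\<^sup>2) * (poly D (x\<^sup>2))\<^sup>2 / N"
      proof -
        have "(e - x\<^sup>2 * d) / (- (x * N)) * (h / x) = - (h * e / (N * x\<^sup>2)) + h * d / N" for e d h
          using N pos[OF x] by (simp add: field_simps power2_eq_square)
        then show ?thesis unfolding Ueq by blast
      qed
      then show "2 * c x * (\<Sum>y\<in>X. c y / (x + y)) * (H (x\<^sup>2) / x) =
          - (H (x\<^sup>2) * (poly E (x\<^sup>2))\<^sup>2 / (node_prod S (x\<^sup>2) * x\<^sup>2))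
          + H (x\<^sup>2) * (poly D (x\<^sup>2))\<^sup>2 / node_prod S (x\<^sup>2)"
        unfolding U_def N_def .
    qed
    also have "\<dots> = - (\<Sum>s\<in>S. H s * (poly E s)\<^sup>2 / (node_prod S s * s))
        + (\<Sum>s\<in>S. H s * (poly D s)\<^sup>2 / node_prod S s)"
      unfolding sum.distrib sum_negf reindex ..
    finally show ?thesis
      using divided_difference_limits(1)[OF inf mono H S(1-3), of E] divided_difference_limits(2)[OF inf mono H S(1-3), of D]
        ED S(4) by simp
  qed (simp add: kwong_form_def)
  show ?thesis
    unfolding kwong_kernel_def
  proof (intro allI impI)
    fix X c assume X: "finite X" "X \<subseteq> {0::real<..}"
    show "0 \<le> kwong_form ?F c X"
    proof (cases "even (card X)")
      case True
      then show ?thesis using even_case X by blast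
    next
      case False
      have "infinite {0::real<..}" by (rule infinite_Ioi)
      then obtain y where y: "0 < y" "y \<notin> X" using X(1) by (metis finite_subset greaterThan_iff subsetI)
      define c' where "c' = c(y := 0)"
      have "kwong_form ?F c' (insert y X) = kwong_form ?F c X"
      proof -
        have eq: "c' x = c x" if "x \<in> X" for x using that y by (auto simp: c'_def)
        have "c' y = 0" by (simp add: c'_def)
        then have "kwong_form ?F c' (insert y X) = kwong_form ?F c' X"
          unfolding kwong_form_def using X(1) y(2) by simp
        also have "\<dots> = kwong_form ?F c X"
          unfolding kwong_form_def by (intro sum.cong refl) (simp add: eq)
        finally show ?thesis .
      qed
      moreover have "0 \<le> kwong_form ?F c' (insert y X)"
        by (rule even_case) (use X y False in auto)
      ultimately show ?thesis by simp
    qed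
  qed
qed


section \<open>Kwong functions and Kwong kernels\<close>

lemma kwong_kernel_of_kwong_function:
  assumes "kwong_function f"
  shows "kwong_kernel f"
  unfolding kwong_kernel_def
proof (intro allI impI)
  fix X c assume X: "finite X" "X \<subseteq> {0::real<..}"
  define n where "n = card X"
  obtain x where x: "bij_betw x {0..<n} X" using ex_bij_betw_nat_finite[OF X(1)] n_def by blast
  then have x: "bij_betw x {..<n} X" by (simp add: atLeast0LessThan)
  let ?K = "\<lambda>i j. (f (x i) + f (x j)) / (x i + x j)"
  have "\<forall>i<n. 0 < x i" using x X(2) by (force simp: bij_betw_def)
  then have "positive_matrix n ?K"
    using assms x unfolding kwong_function_def bij_betw_def by blast
  then have "(\<Sum>i<n. (\<Sum>j<n. complex_of_real (?K i j) * complex_of_real (c (x j)))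
      * cnj (complex_of_real (c (x i)))) \<in> \<real>\<^sub>\<ge>\<^sub>0"
    unfolding positive_matrix_def by (rule allE[where x="\<lambda>i. complex_of_real (c (x i))"])
  also have "(\<Sum>i<n. (\<Sum>j<n. complex_of_real (?K i j) * complex_of_real (c (x j)))
      * cnj (complex_of_real (c (x i)))) =
      complex_of_real (\<Sum>i<n. \<Sum>j<n. c (x i) * c (x j) * ?K i j)"
    unfolding of_real_sum sum_distrib_right by (intro sum.cong refl) simp
  also have "(\<Sum>i<n. \<Sum>j<n. c (x i) * c (x j) * ?K i j) = kwong_form f c X"
    unfolding kwong_form_def sum.reindex_bij_betw[OF x, symmetric] ..
  finally show "0 \<le> kwong_form f c X" by (simp add: complex_nonneg_Reals_iff)
qed

lemma kwong_function_of_kwong_kernel: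
  assumes f: "continuous_on {0<..} f" "kwong_kernel f"
  shows "kwong_function f"
  unfolding kwong_function_def positive_matrix_def
proof (intro conjI allI impI f(1))
  fix n and x :: "nat \<Rightarrow> real" and c :: "nat \<Rightarrow> complex"
  assume pos: "\<forall>i<n. 0 < x i" and inj: "inj_on x {..<n}"
  define K where "K i j = (f (x i) + f (x j)) / (x i + x j)" for i j
  have sym: "K i j = K j i" for i j by (simp add: K_def add.commute)
  define X where "X = x ` {..<n}"
  have bij: "bij_betw x {..<n} X" using inj by (simp add: X_def bij_betw_def)
  have X: "finite X" "X \<subseteq> {0<..}" using pos by (auto simp: X_def)
  have real: "0 \<le> (\<Sum>i<n. \<Sum>j<n. a i * a j * K i j)" for a :: "nat \<Rightarrow> real"
  proof -
    define b where "b y = a (inv_into {..<n} x y)" for y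
    have b: "b (x i) = a i" if "i < n" for i using inv_into_f_f[OF inj] that by (simp add: b_def)
    have "(\<Sum>i<n. \<Sum>j<n. a i * a j * K i j) = (\<Sum>i<n. \<Sum>j<n. b (x i) * b (x j) * K i j)"
      by (intro sum.cong refl) (simp add: b)
    also have "\<dots> = kwong_form f b X"
      unfolding kwong_form_def K_def sum.reindex_bij_betw[OF bij, symmetric] ..
    finally show ?thesis using kwong_kernelD[OF f(2) X, of b] by simp
  qed
  define Z where "Z = (\<Sum>i<n. (\<Sum>j<n. complex_of_real (K i j) * c j) * cnj (c i))"
  have "Re Z = (\<Sum>i<n. \<Sum>j<n. Re (c i) * Re (c j) * K i j) + (\<Sum>i<n. \<Sum>j<n. Im (c i) * Im (c j) * K i j)"
    by (simp add: Z_def sum_distrib_right sum_distrib_left flip: sum.distrib) (simp add: algebra_simps)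
  then have "0 \<le> Re Z" using real[of "\<lambda>i. Re (c i)"] real[of "\<lambda>i. Im (c i)"] by simp
  moreover have "Im Z = (\<Sum>i<n. \<Sum>j<n. K i j * Im (c j) * Re (c i)) - (\<Sum>i<n. \<Sum>j<n. K i j * Re (c j) * Im (c i))"
    by (simp add: Z_def sum_distrib_right flip: sum_subtractf)
  moreover have "(\<Sum>i<n. \<Sum>j<n. K i j * Im (c j) * Re (c i)) = (\<Sum>i<n. \<Sum>j<n. K i j * Re (c j) * Im (c i))"
    by (subst sum.swap) (intro sum.cong refl, simp add: sym mult_ac)
  ultimately show "(\<Sum>i<n. (\<Sum>j<n. complex_of_real ((f (x i) + f (x j)) / (x i + x j)) * c j) * cnj (c i)) \<in> \<real>\<^sub>\<ge>\<^sub>0"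
    unfolding K_def[symmetric] Z_def[symmetric] by (simp add: complex_nonneg_Reals_iff)
qed


section \<open>General exponents\<close>

theorem theorem3p1:
  fixes f :: "real \<Rightarrow> real"
  assumes "continuous_on {0<..} f"
  shows
    "(infinite_dimensional TYPE('h::complex_hilbert_space) \<longrightarrow>
       (\<forall>p::real. p \<ge> 1/2 \<longrightarrow>
          nonneg_on {0<..} (\<lambda>x. x powr p * f (x powr p)) \<longrightarrow>
          operator_monotone_on TYPE('h) {0<..} (\<lambda>x. x powr p * f (x powr p)) \<longrightarrow>
          kwong_function f))
     \<and> (\<forall>p::real. kwong_function f \<longrightarrow> 0 \<le> p \<longrightarrow> p \<le> 1/2 \<longrightarrow>
          nonneg_on {0<..} (\<lambda>x. x powr p * f (x powr p)) \<and>
          operator_monotone_on TYPE('h) {0<..} (\<lambda>x. x powr p * f (x powr p)))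
     \<and> (\<forall>p::real. kwong_function f \<longrightarrow> 0 \<le> p \<longrightarrow> p \<le> 1/2 \<longrightarrow>
          nonneg_on {0<..} (\<lambda>x. f (x powr p) / x powr p) \<and>
          operator_monotone_decreasing_on TYPE('h) {0<..} (\<lambda>x. f (x powr p) / x powr p))"
proof (intro conjI impI allI)
  fix p :: real
  assume inf: "infinite_dimensional TYPE('h)" and p: "1/2 \<le> p"
    and nn: "nonneg_on {0<..} (\<lambda>x. x powr p * f (x powr p))"
    and mono: "operator_monotone_on TYPE('h) {0<..} (\<lambda>x. x powr p * f (x powr p))"
  \<comment> \<open>The exponent \<open>r \<le> 1\<close> undoes the substitution \<open>y \<mapsto> y powr (2 * p)\<close> in the function of exponent \<open>1/2\<close>.\<close>
  define r where "r = 1 / (2 * p)"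
  have r: "0 < r" "r \<le> 1" "2 * (r * p) = 1" using p by (auto simp: r_def field_simps)
  have "kwong_kernel (\<lambda>y. (y\<^sup>2) powr p * f ((y\<^sup>2) powr p) / y)"
    by (rule kwong_kernel_of_operator_monotone[OF inf mono]) (use nn in \<open>auto simp: nonneg_on_def\<close>)
  then have "kwong_kernel (\<lambda>y. y powr (r - 1) *
      (((y powr r)\<^sup>2) powr p * f (((y powr r)\<^sup>2) powr p) / (y powr r)))"
    by (rule kwong_kernel_powr_comp) (use r in auto)
  then have "kwong_kernel f"
  proof (rule kwong_kernel_cong)
    fix y :: real assume y: "0 < y"
    have "((y powr r)\<^sup>2) powr p = y powr (2 * (r * p))"
      using y by (simp add: powr_power powr_powr mult_ac)
    then have "((y powr r)\<^sup>2) powr p = y" using y r(3) by simp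
    then show "y powr (r - 1) * (((y powr r)\<^sup>2) powr p * f (((y powr r)\<^sup>2) powr p) / (y powr r)) = f y"
      using y by (simp add: powr_diff)
  qed
  then show "kwong_function f" by (rule kwong_function_of_kwong_kernel[OF assms])
next
  fix p :: real
  assume kw: "kwong_function f" and p: "0 \<le> p" "p \<le> 1/2"
  note kern = kwong_kernel_of_kwong_function[OF kw]
  show "nonneg_on {0<..} (\<lambda>x. x powr p * f (x powr p))"
    "nonneg_on {0<..} (\<lambda>x. f (x powr p) / x powr p)"
    using kwong_kernel_nonneg[OF kern] by (auto simp: nonneg_on_def)
  have cont: "continuous_on {0<..} (\<lambda>x. f (x powr q))" for q
    by (rule continuous_on_compose2[OF assms]) (auto intro!: continuous_intros)
  \<comment> \<open>Both functions have the form of exponent \<open>1/2\<close> for \<open>G\<close>, with \<open>e = 2 * p - 1\<close> or \<open>e = 1 - 2 * p\<close>.\<close>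
  define G where "G e y = y powr e * f (y powr (2 * p))" for e y
  have G: "continuous_on {0<..} (G e)" for e
    unfolding G_def by (intro continuous_on_mult cont) (auto intro!: continuous_intros)
  have Gk: "kwong_kernel (G (2 * p - 1))" "kwong_kernel (G (1 - 2 * p))"
    unfolding G_def by (rule kwong_kernel_powr_comp[OF kern]; use p in auto)+
  have sq: "sqrt t powr (2 * p) = t powr p" "sqrt t powr (2 * p - 1) = t powr p / sqrt t"
    "sqrt t powr (1 - 2 * p) = sqrt t / t powr p" if "0 < t" for t
    using that by (auto simp: powr_half_sqrt[symmetric] powr_powr powr_diff)
  have inc: "t * (G (2 * p - 1) (sqrt t) / sqrt t) = t powr p * f (t powr p)" if "0 < t" for t
  proof -
    have "t * (t powr p / sqrt t * f (t powr p) / sqrt t) = t / (sqrt t * sqrt t) * (t powr p * f (t powr p))"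
      by simp
    then show ?thesis using that by (simp add: G_def sq)
  qed
  have dec: "G (1 - 2 * p) (sqrt t) / sqrt t = f (t powr p) / t powr p" if "0 < t" for t
    using that by (simp add: G_def sq)
  have eq: "fun_calc h A = fun_calc g A"
    if "op_spectrum A \<subseteq> complex_of_real ` {0<..}" "\<And>t. 0 < t \<Longrightarrow> h t = g t" for A :: "'h \<Rightarrow> 'h" and h g
    by (rule fun_calc_cong) (use that in auto)
  show "operator_monotone_on TYPE('h) {0<..} (\<lambda>x. x powr p * f (x powr p))"
    unfolding operator_monotone_on_def
  proof (intro conjI allI impI)
    fix A B :: "'h \<Rightarrow> 'h"
    assume A: "selfadjoint A" "selfadjoint B" and spec: "op_spectrum A \<subseteq> complex_of_real ` {0<..}"
      "op_spectrum B \<subseteq> complex_of_real ` {0<..}" and le: "op_le A B"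
    show "op_le (fun_calc (\<lambda>x. x powr p * f (x powr p)) A) (fun_calc (\<lambda>x. x powr p * f (x powr p)) B)"
      using op_le_fun_calc_of_kwong(1)[OF A(1) spec(1) A(2) spec(2) le Gk(1) G]
      by (simp only: eq[OF spec(1) inc] eq[OF spec(2) inc])
  qed (intro continuous_on_mult cont, auto intro!: continuous_intros)
  show "operator_monotone_decreasing_on TYPE('h) {0<..} (\<lambda>x. f (x powr p) / x powr p)"
    unfolding operator_monotone_decreasing_on_def
  proof (intro conjI allI impI)
    fix A B :: "'h \<Rightarrow> 'h"
    assume A: "selfadjoint A" "selfadjoint B" and spec: "op_spectrum A \<subseteq> complex_of_real ` {0<..}"
      "op_spectrum B \<subseteq> complex_of_real ` {0<..}" and le: "op_le A B"
    show "op_le (fun_calc (\<lambda>x. f (x powr p) / x powr p) B) (fun_calc (\<lambda>x. f (x powr p) / x powr p) A)"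
      using op_le_fun_calc_of_kwong(2)[OF A(1) spec(1) A(2) spec(2) le Gk(2) G]
      by (simp only: eq[OF spec(1) dec] eq[OF spec(2) dec])
  qed (intro continuous_on_divide cont, auto intro!: continuous_intros)
qed

end
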